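(* Let $(M^m,g)$ be a closed Riemannian manifold of positive scalar curvature and let $n\ge1$. Then $$Y^2(M\times\mathbb{R}^n,g+g_e)=2^{\frac{2}{m+n}}\,Y(M\times\mathbb{R}^n,[g+g_e]).$$ If in addition $(M^m,g)$ has constant scalar curvature, then $$Y^2_{\mathbb{R}^n}(M\times\mathbb{R}^n,g+g_e)=2^{\frac{2}{m+n}}\,Y_{\mathbb{R}^n}(M\times\mathbb{R}^n,g+g_e).$$
   Context: For $k\ge 3$ put $a_k=\frac{4(k-1)}{k-2}$ and $p_k=\frac{2k}{k-2}$. $s_G$ is the scalar curvature of a metric $G$; $g_e$ is the Euclidean metric on $\mathbb{R}^n$. $L^p_{\ge0,c}(X)$ denotes the set of non-negative, compactly supported functions in $L^p(X)$ that are not identically zero. Given $u\ge 0$, $Gr^l_u(C_c^\infty(X))$ (with exponent $p=p_k$, $k$ being the dimension of the total space) is the set of $l$-dimensional subspaces $V=\mathrm{span}(v_1,\dots,v_l)$ of $C^\infty_c(X)$ such that $u^{p-2}v_1,\dots,u^{p-2}v_l$ also span an $l$-dimensional space. For a (possibly non-compact) Riemannian manifold $(W^k,G)$, $$Y(W,[G])=\inf_{u\in C_c^\infty(W)-\{0\}}\frac{\int_W a_k|\nabla u|_G^2+s_Gu^2\,dv_G}{\left(\int_W|u|^{p_k}dv_G\right)^{2/p_k}}.$$ For a complete $(W^k,G)$, not necessarily compact, with $Y(W,[G])>0$, $$Y^l(W,G)=\inf_{\substack{u\in L^{p_k}_{\ge0,c}(W)\\ V\in Gr^l_u(C_c^\infty(W))}}\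 \sup_{v\in V-\{0\}}\frac{\int_W a_k|\nabla v|_G^2+s_Gv^2\,dv_G}{\int_W u^{p_k-2}v^2\,dv_G}\Big(\int_W u^{p_k}dv_G\Big)^{2/k}.$$ For $(M^m,g)$ closed with constant scalar curvature and $(N^n,h)$ non-compact with $Y(M\times N,[g+h])>0$, $$Y^l_N(M\times N,g+h)=\inf_{\substack{u\in L^{p_{m+n}}_{\ge0,c}(N)\\ V\in Gr^l_u(C_c^\infty(N))}}\ \sup_{v\in V-\{0\}}\frac{\int_N a_{m+n}|\nabla v|_h^2+s_{g+h}v^2\,dv_h}{\int_N u^{p_{m+n}-2}v^2\,dv_h}\Big(\int_N u^{p_{m+n}}dv_h\Big)^{\frac{2}{m+n}}\mathrm{vol}(M,g)^{\frac{2}{m+n}},$$ used here with $(N,h)=(\mathbb{R}^n,g_e)$. Finally, $$Y_{\mathbb{R}^n}(M\times\mathbb{R}^n,g+g_e)=\inf_{u\in C_c^\infty(\mathbb{R}^n)-\{0\}}\frac{\int_{M\times\mathbb{R}^n}a_{m+n}|\nabla u|^2_{g+g_e}+s_gu^2\,dv_{g+g_e}}{\left(\int_{M\times\mathbb{R}^n}|u|^{p_{m+n}}dv_{g+g_e}\right)^{2/p_{m+n}}},$$ with functions on $\mathbb{R}^n$ regarded as functions on $M\times\mathbb{R}^n$ depending only on the second variable. *)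

theory Defs
  imports "HOL-Analysis.Analysis"
begin

section \<open>Smooth functions on open subsets of Euclidean space\<close>

text \<open>
  Meaningful for open \<open>S\<close> only. Continuity and differentiability of all iterated directional
  derivatives is the usual notion of a \<open>C\<^sup>k\<close> function.
\<close>

primrec Ck_on :: "nat \<Rightarrow> 'e::euclidean_space set \<Rightarrow> ('e \<Rightarrow> 'f::real_normed_vector) \<Rightarrow> bool" where
  "Ck_on 0 S f \<longleftrightarrow> continuous_on S f"
| "Ck_on (Suc k) S f \<longleftrightarrow>
     (\<forall>y\<in>S. f differentiable (at y)) \<and>
     (\<forall>w. Ck_on k S (\<lambda>y. frechet_derivative f (at y) w))"

definition smooth_on :: "'e::euclidean_space set \<Rightarrow> ('e \<Rightarrow> 'f::real_normed_vector) \<Rightarrow> bool" where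
  "smooth_on S f \<longleftrightarrow> (\<forall>k. Ck_on k S f)"

definition partial :: "'m::finite \<Rightarrow> (real^'m \<Rightarrow> real) \<Rightarrow> real^'m \<Rightarrow> real" where
  "partial i f y = frechet_derivative f (at y) (axis i 1)"

section \<open>Riemannian manifolds\<close>

text \<open>
  The underlying space of a manifold is a whole (Hausdorff, second countable) type \<open>'a\<close>. The smooth
  structure and the metric are given together by an atlas whose charts carry the coefficient matrix
  \<open>(g\<^sub>i\<^sub>j)\<close> of the metric as a function of the coordinates. That these local coefficients define one
  (0,2)-tensor field is the transformation law in \<open>riemannian_manifold\<close>. Values of
  \<open>chart_map c\<close> outside \<open>chart_dom c\<close>, and of \<open>chart_metric c\<close> outside the chart image, are irrelevant.
\<close>

record ('a, 'm) rchart =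
  chart_dom :: "'a set"
  chart_map :: "'a \<Rightarrow> real^'m"
  chart_metric :: "real^'m \<Rightarrow> real^'m^'m"

type_synonym ('a, 'm) riem = "('a, 'm) rchart set"

definition chart_image :: "('a, 'm::finite) rchart \<Rightarrow> (real^'m) set" where
  "chart_image c = chart_map c ` chart_dom c"

definition chart_inv :: "('a, 'm::finite) rchart \<Rightarrow> real^'m \<Rightarrow> 'a" where
  "chart_inv c = inv_into (chart_dom c) (chart_map c)"

definition transition :: "('a, 'm::finite) rchart \<Rightarrow> ('a, 'm) rchart \<Rightarrow> real^'m \<Rightarrow> real^'m" where
  "transition c d = chart_map d \<circ> chart_inv c"

definition riemannian_chart :: "('a::topological_space, 'm::finite) rchart \<Rightarrow> bool" where
  "riemannian_chart c \<longleftrightarrow>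
     open (chart_dom c) \<and> open (chart_image c) \<and>
     homeomorphism (chart_dom c) (chart_image c) (chart_map c) (chart_inv c) \<and>
     smooth_on (chart_image c) (chart_metric c) \<and>
     (\<forall>y\<in>chart_image c. transpose (chart_metric c y) = chart_metric c y \<and>
        (\<forall>w. w \<noteq> 0 \<longrightarrow> w \<bullet> (chart_metric c y *v w) > 0))"

definition compatible_charts :: "('a, 'm::finite) rchart \<Rightarrow> ('a, 'm) rchart \<Rightarrow> bool" where
  "compatible_charts c d \<longleftrightarrow>
     smooth_on (chart_map c ` (chart_dom c \<inter> chart_dom d)) (transition c d) \<and>
     (\<forall>x\<in>chart_dom c \<inter> chart_dom d.
        let J = matrix (frechet_derivative (transition c d) (at (chart_map c x)))
        in chart_metric c (chart_map c x) = transpose J ** chart_metric d (chart_map d x) ** J)"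

definition riemannian_manifold ::
    "('a::{t2_space,second_countable_topology}, 'm::finite) riem \<Rightarrow> bool" where
  "riemannian_manifold A \<longleftrightarrow>
     (\<Union>c\<in>A. chart_dom c) = UNIV \<and>
     (\<forall>c\<in>A. riemannian_chart c) \<and>
     (\<forall>c\<in>A. \<forall>d\<in>A. compatible_charts c d)"

text \<open>Boundaryless, since charts have open image; not required to be connected.\<close>

definition closed_riemannian_manifold ::
    "('a::{t2_space,second_countable_topology}, 'm::finite) riem \<Rightarrow> bool" where
  "closed_riemannian_manifold A \<longleftrightarrow> riemannian_manifold A \<and> compact (UNIV :: 'a set)"

definition euclid :: "(real^'n, 'n::finite) riem" where
  "euclid = {\<lparr>chart_dom = UNIV, chart_map = (\<lambda>x. x), chart_metric = (\<lambda>_. mat 1)\<rparr>}"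

subsection \<open>Riemannian products\<close>

definition join_vec :: "real^'m \<Rightarrow> real^'n \<Rightarrow> real^('m::finite + 'n::finite)" where
  "join_vec a b = (\<chi> i. case i of Inl j \<Rightarrow> a $ j | Inr j \<Rightarrow> b $ j)"

definition left_vec :: "real^('m::finite + 'n::finite) \<Rightarrow> real^'m" where
  "left_vec z = (\<chi> j. z $ Inl j)"

definition right_vec :: "real^('m::finite + 'n::finite) \<Rightarrow> real^'n" where
  "right_vec z = (\<chi> j. z $ Inr j)"

definition block_diag ::
    "real^'m^'m \<Rightarrow> real^'n^'n \<Rightarrow> real^('m::finite + 'n::finite)^('m + 'n)" where
  "block_diag P Q = (\<chi> i j. case (i, j) of
       (Inl k, Inl l) \<Rightarrow> P $ k $ l
     | (Inr k, Inr l) \<Rightarrow> Q $ k $ l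
     | _ \<Rightarrow> 0)"

definition prod_chart ::
    "('a, 'm::finite) rchart \<Rightarrow> ('b, 'n::finite) rchart \<Rightarrow> ('a \<times> 'b, 'm + 'n) rchart" where
  "prod_chart c d =
     \<lparr>chart_dom = chart_dom c \<times> chart_dom d,
      chart_map = (\<lambda>(x, y). join_vec (chart_map c x) (chart_map d y)),
      chart_metric = (\<lambda>z. block_diag (chart_metric c (left_vec z)) (chart_metric d (right_vec z)))\<rparr>"

definition riem_prod ::
    "('a, 'm::finite) riem \<Rightarrow> ('b, 'n::finite) riem \<Rightarrow> ('a \<times> 'b, 'm + 'n) riem" where
  "riem_prod A B = (\<lambda>(c, d). prod_chart c d) ` (A \<times> B)"

subsection \<open>Scalar curvature\<close>

text \<open>
  The local formulas for the Christoffel symbols \<open>\<Gamma>\<^sup>k\<^sub>i\<^sub>j\<close> of the Levi-Civita connection and for the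
  Ricci tensor, with the sign for which round spheres have positive curvature:
  \<open>R\<^sub>i\<^sub>j = \<partial>\<^sub>k \<Gamma>\<^sup>k\<^sub>i\<^sub>j - \<partial>\<^sub>j \<Gamma>\<^sup>k\<^sub>i\<^sub>k + \<Gamma>\<^sup>k\<^sub>k\<^sub>l \<Gamma>\<^sup>l\<^sub>i\<^sub>j - \<Gamma>\<^sup>k\<^sub>j\<^sub>l \<Gamma>\<^sup>l\<^sub>i\<^sub>k\<close>.
\<close>

definition christoffel ::
    "(real^'m \<Rightarrow> real^'m^'m) \<Rightarrow> 'm::finite \<Rightarrow> 'm \<Rightarrow> 'm \<Rightarrow> real^'m \<Rightarrow> real" where
  "christoffel G k i j y =
     (\<Sum>l\<in>UNIV. matrix_inv (G y) $ k $ l *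
        (partial i (\<lambda>z. G z $ j $ l) y + partial j (\<lambda>z. G z $ i $ l) y
          - partial l (\<lambda>z. G z $ i $ j) y)) / 2"

definition ricci :: "(real^'m \<Rightarrow> real^'m^'m) \<Rightarrow> 'm::finite \<Rightarrow> 'm \<Rightarrow> real^'m \<Rightarrow> real" where
  "ricci G i j y =
     (\<Sum>k\<in>UNIV. partial k (christoffel G k i j) y - partial j (christoffel G k i k) y
        + (\<Sum>l\<in>UNIV. christoffel G k k l y * christoffel G l i j y
                     - christoffel G k j l y * christoffel G l i k y))"

definition local_scal :: "(real^'m \<Rightarrow> real^'m^'m::finite) \<Rightarrow> real^'m \<Rightarrow> real" where
  "local_scal G y = (\<Sum>i\<in>UNIV. \<Sum>j\<in>UNIV. matrix_inv (G y) $ i $ j * ricci G i j y)"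

text \<open>
  On a Riemannian manifold, scalar curvature and gradient norm do not depend on the chart around
  the point in which they are computed, so an arbitrary one is chosen.
\<close>

definition chart_at :: "('a, 'm::finite) riem \<Rightarrow> 'a \<Rightarrow> ('a, 'm) rchart" where
  "chart_at A x = (SOME c. c \<in> A \<and> x \<in> chart_dom c)"

definition scal :: "('a, 'm::finite) riem \<Rightarrow> 'a \<Rightarrow> real" where
  "scal A x = (let c = chart_at A x in local_scal (chart_metric c) (chart_map c x))"

subsection \<open>Gradient norm and volume\<close>

text \<open>\<open>|\<nabla>f|\<^sup>2 = g\<^sup>i\<^sup>j \<partial>\<^sub>i f \<partial>\<^sub>j f\<close>\<close>

definition grad_sq :: "('a, 'm::finite) riem \<Rightarrow> ('a \<Rightarrow> real) \<Rightarrow> 'a \<Rightarrow> real" where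
  "grad_sq A f x =
     (let c = chart_at A x; y = chart_map c x
      in \<Sum>i\<in>UNIV. \<Sum>j\<in>UNIV. matrix_inv (chart_metric c y) $ i $ j *
           partial i (f \<circ> chart_inv c) y * partial j (f \<circ> chart_inv c) y)"

text \<open>
  The unique Borel measure which in every chart has density \<open>sqrt (det (g\<^sub>i\<^sub>j))\<close> with respect to
  Lebesgue measure; it exists for every Riemannian manifold, orientable or not.
\<close>

definition vol :: "('a::topological_space, 'm::finite) riem \<Rightarrow> 'a measure" where
  "vol A = (THE \<mu>. sets \<mu> = sets borel \<and>
     (\<forall>c\<in>A. \<forall>B\<in>sets borel. B \<subseteq> chart_dom c \<longrightarrow>
        emeasure \<mu> B =
          (\<integral>\<^sup>+y. ennreal (sqrt (det (chart_metric c y))) * indicator (chart_map c ` B) y \<partial>lborel)))"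

section \<open>Function spaces\<close>

definition supp :: "('a::topological_space \<Rightarrow> real) \<Rightarrow> 'a set" where
  "supp f = closure {x. f x \<noteq> 0}"

definition Cc_smooth :: "('a::topological_space, 'm::finite) riem \<Rightarrow> ('a \<Rightarrow> real) set" where
  "Cc_smooth A = {f. (\<forall>c\<in>A. smooth_on (chart_image c) (f \<circ> chart_inv c)) \<and> compact (supp f)}"

text \<open>
  Elements of \<open>L\<^sup>p\<close> are represented by Borel functions; \<open>not identically zero\<close> refers to the class
  modulo null sets.
\<close>

definition Lp_nonneg_c :: "('a::topological_space, 'm::finite) riem \<Rightarrow> real \<Rightarrow> ('a \<Rightarrow> real) set" where
  "Lp_nonneg_c A p = {u. u \<in> borel_measurable borel \<and> (\<forall>x. u x \<ge> 0) \<and>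
     integrable (vol A) (\<lambda>x. u x powr p) \<and> compact (supp u) \<and>
     \<not> (AE x in vol A. u x = 0)}"

definition lin_comb :: "nat \<Rightarrow> (nat \<Rightarrow> 'a \<Rightarrow> real) \<Rightarrow> (nat \<Rightarrow> real) \<Rightarrow> 'a \<Rightarrow> real" where
  "lin_comb l v a x = (\<Sum>i<l. a i * v i x)"

text \<open>
  \<open>Gr\<^sup>l\<^sub>u\<close> of smooth compactly supported functions, with exponent \<open>p\<close>. Since \<open>u\<close> is an element of
  \<open>L\<^sup>p\<close>, independence of the functions \<open>u\<^sup>p\<^sup>-\<^sup>2 v\<^sub>i\<close> is understood modulo null sets.
\<close>

definition Gr :: "('a::topological_space, 'm::finite) riem \<Rightarrow> real \<Rightarrow> nat \<Rightarrow> ('a \<Rightarrow> real)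
    \<Rightarrow> ('a \<Rightarrow> real) set set" where
  "Gr A p l u = {V. \<exists>v. (\<forall>i<l. v i \<in> Cc_smooth A) \<and> V = range (lin_comb l v) \<and>
     (\<forall>a. (\<forall>x. lin_comb l v a x = 0) \<longrightarrow> (\<forall>i<l. a i = 0)) \<and>
     (\<forall>a. (AE x in vol A. lin_comb l (\<lambda>i x. u x powr (p - 2) * v i x) a x = 0)
            \<longrightarrow> (\<forall>i<l. a i = 0))}"

section \<open>Yamabe constants\<close>

text \<open>Infima and suprema are taken in the extended reals, so that they always exist.\<close>

definition yam_a :: "nat \<Rightarrow> real" where
  "yam_a k = 4 * (real k - 1) / (real k - 2)"

definition yam_p :: "nat \<Rightarrow> real" where
  "yam_p k = 2 * real k / (real k - 2)"

definition yamabe_const :: "('a::topological_space, 'k::finite) riem \<Rightarrow> ereal" where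
  "yamabe_const W = (let k = CARD('k); p = yam_p k in
     INF u \<in> Cc_smooth W - {\<lambda>_. 0}. ereal (
       (\<integral>x. yam_a k * grad_sq W u x + scal W x * (u x)\<^sup>2 \<partial>vol W) /
       (\<integral>x. \<bar>u x\<bar> powr p \<partial>vol W) powr (2 / p)))"

text \<open>\<open>Y\<^sup>l(W, G)\<close>, to be used for complete \<open>W\<close> with positive Yamabe constant.\<close>

definition yamabe_l :: "nat \<Rightarrow> ('a::topological_space, 'k::finite) riem \<Rightarrow> ereal" where
  "yamabe_l l W = (let k = CARD('k); p = yam_p k in
     INF u \<in> Lp_nonneg_c W p. INF V \<in> Gr W p l u. SUP v \<in> V - {\<lambda>_. 0}. ereal (
       (\<integral>x. yam_a k * grad_sq W v x + scal W x * (v x)\<^sup>2 \<partial>vol W) /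
       (\<integral>x. u x powr (p - 2) * (v x)\<^sup>2 \<partial>vol W) *
       (\<integral>x. u x powr p \<partial>vol W) powr (2 / real k)))"

text \<open>
  \<open>Y\<^sup>l\<^sub>N(M \<times> N, g + h)\<close>, for closed \<open>M\<close> of constant scalar curvature. The scalar curvature of
  \<open>g + h\<close> is then a function on \<open>N\<close>: it is evaluated at \<open>undefined\<close>, an arbitrary point of \<open>M\<close>.
\<close>

definition yamabe_l_N ::
    "nat \<Rightarrow> ('a::topological_space, 'm::finite) riem \<Rightarrow> ('b::topological_space, 'n::finite) riem
      \<Rightarrow> ereal" where
  "yamabe_l_N l M N = (let k = CARD('m) + CARD('n); p = yam_p k in
     INF u \<in> Lp_nonneg_c N p. INF V \<in> Gr N p l u. SUP v \<in> V - {\<lambda>_. 0}. ereal (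
       (\<integral>y. yam_a k * grad_sq N v y + scal (riem_prod M N) (undefined, y) * (v y)\<^sup>2 \<partial>vol N) /
       (\<integral>y. u y powr (p - 2) * (v y)\<^sup>2 \<partial>vol N) *
       (\<integral>y. u y powr p \<partial>vol N) powr (2 / real k) *
       measure (vol M) UNIV powr (2 / real k)))"

text \<open>
  The Yamabe constant of \<open>M \<times> R^n\<close> restricted to functions on \<open>R^n\<close>; the second argument only
  serves to fix the dimension \<open>n\<close>.
\<close>

definition yamabe_const_Rn ::
    "('a::topological_space, 'm::finite) riem \<Rightarrow> 'n::finite itself \<Rightarrow> ereal" where
  "yamabe_const_Rn M _ = (let
       k = CARD('m) + CARD('n); p = yam_p k;
       W = riem_prod M (euclid :: (real^'n, 'n) riem)
     in INF u \<in> Cc_smooth (euclid :: (real^'n, 'n) riem) - {\<lambda>_. 0}. ereal (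
       (\<integral>z. yam_a k * grad_sq W (u \<circ> snd) z + scal M (fst z) * (u (snd z))\<^sup>2 \<partial>vol W) /
       (\<integral>z. \<bar>u (snd z)\<bar> powr p \<partial>vol W) powr (2 / p)))"

end

theory Submission
  imports Defs
begin

text \<open>
  Write \<open>k = m + n\<close>, \<open>p = 2 k / (k - 2)\<close>, and let \<open>E v\<close> be the integral of \<open>a \<bar>\<nabla>v\<bar>\<^sup>2 + s v\<^sup>2\<close>. Since \<open>s\<close> is
  positive, \<open>E\<close> is non-negative. The second Yamabe constant is an infimum over a weight \<open>u\<close> and a plane
  of test functions, and the claim is that the best weight consists of two far apart copies of an
  almost optimal function for the Yamabe constant \<open>Y\<close>.

  Upper bound (\<open>second_upper_bound\<close>). Translations of the Euclidean factor move the support of a test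
  function \<open>v\<close> off itself. With a translate \<open>v'\<close> of disjoint support, the weight \<open>\<bar>v\<bar> + \<bar>v'\<bar>\<close> and the plane
  spanned by \<open>v\<close> and \<open>v'\<close> give exactly \<open>2\<^sup>2\<^sup>/\<^sup>k\<close> times the Yamabe quotient of \<open>v\<close>.

  Lower bound (\<open>nodal_splitting\<close>, \<open>second_lower_bound\<close>). Let every function of a plane have Rayleigh
  quotient below \<open>\<kappa>\<close>. No spectral theory is needed to find one whose positive and negative
  parts both have quotient below \<open>\<kappa>\<close>: consider \<open>v\<^sub>t = cos t v\<^sub>0 + sin t v\<^sub>1\<close> and the function
  \<open>f t = E (v\<^sub>t\<^sup>+) - \<kappa> \<integral> u\<^sup>p\<^sup>-\<^sup>2 (v\<^sub>t\<^sup>+)\<^sup>2\<close>. Its values at antipodal points belong to the positive and the negative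
  part of the same function, so their sum is negative. By the intermediate value theorem there are
  antipodal points with equal values, and these are then both negative. Replacing the positive part
  by the smooth function \<open>pos_cut\<close> keeps the two pieces in the space of test functions; the error is
  small, uniformly in \<open>t\<close>, and is absorbed by the gap below \<open>\<kappa>\<close>. One of the two pieces meets at most
  half of \<open>\<integral> u\<^sup>p\<close>, and Hoelder's inequality for that piece gives \<open>2\<^sup>2\<^sup>/\<^sup>k Y \<le> \<kappa> (\<integral> u\<^sup>p)\<^sup>2\<^sup>/\<^sup>k\<close>.

  Both parts of the theorem are instances of this argument (locale \<open>yamabe_data\<close>): the first on the
  product manifold, the second on Euclidean space, where the volume of the closed factor enters as
  a constant.

  The definitions of scalar curvature, gradient norm and volume involve a choice of charts or a
  unique description, and most of the text shows that these are harmless. The curvature of a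
  metric is invariant under changes of coordinates because the Christoffel symbols undergo a
  gauge transformation, under which curvature is conjugated (\<open>chr_transform\<close>, \<open>curv_gauge\<close>,
  \<open>local_scal_transform\<close>). The volume exists because the chart densities match under the change
  of variables formula (\<open>chart_vol_compatible\<close>, \<open>volume_spec_exists\<close>). For the product with Euclidean
  space, the scalar curvature is that of the closed factor (\<open>scal_times\<close>) and the volume is the
  product measure (\<open>vol_times\<close>).
\<close>

section \<open>Calculus of \<open>C\<^sup>k\<close> functions\<close>

lemma frechet_derivative_cong_open:
  assumes "open S" "y \<in> S" "\<And>z. z \<in> S \<Longrightarrow> f z = g z"
  shows "frechet_derivative f (at y) = frechet_derivative g (at y)"
    and "f differentiable (at y) \<longleftrightarrow> g differentiable (at y)"
proof -
  have "(f has_derivative D) (at y) \<longleftrightarrow> (g has_derivative D) (at y)" for D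
    using has_derivative_transform_within_open[OF _ assms(1,2), of f D UNIV g]
      has_derivative_transform_within_open[OF _ assms(1,2), of g D UNIV f] assms(3) by auto
  then show "frechet_derivative f (at y) = frechet_derivative g (at y)"
    and "f differentiable (at y) \<longleftrightarrow> g differentiable (at y)"
    by (auto simp: frechet_derivative_def differentiable_def)
qed

lemma partial_cong_open:
  assumes "open S" "y \<in> S" "\<And>z. z \<in> S \<Longrightarrow> f z = g z"
  shows "partial i f y = partial i g y"
  unfolding partial_def using frechet_derivative_cong_open(1)[OF assms] by simp

lemma Ck_on_cong:
  assumes "open S" "\<And>y. y \<in> S \<Longrightarrow> f y = g y"
  shows "Ck_on k S f \<longleftrightarrow> Ck_on k S g"
  using assms(2)
proof (induction k arbitrary: f g)
  case 0
  then show ?case by (simp cong: continuous_on_cong)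
next
  case (Suc k)
  have "Ck_on k S (\<lambda>y. frechet_derivative f (at y) w) \<longleftrightarrow>
      Ck_on k S (\<lambda>y. frechet_derivative g (at y) w)" for w
    by (rule Suc.IH) (use frechet_derivative_cong_open(1)[OF assms(1) _ Suc.prems] in auto)
  then show ?case
    using frechet_derivative_cong_open(2)[OF assms(1) _ Suc.prems] by auto
qed

lemma Ck_on_SucD:
  assumes "Ck_on (Suc k) S f" "y \<in> S"
  shows "(f has_derivative frechet_derivative f (at y)) (at y)"
  using assms by (simp add: frechet_derivative_works)

lemma Ck_on_SucI:
  assumes "open S" "\<And>y. y \<in> S \<Longrightarrow> (f has_derivative f' y) (at y)"
    and "\<And>w. Ck_on k S (\<lambda>y. f' y w)"
  shows "Ck_on (Suc k) S f"
proof -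
  have "frechet_derivative f (at y) = f' y" if "y \<in> S" for y
    using assms(2)[OF that] by (rule frechet_derivative_at[symmetric])
  then have "Ck_on k S (\<lambda>y. frechet_derivative f (at y) w)" for w
    using assms(3)[of w] Ck_on_cong[OF assms(1), of "\<lambda>y. frechet_derivative f (at y) w" "\<lambda>y. f' y w"]
    by simp
  then show ?thesis using assms(2) by (auto simp: differentiable_def)
qed

lemma Ck_on_Suc_imp: "Ck_on (Suc k) S f \<Longrightarrow> Ck_on k S f"
proof (induction k arbitrary: f)
  case 0
  then show ?case
    by (auto intro!: continuous_at_imp_continuous_on differentiable_imp_continuous_within)
next
  case (Suc k)
  then show ?case by (metis Ck_on.simps(2))
qed

lemma Ck_on_continuous: "Ck_on k S f \<Longrightarrow> continuous_on S f"
  by (induction k) (use Ck_on_Suc_imp in auto)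

lemma Ck_on_subset:
  assumes "Ck_on k S f" "T \<subseteq> S"
  shows "Ck_on k T f"
  using assms
proof (induction k arbitrary: f)
  case 0
  then show ?case by (auto intro: continuous_on_subset)
next
  case (Suc k)
  then show ?case by auto
qed

lemma Ck_on_const: "open S \<Longrightarrow> Ck_on k S (\<lambda>y. c)"
proof (induction k arbitrary: c)
  case (Suc k)
  then show ?case by (intro Ck_on_SucI[where f' = "\<lambda>y w. 0"]) auto
qed simp

lemma Ck_on_linear:
  assumes "open S" "bounded_linear L"
  shows "Ck_on k S L"
proof (cases k)
  case 0
  then show ?thesis using assms by (simp add: linear_continuous_on)
next
  case (Suc j)
  show ?thesis unfolding Suc
    by (intro Ck_on_SucI[where f' = "\<lambda>y. L"] Ck_on_const assms)
      (auto intro: bounded_linear_imp_has_derivative assms)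
qed

lemma Ck_on_compose_linear:
  assumes "open S" "bounded_linear L" "Ck_on k S f"
  shows "Ck_on k S (\<lambda>y. L (f y))"
  using assms(3)
proof (induction k arbitrary: f)
  case 0
  then show ?case using assms(2) by (simp add: linear_continuous_on_compose bounded_linear.continuous_on)
next
  case (Suc k)
  show ?case
    by (intro Ck_on_SucI[where f' = "\<lambda>y w. L (frechet_derivative f (at y) w)"] assms)
      (use Suc in \<open>auto intro!: bounded_linear.has_derivative[OF assms(2)] Ck_on_SucD\<close>)
qed

lemma Ck_on_add:
  assumes "open S" "Ck_on k S f" "Ck_on k S g"
  shows "Ck_on k S (\<lambda>y. f y + g y)"
  using assms(2,3)
proof (induction k arbitrary: f g)
  case 0
  then show ?case by (auto intro: continuous_intros)
next
  case (Suc k)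
  show ?case
    by (intro Ck_on_SucI[where f' = "\<lambda>y w. frechet_derivative f (at y) w + frechet_derivative g (at y) w"] assms)
      (use Suc in \<open>auto intro!: has_derivative_add Ck_on_SucD\<close>)
qed

lemma Ck_on_bilinear:
  assumes "open S" "bounded_bilinear h" "Ck_on k S f" "Ck_on k S g"
  shows "Ck_on k S (\<lambda>y. h (f y) (g y))"
  using assms(3,4)
proof (induction k arbitrary: f g)
  case 0
  then show ?case by (auto intro: bounded_bilinear.continuous_on[OF assms(2)])
next
  case (Suc k)
  note Suc' = Suc.prems[THEN Ck_on_Suc_imp]
  show ?case
    by (intro Ck_on_SucI[where f' = "\<lambda>y w. h (f y) (frechet_derivative g (at y) w) +
          h (frechet_derivative f (at y) w) (g y)"] assms bounded_bilinear.FDERIV[OF assms(2)] Ck_on_add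
          Suc.IH Suc')
      (use Suc.prems in \<open>auto intro!: Ck_on_SucD\<close>)
qed

lemmas Ck_on_mult = Ck_on_bilinear[OF _ bounded_bilinear_mult]
lemmas Ck_on_scaleR = Ck_on_bilinear[OF _ bounded_bilinear_scaleR]

lemma Ck_on_minus: "open S \<Longrightarrow> Ck_on k S f \<Longrightarrow> Ck_on k S (\<lambda>y. - f y)"
  using Ck_on_compose_linear[OF _ bounded_linear_minus[OF bounded_linear_ident]] by blast

lemma Ck_on_diff: "open S \<Longrightarrow> Ck_on k S f \<Longrightarrow> Ck_on k S g \<Longrightarrow> Ck_on k S (\<lambda>y. f y - g y)"
  using Ck_on_add[OF _ _ Ck_on_minus] by fastforce

lemma Ck_on_sum: "open S \<Longrightarrow> (\<And>i. i \<in> I \<Longrightarrow> Ck_on k S (f i)) \<Longrightarrow> Ck_on k S (\<lambda>y. \<Sum>i\<in>I. f i y)"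
  by (induction I rule: infinite_finite_induct) (auto intro: Ck_on_const Ck_on_add)

lemma Ck_on_prod:
  fixes f :: "'i \<Rightarrow> 'e::euclidean_space \<Rightarrow> real"
  shows "open S \<Longrightarrow> (\<And>i. i \<in> I \<Longrightarrow> Ck_on k S (f i)) \<Longrightarrow> Ck_on k S (\<lambda>y. \<Prod>i\<in>I. f i y)"
  by (induction I rule: infinite_finite_induct) (auto intro: Ck_on_const Ck_on_mult)

lemma Ck_on_vec_nth: "open S \<Longrightarrow> Ck_on k S f \<Longrightarrow> Ck_on k S (\<lambda>y. f y $ i)"
  by (rule Ck_on_compose_linear[OF _ bounded_linear_vec_nth])

lemma Ck_on_vec_lambda:
  fixes f :: "'i::finite \<Rightarrow> 'e::euclidean_space \<Rightarrow> real"
  assumes "open S" "\<And>i. Ck_on k S (f i)"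
  shows "Ck_on k S (\<lambda>y. \<chi> i. f i y)"
proof -
  have "(\<lambda>y. \<chi> i. f i y) = (\<lambda>y. \<Sum>i\<in>UNIV. f i y *\<^sub>R axis i 1)"
    by (rule ext) (simp add: vec_eq_iff axis_def if_distrib cong: if_cong)
  then show ?thesis by (simp add: Ck_on_sum Ck_on_scaleR Ck_on_const assms)
qed

lemma Ck_on_matrix:
  fixes f :: "'i::finite \<Rightarrow> 'j::finite \<Rightarrow> 'e::euclidean_space \<Rightarrow> real"
  assumes "open S" "\<And>i j. Ck_on k S (f i j)"
  shows "Ck_on k S (\<lambda>y. \<chi> i j. f i j y)"
proof -
  have bl: "bounded_linear (\<lambda>v::real^'j. axis i v :: real^'j^'i)" for i
    unfolding linear_conv_bounded_linear[symmetric]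
    by (rule linearI) (simp_all add: vec_eq_iff axis_def)
  have "(\<lambda>y. \<chi> i j. f i j y) = (\<lambda>y. \<Sum>i\<in>UNIV. axis i (\<chi> j. f i j y))"
    by (rule ext) (simp add: vec_eq_iff axis_def if_distrib[of "\<lambda>v. v $ _"] cong: if_cong)
  then show ?thesis
    by (simp add: Ck_on_sum Ck_on_compose_linear[OF _ bl] Ck_on_vec_lambda assms)
qed

text \<open>Linear substitutions are what is needed for functions of one block of coordinates of a product.\<close>

lemma Ck_on_precompose_linear:
  assumes "open S" "open T" "bounded_linear L" "L ` T \<subseteq> S" "Ck_on k S f"
  shows "Ck_on k T (\<lambda>z. f (L z))"
  using assms(5)
proof (induction k arbitrary: f)
  case 0
  then show ?case
    using assms continuous_on_compose2[of S f T L] by (simp add: linear_continuous_on)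
next
  case (Suc k)
  show ?case
  proof (intro Ck_on_SucI[where f' = "\<lambda>z w. frechet_derivative f (at (L z)) (L w)"] assms)
    fix z assume "z \<in> T"
    then have "(f has_derivative frechet_derivative f (at (L z))) (at (L z))"
      using Suc.prems assms(4) by (auto intro!: Ck_on_SucD)
    then show "((\<lambda>z. f (L z)) has_derivative (\<lambda>w. frechet_derivative f (at (L z)) (L w))) (at z)"
      using bounded_linear_imp_has_derivative[OF assms(3)] by (rule has_derivative_compose[rotated])
  qed (use Suc in auto)
qed

text \<open>
  A family of real functions that is closed under differentiation expresses smoothness without
  naming the successive derivatives; by the chain rule the induction never leaves the family.
\<close>

lemma Ck_on_compose_real:
  fixes f :: "'e::euclidean_space \<Rightarrow> real"
  assumes "open S" "f ` S \<subseteq> T" and F: "\<And>\<phi>. \<phi> \<in> F \<Longrightarrow> \<exists>\<psi>\<in>F. \<forall>t\<in>T. (\<phi> has_real_derivative \<psi> t) (at t)"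
    and "Ck_on k S f" "\<phi> \<in> F"
  shows "Ck_on k S (\<lambda>y. \<phi> (f y))"
  using assms(4,5)
proof (induction k arbitrary: \<phi>)
  case 0
  obtain \<psi> where "\<forall>t\<in>T. (\<phi> has_real_derivative \<psi> t) (at t)" using F[OF 0(2)] by blast
  then have "continuous_on T \<phi>"
    by (intro continuous_at_imp_continuous_on ballI) (auto intro: DERIV_isCont)
  then show ?case using 0 assms(2) by (auto intro!: continuous_on_compose2[of T \<phi>])
next
  case (Suc k)
  obtain \<psi> where \<psi>: "\<psi> \<in> F" "\<forall>t\<in>T. (\<phi> has_real_derivative \<psi> t) (at t)" using F[OF Suc.prems(2)] by blast
  show ?case
  proof (intro Ck_on_SucI[where f' = "\<lambda>z w. frechet_derivative f (at z) w * \<psi> (f z)"] assms Ck_on_mult)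
    fix y assume y: "y \<in> S"
    then have "(\<phi> has_derivative (\<lambda>h. h * \<psi> (f y))) (at (f y))"
      using \<psi>(2) assms(2) by (auto simp: has_field_derivative_def mult_commute_abs)
    from has_derivative_compose[OF Ck_on_SucD[OF Suc.prems(1) y] this]
    show "((\<lambda>y. \<phi> (f y)) has_derivative (\<lambda>w. frechet_derivative f (at y) w * \<psi> (f y))) (at y)" .
  next
    show "Ck_on k S (\<lambda>y. \<psi> (f y))" by (rule Suc.IH[OF Ck_on_Suc_imp[OF Suc.prems(1)] \<psi>(1)])
  qed (use Suc.prems in auto)
qed

lemma Ck_on_inverse:
  fixes f :: "'e::euclidean_space \<Rightarrow> real"
  assumes "open S" "\<And>y. y \<in> S \<Longrightarrow> f y \<noteq> 0" "Ck_on k S f"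
  shows "Ck_on k S (\<lambda>y. inverse (f y))"
  using assms(3)
proof (induction k)
  case 0
  then show ?case using assms by (auto intro: continuous_intros)
next
  case (Suc k)
  note IH = Suc.IH[OF Suc.prems[THEN Ck_on_Suc_imp]]
  show ?case
  proof (intro Ck_on_SucI[where f' = "\<lambda>z w. - (inverse (f z) * frechet_derivative f (at z) w * inverse (f z))"]
        assms Ck_on_mult Ck_on_minus IH)
    fix y assume y: "y \<in> S"
    show "((\<lambda>y. inverse (f y)) has_derivative
        (\<lambda>w. - (inverse (f y) * frechet_derivative f (at y) w * inverse (f y)))) (at y)"
      by (rule Deriv.has_derivative_inverse[OF assms(2)[OF y] Ck_on_SucD[OF Suc.prems y]])
  qed (use Suc.prems in auto)
qed

lemma Ck_on_det:
  fixes F :: "'e::euclidean_space \<Rightarrow> real^'n^'n"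
  assumes "open S" "\<And>i j. Ck_on k S (\<lambda>y. F y $ i $ j)"
  shows "Ck_on k S (\<lambda>y. det (F y))"
  unfolding det_def by (intro Ck_on_sum Ck_on_mult Ck_on_const Ck_on_prod assms)

lemma matrix_inv_inverse:
  fixes A :: "real^'n^'n"
  assumes "invertible A"
  shows matrix_inv_right: "A ** matrix_inv A = mat 1" and matrix_inv_left: "matrix_inv A ** A = mat 1"
  using someI_ex[of "\<lambda>A'. A ** A' = mat 1 \<and> A' ** A = mat 1"] assms
  unfolding matrix_inv_def invertible_def by auto

lemma matrix_inv_unique:
  fixes A :: "real^'n^'n"
  assumes "A ** B = mat 1"
  shows "matrix_inv A = B"
proof -
  have "invertible A" using assms by (auto simp: invertible_right_inverse)
  then have "matrix_inv A ** (A ** B) = B"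
    by (simp add: matrix_mul_assoc matrix_inv_left)
  then show ?thesis using assms by simp
qed

text \<open>
  Cramer's rule writes the entries of the inverse as rational functions of the entries of the matrix;
  this is how the inverse metric inherits smoothness.
\<close>

lemma matrix_inv_cramer:
  fixes A :: "real^'n^'n"
  assumes "invertible A"
  shows "matrix_inv A $ i $ j = det (\<chi> r s. if s = i then axis j 1 $ r else A $ r $ s) * inverse (det A)"
proof -
  have d: "det A \<noteq> 0" using assms invertible_det_nz by blast
  have "A *v (matrix_inv A *v axis j 1) = axis j 1"
    using matrix_inv_right[OF assms] by (simp add: matrix_vector_mul_assoc)
  then have "matrix_inv A *v axis j 1 =
      (\<chi> k. det (\<chi> r s. if s = k then axis j 1 $ r else A $ r $ s) / det A)"
    using cramer[OF d] by blast
  then show ?thesis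
    by (simp add: vec_eq_iff matrix_vector_mul_component inner_axis divide_inverse
        flip: matrix_vector_mult_basis)
qed

lemma Ck_on_matrix_inv_nth:
  fixes F :: "'e::euclidean_space \<Rightarrow> real^'n^'n"
  assumes "open S" "\<And>i j. Ck_on k S (\<lambda>y. F y $ i $ j)" "\<And>y. y \<in> S \<Longrightarrow> invertible (F y)"
  shows "Ck_on k S (\<lambda>y. matrix_inv (F y) $ i $ j)"
proof -
  have "Ck_on k S (\<lambda>y. det (\<chi> r s. if s = i then axis j 1 $ r else F y $ r $ s) * inverse (det (F y)))"
  proof (intro Ck_on_mult Ck_on_inverse Ck_on_det assms)
    fix r s
    show "Ck_on k S (\<lambda>y. (\<chi> r s. if s = i then axis j 1 $ r else F y $ r $ s) $ r $ s)"
      by (cases "s = i") (simp_all add: Ck_on_const assms)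
  qed (use assms(3) in \<open>auto simp: invertible_det_nz\<close>)
  moreover have "Ck_on k S (\<lambda>y. matrix_inv (F y) $ i $ j) \<longleftrightarrow>
     Ck_on k S (\<lambda>y. det (\<chi> r s. if s = i then axis j 1 $ r else F y $ r $ s) * inverse (det (F y)))"
    by (rule Ck_on_cong[OF assms(1)]) (rule matrix_inv_cramer[OF assms(3)])
  ultimately show ?thesis by simp
qed

lemma Ck_on_matrix_inv:
  fixes F :: "'e::euclidean_space \<Rightarrow> real^'n^'n"
  assumes "open S" "Ck_on k S F" "\<And>y. y \<in> S \<Longrightarrow> invertible (F y)"
  shows "Ck_on k S (\<lambda>y. matrix_inv (F y))"
proof -
  have "Ck_on k S (\<lambda>y. \<chi> i j. matrix_inv (F y) $ i $ j)"
    by (intro Ck_on_matrix Ck_on_matrix_inv_nth Ck_on_vec_nth assms)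
  then show ?thesis by simp
qed

lemma Ck_on_partial: "Ck_on (Suc k) S f \<Longrightarrow> Ck_on k S (partial i f)"
  unfolding partial_def by simp

lemma frechet_derivative_eq_sum_partial:
  fixes f :: "real^'m \<Rightarrow> real"
  assumes "f differentiable (at y)"
  shows "frechet_derivative f (at y) w = (\<Sum>i\<in>UNIV. w $ i * partial i f y)"
proof -
  have "linear (frechet_derivative f (at y))"
    using assms by (simp add: frechet_derivative_works has_derivative_bounded_linear linear_frechet_derivative)
  then have "frechet_derivative f (at y) (\<Sum>i\<in>UNIV. w $ i *\<^sub>R axis i 1) =
      (\<Sum>i\<in>UNIV. w $ i *\<^sub>R frechet_derivative f (at y) (axis i 1))"
    by (simp add: linear_sum linear_cmul)
  moreover have "(\<Sum>i\<in>UNIV. w $ i *\<^sub>R axis i 1) = w"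
    by (simp add: vec_eq_iff axis_def if_distrib cong: if_cong)
  ultimately show ?thesis by (simp add: partial_def)
qed

lemma partial_eq: "(f has_derivative f') (at y) \<Longrightarrow> partial i f y = f' (axis i 1)"
  unfolding partial_def by (simp add: frechet_derivative_at[symmetric])

lemma smooth_on_Suc: "smooth_on S f \<Longrightarrow> y \<in> S \<Longrightarrow> f differentiable (at y)"
  unfolding smooth_on_def using Ck_on.simps(2)[of 0 S f] by blast

lemma smooth_on_has_derivative:
  "smooth_on S f \<Longrightarrow> y \<in> S \<Longrightarrow> (f has_derivative frechet_derivative f (at y)) (at y)"
  by (simp add: smooth_on_Suc frechet_derivative_works[symmetric])

lemma smooth_on_derivative: "smooth_on S f \<Longrightarrow> smooth_on S (\<lambda>y. frechet_derivative f (at y) w)"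
  unfolding smooth_on_def by (metis Ck_on.simps(2))

lemma smooth_on_partial: "smooth_on S f \<Longrightarrow> smooth_on S (partial i f)"
  unfolding partial_def by (rule smooth_on_derivative)

lemma smooth_on_continuous: "smooth_on S f \<Longrightarrow> continuous_on S f"
  unfolding smooth_on_def using Ck_on_continuous by blast

lemma smooth_on_subset: "smooth_on S f \<Longrightarrow> T \<subseteq> S \<Longrightarrow> smooth_on T f"
  unfolding smooth_on_def using Ck_on_subset by blast

lemma smooth_on_cong:
  "open S \<Longrightarrow> (\<And>y. y \<in> S \<Longrightarrow> f y = g y) \<Longrightarrow> smooth_on S f \<longleftrightarrow> smooth_on S g"
  unfolding smooth_on_def using Ck_on_cong by metis

lemma smooth_on_const: "open S \<Longrightarrow> smooth_on S (\<lambda>y. c)"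
  unfolding smooth_on_def by (auto intro: Ck_on_const)

lemma smooth_on_add: "open S \<Longrightarrow> smooth_on S f \<Longrightarrow> smooth_on S g \<Longrightarrow> smooth_on S (\<lambda>y. f y + g y)"
  unfolding smooth_on_def by (auto intro: Ck_on_add)

lemma smooth_on_mult:
  fixes f :: "'e::euclidean_space \<Rightarrow> real"
  shows "open S \<Longrightarrow> smooth_on S f \<Longrightarrow> smooth_on S g \<Longrightarrow> smooth_on S (\<lambda>y. f y * g y)"
  unfolding smooth_on_def by (auto intro: Ck_on_mult)

lemma smooth_on_vec_nth: "open S \<Longrightarrow> smooth_on S f \<Longrightarrow> smooth_on S (\<lambda>y. f y $ i)"
  unfolding smooth_on_def by (auto intro: Ck_on_vec_nth)

lemma smooth_on_matrix_inv:
  fixes F :: "'e::euclidean_space \<Rightarrow> real^'n^'n"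
  shows "open S \<Longrightarrow> smooth_on S F \<Longrightarrow> (\<And>y. y \<in> S \<Longrightarrow> invertible (F y)) \<Longrightarrow>
    smooth_on S (\<lambda>y. matrix_inv (F y))"
  unfolding smooth_on_def by (auto intro: Ck_on_matrix_inv)

subsection \<open>A smooth cut-off of the positive part\<close>

text \<open>
  A smooth replacement for the positive part \<open>max t 0\<close>. It vanishes exactly for \<open>t \<le> 0\<close>, has slope
  between 0 and 1, and differs from the positive part by at most \<open>\<epsilon>\<close>. Cutting with it keeps test
  functions smooth, which the true positive part would not.
\<close>

definition pos_cut :: "real \<Rightarrow> real \<Rightarrow> real" where
  "pos_cut \<epsilon> t = (if t > 0 then t * exp (- (\<epsilon> / t)) else 0)"

definition pos_cut' :: "real \<Rightarrow> real \<Rightarrow> real" where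
  "pos_cut' \<epsilon> t = (if t > 0 then (1 + \<epsilon> / t) * exp (- (\<epsilon> / t)) else 0)"

text \<open>
  The derivatives of \<open>exp (- \<epsilon> / t)\<close> are polynomials in \<open>1 / t\<close> times the function itself; this family
  contains them all.
\<close>

definition flat_family :: "real \<Rightarrow> (real \<Rightarrow> real) set" where
  "flat_family \<epsilon> = range (\<lambda>q t. if t > 0 then poly q (1 / t) * exp (- (\<epsilon> / t)) else 0)"

lemma poly_times_exp_tendsto_0:
  fixes \<epsilon> :: real
  assumes "\<epsilon> > 0"
  shows "((\<lambda>x. poly q x * exp (- (\<epsilon> * x))) \<longlongrightarrow> 0) at_top"
proof -
  have *: "((\<lambda>x. x ^ j * exp (- (\<epsilon> * x))) \<longlongrightarrow> 0) at_top" for j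
  proof -
    have "((\<lambda>x. (\<epsilon> * x) ^ j / exp (\<epsilon> * x)) \<longlongrightarrow> 0) at_top"
      by (rule filterlim_compose[OF tendsto_power_div_exp_0])
        (use assms in \<open>auto intro: filterlim_tendsto_pos_mult_at_top filterlim_ident\<close>)
    from tendsto_mult_left[OF this, of "inverse (\<epsilon> ^ j)"] show ?thesis
      using assms by (simp add: power_mult_distrib exp_minus divide_inverse flip: mult.assoc)
  qed
  have "((\<lambda>x. x ^ j * poly q x * exp (- (\<epsilon> * x))) \<longlongrightarrow> 0) at_top" for j
  proof (induction q arbitrary: j)
    case (pCons a q)
    have "((\<lambda>x. a * (x ^ j * exp (- (\<epsilon> * x))) + x ^ Suc j * poly q x * exp (- (\<epsilon> * x))) \<longlongrightarrow> a * 0 + 0) at_top"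
      by (intro tendsto_intros * pCons.IH)
    then show ?case by (simp add: algebra_simps)
  qed simp
  from this[of 0] show ?thesis by simp
qed

lemma flat_at_0:
  fixes \<epsilon> :: real
  assumes "\<epsilon> > 0"
  shows "((\<lambda>t. if t > 0 then poly q (1 / t) * exp (- (\<epsilon> / t)) else 0) \<longlongrightarrow> 0) (at (0::real))"
proof -
  have "((\<lambda>t::real. poly q (inverse t) * exp (- (\<epsilon> * inverse t))) \<longlongrightarrow> 0) (at_right 0)"
    by (rule filterlim_compose[OF poly_times_exp_tendsto_0[OF assms] filterlim_inverse_at_top_right])
  then have "((\<lambda>t. if t > 0 then poly q (1 / t) * exp (- (\<epsilon> / t)) else 0) \<longlongrightarrow> 0) (at_right (0::real))"
    by (rule Lim_transform_eventually) (auto simp: eventually_at_filter divide_inverse)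
  moreover have "((\<lambda>t. if t > 0 then poly q (1 / t) * exp (- (\<epsilon> / t)) else 0) \<longlongrightarrow> 0) (at_left (0::real))"
    by (rule Lim_transform_eventually[OF tendsto_const]) (auto simp: eventually_at_filter)
  ultimately show ?thesis by (simp add: filterlim_split_at)
qed

text \<open>
  Off the origin the derivative is computed directly; at the origin the difference quotient is
  again of the form above, with the polynomial multiplied by its variable, so it tends to zero.
\<close>

lemma flat_family_deriv:
  assumes "\<epsilon> > 0" "\<phi> \<in> flat_family \<epsilon>"
  shows "\<exists>\<psi>\<in>flat_family \<epsilon>. \<forall>t\<in>UNIV. (\<phi> has_real_derivative \<psi> t) (at t)"
proof -
  obtain q where q: "\<phi> = (\<lambda>t. if t > 0 then poly q (1 / t) * exp (- (\<epsilon> / t)) else 0)"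
    using assms(2) by (auto simp: flat_family_def)
  define r where "r = [:0, 0, 1:] * (smult \<epsilon> q - pderiv q)"
  define \<psi> where "\<psi> = (\<lambda>t::real. if t > 0 then poly r (1 / t) * exp (- (\<epsilon> / t)) else 0)"
  have "(\<phi> has_real_derivative \<psi> t) (at t)" for t
  proof -
    consider "t > 0" | "t < 0" | "t = 0" by linarith
    then show ?thesis
    proof cases
      case 1
      have "((\<lambda>t. poly q (1 / t) * exp (- (\<epsilon> / t))) has_real_derivative \<psi> t) (at t)"
        using 1 by (auto intro!: derivative_eq_intros
            simp: \<psi>_def r_def power2_eq_square divide_simps algebra_simps)
      then show ?thesis unfolding q
        by (rule has_field_derivative_transform_within_open[where S = "{0<..}"]) (use 1 in auto)
    next
      case 2
      have "((\<lambda>t. 0) has_real_derivative \<psi> t) (at t)"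
        using 2 by (simp add: \<psi>_def)
      then show ?thesis unfolding q
        by (rule has_field_derivative_transform_within_open[where S = "{..<0}"]) (use 2 in auto)
    next
      case 3
      have "(\<lambda>h. (\<phi> (0 + h) - \<phi> 0) / h) =
          (\<lambda>t. if t > 0 then poly ([:0, 1:] * q) (1 / t) * exp (- (\<epsilon> / t)) else 0)"
        by (rule ext) (simp add: q)
      then have "((\<lambda>h. (\<phi> (0 + h) - \<phi> 0) / h) \<longlongrightarrow> 0) (at 0)"
        using flat_at_0[OF assms(1)] by simp
      then show ?thesis unfolding 3 \<psi>_def by (simp add: has_field_derivative_def DERIV_def flip: has_field_derivative_def)
    qed
  qed
  moreover have "\<psi> \<in> flat_family \<epsilon>" unfolding flat_family_def \<psi>_def by blast
  ultimately show ?thesis by blast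
qed

lemma smooth_on_pos_cut:
  fixes f :: "'e::euclidean_space \<Rightarrow> real"
  assumes "\<epsilon> > 0" "open S" "smooth_on S f"
  shows "smooth_on S (\<lambda>y. pos_cut \<epsilon> (f y))"
proof -
  have "(\<lambda>t. if t > 0 then poly [:1:] (1 / t) * exp (- (\<epsilon> / t)) else 0) \<in> flat_family \<epsilon>"
    unfolding flat_family_def by blast
  from Ck_on_compose_real[OF assms(2) _ flat_family_deriv[OF assms(1)] _ this, of f]
  have "Ck_on k S (\<lambda>y. f y * (if f y > 0 then poly [:1:] (1 / f y) * exp (- (\<epsilon> / f y)) else 0))" for k
    using assms(3) unfolding smooth_on_def by (auto intro!: Ck_on_mult[OF assms(2)])
  then show ?thesis unfolding smooth_on_def pos_cut_def
    by (simp add: if_distrib cong: if_cong)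
qed

lemma pos_cut_deriv:
  assumes "\<epsilon> > 0"
  shows "(pos_cut \<epsilon> has_real_derivative pos_cut' \<epsilon> t) (at t)"
proof -
  define h where "h = (\<lambda>t. if t > 0 then poly [:1:] (1 / t) * exp (- (\<epsilon> / t)) else 0)"
  have "h \<in> flat_family \<epsilon>" unfolding h_def flat_family_def by blast
  then obtain \<psi> where \<psi>: "\<And>t. (h has_real_derivative \<psi> t) (at t)"
    using flat_family_deriv[OF assms] by blast
  have eq: "pos_cut \<epsilon> = (\<lambda>t. t * h t)" by (auto simp: pos_cut_def h_def)
  have D: "(pos_cut \<epsilon> has_real_derivative h t + t * \<psi> t) (at t)"
    unfolding eq by (auto intro!: derivative_eq_intros \<psi>)
  show ?thesis
  proof (cases "t > 0")
    case True
    have "((\<lambda>t. t * exp (- (\<epsilon> / t))) has_real_derivative pos_cut' \<epsilon> t) (at t)"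
      using True by (auto intro!: derivative_eq_intros simp: pos_cut'_def divide_simps algebra_simps power2_eq_square)
    then show ?thesis
      by (rule has_field_derivative_transform_within_open[where S = "{0<..}"]) (use True in \<open>auto simp: pos_cut_def\<close>)
  next
    case F: False
    show ?thesis
    proof (cases "t = 0")
      case True
      then show ?thesis using D by (simp add: h_def pos_cut'_def)
    next
      case False
      have "((\<lambda>t. 0) has_real_derivative pos_cut' \<epsilon> t) (at t)"
        using F by (simp add: pos_cut'_def)
      then show ?thesis
        by (rule has_field_derivative_transform_within_open[where S = "{..<0}"])
          (use F False in \<open>auto simp: pos_cut_def\<close>)
    qed
  qed
qed

lemma pos_cut'_nonneg: "\<epsilon> > 0 \<Longrightarrow> pos_cut' \<epsilon> t \<ge> 0"
  by (simp add: pos_cut'_def)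

lemma pos_cut'_le_1:
  assumes "\<epsilon> > 0"
  shows "pos_cut' \<epsilon> t \<le> 1"
proof (cases "t > 0")
  case True
  have "(1 + \<epsilon> / t) * exp (- (\<epsilon> / t)) \<le> exp (\<epsilon> / t) * exp (- (\<epsilon> / t))"
    by (intro mult_right_mono exp_ge_add_one_self) auto
  then show ?thesis using True by (simp add: pos_cut'_def exp_minus)
qed (simp add: pos_cut'_def)

lemma pos_cut_nonneg: "pos_cut \<epsilon> t \<ge> 0"
  by (simp add: pos_cut_def)

lemma pos_cut_zero: "t \<le> 0 \<Longrightarrow> pos_cut \<epsilon> t = 0" and pos_cut'_zero: "t \<le> 0 \<Longrightarrow> pos_cut' \<epsilon> t = 0"
  by (simp_all add: pos_cut_def pos_cut'_def)

lemma pos_cut_le: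
  assumes "\<epsilon> > 0" "t \<ge> 0"
  shows "pos_cut \<epsilon> t \<le> t"
  using assms by (auto simp: pos_cut_def mult_left_le)

lemma pos_cut_ge:
  assumes "\<epsilon> > 0" "t \<ge> 0"
  shows "t - \<epsilon> \<le> pos_cut \<epsilon> t"
proof (cases "t = 0")
  case False
  then have "t * (1 - \<epsilon> / t) \<le> t * exp (- (\<epsilon> / t))"
    using assms exp_ge_add_one_self[of "- (\<epsilon> / t)"] by (intro mult_left_mono) auto
  then show ?thesis using False assms by (simp add: pos_cut_def algebra_simps)
qed (use assms in \<open>simp add: pos_cut_def\<close>)

lemma continuous_on_pos_cut: "\<epsilon> > 0 \<Longrightarrow> continuous_on S (pos_cut \<epsilon>)"
  by (intro continuous_at_imp_continuous_on ballI) (blast intro: DERIV_isCont pos_cut_deriv)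

lemma continuous_on_pos_cut':
  assumes "\<epsilon> > 0"
  shows "continuous_on S (pos_cut' \<epsilon>)"
proof -
  define h where "h = (\<lambda>t. if t > 0 then poly [:1, \<epsilon>:] (1 / t) * exp (- (\<epsilon> / t)) else 0)"
  have "h \<in> flat_family \<epsilon>" unfolding h_def flat_family_def by blast
  then obtain \<psi> where \<psi>: "\<And>t. (h has_real_derivative \<psi> t) (at t)"
    using flat_family_deriv[OF assms] by blast
  have "pos_cut' \<epsilon> = h" by (auto simp: pos_cut'_def h_def)
  then show ?thesis
    by (metis \<psi> DERIV_isCont continuous_at_imp_continuous_on)
qed

section \<open>Coordinate invariance of scalar curvature\<close>

subsection \<open>Second derivatives commute\<close>

lemma has_real_derivative_along_line:
  fixes f :: "'e::real_normed_vector \<Rightarrow> real"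
  assumes "f differentiable (at (y + t *\<^sub>R v))"
  shows "((\<lambda>s. f (y + s *\<^sub>R v)) has_real_derivative frechet_derivative f (at (y + t *\<^sub>R v)) v) (at t)"
proof -
  have "((\<lambda>s. y + s *\<^sub>R v) has_derivative (\<lambda>s. s *\<^sub>R v)) (at t)"
    by (auto intro!: derivative_eq_intros)
  from has_derivative_compose[OF this assms[unfolded frechet_derivative_works]]
  have "((\<lambda>s. f (y + s *\<^sub>R v)) has_derivative (\<lambda>s. frechet_derivative f (at (y + t *\<^sub>R v)) (s *\<^sub>R v))) (at t)" .
  moreover have "linear (frechet_derivative f (at (y + t *\<^sub>R v)))"
    using assms by (rule linear_frechet_derivative)
  ultimately show ?thesis
    unfolding has_field_derivative_def by (simp add: linear_cmul mult_commute_abs)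
qed

text \<open>
  The mean value theorem, applied first in direction \<open>v\<close> to the increment in direction \<open>w\<close> and then
  in direction \<open>w\<close>. The left hand side is symmetric in \<open>v\<close> and \<open>w\<close>, which forces the
  second derivatives to commute in the limit \<open>h \<rightarrow> 0\<close>.
\<close>

lemma second_difference_mean_value:
  fixes f :: "'e::euclidean_space \<Rightarrow> real"
  assumes "Ck_on 2 S f" "h > 0" "cball y (h * (norm v + norm w)) \<subseteq> S"
  shows "\<exists>z\<in>cball y (h * (norm v + norm w)).
    f (y + h *\<^sub>R v + h *\<^sub>R w) - f (y + h *\<^sub>R v) - f (y + h *\<^sub>R w) + f y =
      h * (h * frechet_derivative (\<lambda>z. frechet_derivative f (at z) v) (at z) w)"
proof -
  have C: "Ck_on (Suc 1) S f" using assms(1) by (simp add: numeral_2_eq_2)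
  have in_cb: "y + s *\<^sub>R v + t *\<^sub>R w \<in> cball y (h * (norm v + norm w))"
    if "0 \<le> s" "s \<le> h" "0 \<le> t" "t \<le> h" for s t
  proof -
    have "norm (s *\<^sub>R v + t *\<^sub>R w) \<le> s * norm v + t * norm w"
      using norm_triangle_ineq[of "s *\<^sub>R v" "t *\<^sub>R w"] that by simp
    also have "\<dots> \<le> h * norm v + h * norm w"
      by (intro add_mono mult_right_mono that norm_ge_zero)
    finally show ?thesis by (simp add: dist_norm norm_minus_commute algebra_simps)
  qed
  have diff: "f differentiable (at z)" "(\<lambda>z. frechet_derivative f (at z) v) differentiable (at z)"
    if "z \<in> cball y (h * (norm v + norm w))" for z
    using C that assms(3) by auto
  define g where "g s = f (y + h *\<^sub>R w + s *\<^sub>R v) - f (y + s *\<^sub>R v)" for s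
  have "\<exists>\<xi>. 0 < \<xi> \<and> \<xi> < h \<and> g h - g 0 = (h - 0) *
      (frechet_derivative f (at (y + h *\<^sub>R w + \<xi> *\<^sub>R v)) v - frechet_derivative f (at (y + \<xi> *\<^sub>R v)) v)"
  proof (rule MVT2[OF assms(2)])
    fix s assume s: "0 \<le> s" "s \<le> h"
    then have "y + h *\<^sub>R w + s *\<^sub>R v \<in> cball y (h * (norm v + norm w))"
      "y + s *\<^sub>R v \<in> cball y (h * (norm v + norm w))"
      using in_cb[of s h] in_cb[of s 0] assms(2) by (simp_all add: algebra_simps)
    then show "(g has_real_derivative
        frechet_derivative f (at (y + h *\<^sub>R w + s *\<^sub>R v)) v - frechet_derivative f (at (y + s *\<^sub>R v)) v) (at s)"
      unfolding g_def[abs_def] by (intro DERIV_diff has_real_derivative_along_line diff)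
  qed
  then obtain \<xi> where \<xi>: "0 < \<xi>" "\<xi> < h" and g: "g h - g 0 = h *
      (frechet_derivative f (at (y + h *\<^sub>R w + \<xi> *\<^sub>R v)) v - frechet_derivative f (at (y + \<xi> *\<^sub>R v)) v)"
    by auto
  define d where "d z = frechet_derivative f (at z) v" for z
  have "\<exists>\<eta>. 0 < \<eta> \<and> \<eta> < h \<and> d (y + \<xi> *\<^sub>R v + h *\<^sub>R w) - d (y + \<xi> *\<^sub>R v + 0 *\<^sub>R w) = (h - 0) *
      frechet_derivative d (at (y + \<xi> *\<^sub>R v + \<eta> *\<^sub>R w)) w"
  proof (rule MVT2[OF assms(2)])
    fix s assume s: "0 \<le> s" "s \<le> h"
    show "((\<lambda>s. d (y + \<xi> *\<^sub>R v + s *\<^sub>R w)) has_real_derivative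
        frechet_derivative d (at (y + \<xi> *\<^sub>R v + s *\<^sub>R w)) w) (at s)"
      by (intro has_real_derivative_along_line)
        (unfold d_def[abs_def], rule diff(2), use in_cb[of \<xi> s] \<xi> s in auto)
  qed
  then obtain \<eta> where \<eta>: "0 < \<eta>" "\<eta> < h" and d: "d (y + \<xi> *\<^sub>R v + h *\<^sub>R w) - d (y + \<xi> *\<^sub>R v) =
      h * frechet_derivative d (at (y + \<xi> *\<^sub>R v + \<eta> *\<^sub>R w)) w"
    by auto
  have "g h - g 0 = h * (h * frechet_derivative d (at (y + \<xi> *\<^sub>R v + \<eta> *\<^sub>R w)) w)"
    unfolding g d[symmetric] by (simp add: d_def algebra_simps)
  moreover have "g h - g 0 = f (y + h *\<^sub>R v + h *\<^sub>R w) - f (y + h *\<^sub>R v) - f (y + h *\<^sub>R w) + f y"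
    by (simp add: g_def algebra_simps)
  ultimately show ?thesis
    using in_cb[of \<xi> \<eta>] \<xi> \<eta> unfolding d_def[abs_def] by (intro bexI) auto
qed

lemma frechet_derivative_commute:
  fixes f :: "'e::euclidean_space \<Rightarrow> real"
  assumes "open S" "Ck_on 2 S f" "y \<in> S"
  shows "frechet_derivative (\<lambda>z. frechet_derivative f (at z) v) (at y) w =
    frechet_derivative (\<lambda>z. frechet_derivative f (at z) w) (at y) v"
proof -
  define D where "D v w z = frechet_derivative (\<lambda>z. frechet_derivative f (at z) v) (at z) w" for v w z
  define r where "r = norm v + norm w"
  have cont: "continuous_on S (D v w)" for v w
    using assms(2) unfolding D_def[abs_def] by (simp add: numeral_2_eq_2)
  obtain e where e: "e > 0" "cball y e \<subseteq> S" using assms(1,3) open_contains_cball by blast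
  have r: "r \<ge> 0" by (simp add: r_def)
  have ev: "\<forall>\<^sub>F n in sequentially. inverse (real (Suc n)) * r < e"
  proof -
    have "(\<lambda>n. inverse (real (Suc n)) * r) \<longlonglongrightarrow> 0 * r"
      by (intro tendsto_intros LIMSEQ_inverse_real_of_nat)
    then show ?thesis using e(1) by (auto intro: order_tendstoD)
  qed
  have "\<exists>p q. p \<in> cball y (inverse (real (Suc n)) * r) \<and> q \<in> cball y (inverse (real (Suc n)) * r) \<and>
     (inverse (real (Suc n)) * r < e \<longrightarrow> D v w p = D w v q)" for n
  proof (cases "inverse (real (Suc n)) * r < e")
    case True
    define h where "h = inverse (real (Suc n))"
    have h: "h > 0" by (simp add: h_def)
    have sub: "cball y (h * (norm v + norm w)) \<subseteq> S" "cball y (h * (norm w + norm v)) \<subseteq> S"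
      using True e(2) by (auto simp: h_def r_def algebra_simps)
    obtain p where p: "p \<in> cball y (h * (norm v + norm w))"
      "f (y + h *\<^sub>R v + h *\<^sub>R w) - f (y + h *\<^sub>R v) - f (y + h *\<^sub>R w) + f y = h * (h * D v w p)"
      using second_difference_mean_value[OF assms(2) h sub(1)] unfolding D_def by blast
    obtain q where q: "q \<in> cball y (h * (norm w + norm v))"
      "f (y + h *\<^sub>R w + h *\<^sub>R v) - f (y + h *\<^sub>R w) - f (y + h *\<^sub>R v) + f y = h * (h * D w v q)"
      using second_difference_mean_value[OF assms(2) h sub(2)] unfolding D_def by blast
    have "h * (h * D v w p) = h * (h * D w v q)"
      unfolding p(2)[symmetric] q(2)[symmetric] by (simp add: algebra_simps)
    then have "D v w p = D w v q" using h by simp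
    moreover have "p \<in> cball y (h * r)" "q \<in> cball y (h * r)"
      using p(1) q(1) by (simp_all add: r_def algebra_simps)
    ultimately show ?thesis unfolding h_def by blast
  next
    case False
    then show ?thesis using r by (intro exI[of _ y]) (simp add: zero_le_mult_iff)
  qed
  then obtain p q where pq: "\<And>n. p n \<in> cball y (inverse (real (Suc n)) * r)"
    "\<And>n. q n \<in> cball y (inverse (real (Suc n)) * r)"
    "\<And>n. inverse (real (Suc n)) * r < e \<Longrightarrow> D v w (p n) = D w v (q n)"
    by metis
  have conv: "s \<longlonglongrightarrow> y" if "\<And>n. s n \<in> cball y (inverse (real (Suc n)) * r)" for s
  proof (rule tendsto_dist_iff[THEN iffD2], rule tendsto_sandwich[OF _ _ tendsto_const])
    show "(\<lambda>n. inverse (real (Suc n)) * r) \<longlonglongrightarrow> 0"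
      using tendsto_mult_right[OF LIMSEQ_inverse_real_of_nat, of r] by simp
  qed (use that in \<open>auto simp: dist_commute\<close>)
  have at: "isCont (D v w) y" for v w
    using cont[of v w] assms(1,3) continuous_on_eq_continuous_at by blast
  have "(\<lambda>n. D v w (p n)) \<longlonglongrightarrow> D v w y" by (rule isCont_tendsto_compose[OF at conv[OF pq(1)]])
  moreover have "(\<lambda>n. D w v (q n)) \<longlonglongrightarrow> D w v y" by (rule isCont_tendsto_compose[OF at conv[OF pq(2)]])
  then have "(\<lambda>n. D v w (p n)) \<longlonglongrightarrow> D w v y"
    by (rule Lim_transform_eventually) (use ev in \<open>eventually_elim, auto simp: pq(3)\<close>)
  ultimately show ?thesis unfolding D_def[symmetric] by (rule LIMSEQ_unique)
qed

subsection \<open>Matrix-valued functions\<close>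

lemma bounded_bilinear_matrix_mult:
  "bounded_bilinear (\<lambda>(A::real^'n^'m) (B::real^'p^'n). A ** B)"
  unfolding bilinear_conv_bounded_bilinear[symmetric] bilinear_def
  by (auto intro!: linearI simp: matrix_matrix_mult_def vec_eq_iff sum.distrib algebra_simps sum_distrib_left)

lemmas mm_simps =
  bounded_bilinear.add_left[OF bounded_bilinear_matrix_mult]
  bounded_bilinear.add_right[OF bounded_bilinear_matrix_mult]
  bounded_bilinear.diff_left[OF bounded_bilinear_matrix_mult]
  bounded_bilinear.diff_right[OF bounded_bilinear_matrix_mult]
  bounded_bilinear.scaleR_left[OF bounded_bilinear_matrix_mult]
  bounded_bilinear.scaleR_right[OF bounded_bilinear_matrix_mult]

lemmas mm_sum_left = bounded_bilinear.sum_left[OF bounded_bilinear_matrix_mult]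
lemmas mm_sum_right = bounded_bilinear.sum_right[OF bounded_bilinear_matrix_mult]

lemma bounded_linear_transpose: "bounded_linear (transpose :: real^'n^'m \<Rightarrow> real^'m^'n)"
  unfolding linear_conv_bounded_linear[symmetric]
  by (rule linearI) (simp_all add: transpose_def vec_eq_iff)

lemmas transpose_add = linear_add[OF bounded_linear.linear[OF bounded_linear_transpose]]
lemmas transpose_sum = linear_sum[OF bounded_linear.linear[OF bounded_linear_transpose]]
lemmas transpose_scaleR = linear_cmul[OF bounded_linear.linear[OF bounded_linear_transpose]]

text \<open>
  Partial derivatives of matrix-valued functions, for which the product rule can be used without
  indices.
\<close>

definition dmat :: "'m::finite \<Rightarrow> (real^'m \<Rightarrow> real^'k^'l) \<Rightarrow> real^'m \<Rightarrow> real^'k^'l" where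
  "dmat i F y = frechet_derivative F (at y) (axis i 1)"

lemma differentiable_matrix_mult:
  "F differentiable (at y) \<Longrightarrow> G differentiable (at y) \<Longrightarrow> (\<lambda>z. F z ** G z) differentiable (at y)"
  for F :: "'e::real_normed_vector \<Rightarrow> real^'n^'m" and G :: "'e \<Rightarrow> real^'p^'n"
  unfolding differentiable_def using bounded_bilinear.FDERIV[OF bounded_bilinear_matrix_mult] by blast

lemma differentiable_transpose:
  "F differentiable (at y) \<Longrightarrow> (\<lambda>z. transpose (F z)) differentiable (at y)"
  for F :: "'e::real_normed_vector \<Rightarrow> real^'n^'m"
  unfolding differentiable_def using bounded_linear.has_derivative[OF bounded_linear_transpose] by blast

lemma dmat_eq: "(F has_derivative F') (at y) \<Longrightarrow> dmat i F y = F' (axis i 1)"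
  unfolding dmat_def by (simp add: frechet_derivative_at[symmetric])

lemma differentiable_has_derivative: "F differentiable (at y) \<Longrightarrow> (F has_derivative frechet_derivative F (at y)) (at y)"
  by (simp add: frechet_derivative_works)

lemma dmat_cong:
  assumes "open S" "y \<in> S" "\<And>z. z \<in> S \<Longrightarrow> F z = G z"
  shows "dmat i F y = dmat i G y"
  unfolding dmat_def using frechet_derivative_cong_open(1)[OF assms] by simp

lemma partial_entry:
  fixes F :: "real^'m \<Rightarrow> real^'k^'l"
  assumes "F differentiable (at y)"
  shows "partial i (\<lambda>z. F z $ a $ b) y = dmat i F y $ a $ b"
proof -
  have "((\<lambda>z. F z $ a $ b) has_derivative (\<lambda>w. frechet_derivative F (at y) w $ a $ b)) (at y)"
    by (intro bounded_linear.has_derivative[OF bounded_linear_vec_nth] differentiable_has_derivative assms)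
  from partial_eq[OF this] show ?thesis by (simp add: dmat_def)
qed

lemma dmat_add:
  "F differentiable (at y) \<Longrightarrow> G differentiable (at y) \<Longrightarrow>
    dmat i (\<lambda>z. F z + G z) y = dmat i F y + dmat i G y"
  by (rule dmat_eq[OF has_derivative_add[OF differentiable_has_derivative differentiable_has_derivative],
        folded dmat_def])

lemma dmat_sum:
  "(\<And>k. k \<in> I \<Longrightarrow> F k differentiable (at y)) \<Longrightarrow>
    dmat i (\<lambda>z. \<Sum>k\<in>I. F k z) y = (\<Sum>k\<in>I. dmat i (F k) y)"
  by (rule dmat_eq[OF has_derivative_sum[OF differentiable_has_derivative], folded dmat_def])

lemma dmat_mult:
  "F differentiable (at y) \<Longrightarrow> G differentiable (at y) \<Longrightarrow>
    dmat i (\<lambda>z. F z ** G z) y = dmat i F y ** G y + F y ** dmat i G y"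
  using dmat_eq[OF bounded_bilinear.FDERIV[OF bounded_bilinear_matrix_mult
      differentiable_has_derivative differentiable_has_derivative], of F y G i]
  by (simp add: dmat_def add.commute)

lemma dmat_scaleR:
  "f differentiable (at y) \<Longrightarrow> G differentiable (at y) \<Longrightarrow>
    dmat i (\<lambda>z. f z *\<^sub>R G z) y = partial i f y *\<^sub>R G y + f y *\<^sub>R dmat i G y"
  using dmat_eq[OF bounded_bilinear.FDERIV[OF bounded_bilinear_scaleR
      differentiable_has_derivative differentiable_has_derivative], of f y G i]
  by (simp add: dmat_def partial_def add.commute)

lemma dmat_transpose:
  "F differentiable (at y) \<Longrightarrow> dmat i (\<lambda>z. transpose (F z)) y = transpose (dmat i F y)"
  by (rule dmat_eq[OF bounded_linear.has_derivative[OF bounded_linear_transpose differentiable_has_derivative],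
        folded dmat_def])

lemma dmat_compose:
  fixes H :: "real^'n \<Rightarrow> real^'k^'l" and \<Phi> :: "real^'m \<Rightarrow> real^'n"
  assumes "H differentiable (at (\<Phi> y))" "\<Phi> differentiable (at y)"
  shows "dmat i (\<lambda>z. H (\<Phi> z)) y =
    (\<Sum>b\<in>UNIV. matrix (frechet_derivative \<Phi> (at y)) $ b $ i *\<^sub>R dmat b H (\<Phi> y))"
proof -
  have lin: "linear (frechet_derivative H (at (\<Phi> y)))"
    using assms(1) by (rule linear_frechet_derivative)
  have "dmat i (\<lambda>z. H (\<Phi> z)) y = frechet_derivative H (at (\<Phi> y)) (frechet_derivative \<Phi> (at y) (axis i 1))"
    by (rule dmat_eq[OF has_derivative_compose]) (intro differentiable_has_derivative assms)+
  also have "frechet_derivative \<Phi> (at y) (axis i 1) =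
      (\<Sum>b\<in>UNIV. frechet_derivative \<Phi> (at y) (axis i 1) $ b *\<^sub>R axis b 1)"
    by (simp add: vec_eq_iff axis_def if_distrib cong: if_cong)
  finally show ?thesis
    by (simp add: linear_sum[OF lin] linear_cmul[OF lin] dmat_def matrix_def)
qed

subsection \<open>The Levi-Civita connection matrices\<close>

lemma transpose_fixed_entry: "transpose A = A \<Longrightarrow> A $ i $ j = A $ j $ i"
  by (drule arg_cong[where f = "\<lambda>B. B $ j $ i"]) (simp add: transpose_def)

text \<open>
  The matrix \<open>\<Gamma>\<^sub>i\<close> of the connection in direction \<open>i\<close>. Christoffel symbols transform by a gauge
  transformation, and in matrix form both this law and its consequence for the curvature are
  short identities in a non-commutative ring.
\<close>

definition chr :: "(real^'m \<Rightarrow> real^'m^'m) \<Rightarrow> 'm::finite \<Rightarrow> real^'m \<Rightarrow> real^'m^'m" where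
  "chr G i y = (\<chi> k j. christoffel G k i j y)"

lemma christoffel_eq:
  assumes "G differentiable (at y)"
  shows "christoffel G k i j y = (\<Sum>l\<in>UNIV. matrix_inv (G y) $ k $ l *
    (dmat i G y $ j $ l + dmat j G y $ i $ l - dmat l G y $ i $ j)) / 2"
  unfolding christoffel_def by (simp add: partial_entry[OF assms])

lemma chr_symmetric:
  assumes "G differentiable (at y)" "open S" "y \<in> S" "\<And>z. z \<in> S \<Longrightarrow> transpose (G z) = G z"
  shows "chr G i y $ k $ j = chr G j y $ k $ i"
proof -
  have "transpose (dmat l G y) = dmat l G y" for l
    using dmat_transpose[OF assms(1), of l] dmat_cong[OF assms(2,3), of "\<lambda>z. transpose (G z)" G l] assms(4) by simp
  then have D: "dmat l G y $ i $ j = dmat l G y $ j $ i" for l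
    by (rule transpose_fixed_entry)
  show ?thesis unfolding chr_def christoffel_eq[OF assms(1)] vec_lambda_beta D
    by (simp only: add.commute)
qed

text \<open>
  The Koszul formula: a connection that is symmetric and compatible with the metric is determined by
  the metric, because the three cyclic compatibility equations can be solved for it.
\<close>

lemma levi_civita_unique:
  fixes G :: "real^'m \<Rightarrow> real^'m^'m" and C :: "'m \<Rightarrow> real^'m^'m"
  assumes diff: "G differentiable (at y)" and inv: "invertible (G y)" and symG: "transpose (G y) = G y"
    and sym: "\<And>i j k. C i $ k $ j = C j $ k $ i"
    and compat: "\<And>i. dmat i G y = transpose (C i) ** G y + G y ** C i"
  shows "chr G i y = C i"
proof -
  have G: "G y $ a $ b = G y $ b $ a" for a b
    using transpose_fixed_entry[OF symG] by simp
  have D: "dmat i G y $ j $ l = (\<Sum>p\<in>UNIV. G y $ l $ p * C i $ p $ j) + (\<Sum>p\<in>UNIV. G y $ j $ p * C i $ p $ l)" for i j l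
    unfolding compat by (simp add: matrix_matrix_mult_def transpose_def G mult.commute)
  have K: "dmat i G y $ j $ l + dmat j G y $ i $ l - dmat l G y $ i $ j = 2 * (G y ** C i) $ l $ j" for i j l
    unfolding D sym[of j _ i] sym[of l _ i] sym[of l _ j] by (simp add: matrix_matrix_mult_def)
  have "christoffel G k i j y = (matrix_inv (G y) ** (G y ** C i)) $ k $ j" for k j
    unfolding christoffel_eq[OF diff] K
    by (simp add: matrix_matrix_mult_def sum_divide_distrib)
  then show ?thesis
    by (simp add: chr_def vec_eq_iff matrix_mul_assoc matrix_inv_left[OF inv])
qed

text \<open>
  \<open>G \<Gamma>\<^sub>i\<close> is half the derivative of \<open>G\<close> in direction \<open>i\<close> plus an antisymmetric matrix, so that its
  symmetrization is the derivative.
\<close>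

lemma levi_civita_compatible:
  fixes G :: "real^'m \<Rightarrow> real^'m^'m"
  assumes diff: "G differentiable (at y)" and inv: "invertible (G y)"
    and S: "open S" "y \<in> S" and symS: "\<And>z. z \<in> S \<Longrightarrow> transpose (G z) = G z"
  shows "dmat i G y = transpose (chr G i y) ** G y + G y ** chr G i y"
proof -
  have G: "G y $ a $ b = G y $ b $ a" for a b
    using transpose_fixed_entry[OF symS[OF S(2)]] by simp
  have "transpose (dmat l G y) = dmat l G y" for l
    using dmat_transpose[OF diff, of l] dmat_cong[OF S, of "\<lambda>z. transpose (G z)" G l] symS by simp
  then have symD: "dmat l G y $ i $ j = dmat l G y $ j $ i" for l i j
    by (rule transpose_fixed_entry)
  define K where "K = (\<chi> l j. (dmat i G y $ j $ l + dmat j G y $ i $ l - dmat l G y $ i $ j) / 2)"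
  have "chr G i y = matrix_inv (G y) ** K"
    by (simp add: chr_def K_def christoffel_eq[OF diff] vec_eq_iff matrix_matrix_mult_def sum_divide_distrib)
  then have GK: "G y ** chr G i y = K"
    by (simp add: matrix_mul_assoc matrix_inv_right[OF inv])
  have "transpose (chr G i y) ** G y = transpose (G y ** chr G i y)"
    by (simp add: matrix_transpose_mul symS[OF S(2)])
  then have "transpose (chr G i y) ** G y + G y ** chr G i y = transpose K + K"
    by (simp add: GK)
  also have "\<dots> = dmat i G y"
    by (simp add: vec_eq_iff K_def transpose_def field_simps) (use symD in \<open>simp add: algebra_simps\<close>)
  finally show ?thesis by simp
qed

subsection \<open>The curvature matrices\<close>

text \<open>
  The curvature of the connection \<open>d + A\<close>. For \<open>A = chr G\<close> it is the Riemann tensor, read as an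
  endomorphism for each pair of directions.
\<close>

definition curv :: "('m::finite \<Rightarrow> real^'m \<Rightarrow> real^'l^'l) \<Rightarrow> 'm \<Rightarrow> 'm \<Rightarrow> real^'m \<Rightarrow> real^'l^'l" where
  "curv A i j y = dmat i (A j) y - dmat j (A i) y + A i y ** A j y - A j y ** A i y"

text \<open>
  The Ricci tensor is a trace of the curvature matrices. The lower indices of the Christoffel symbols
  appear in another order here, so their symmetry is used, also under the derivative sign.
\<close>

lemma ricci_eq_curv:
  fixes G :: "real^'m \<Rightarrow> real^'m^'m"
  assumes diff: "\<And>z. z \<in> S \<Longrightarrow> G differentiable (at z)" "\<And>i. chr G i differentiable (at y)"
    and S: "open S" "y \<in> S" and symS: "\<And>z. z \<in> S \<Longrightarrow> transpose (G z) = G z"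
  shows "ricci G i j y = (\<Sum>k\<in>UNIV. curv (chr G) k j y $ k $ i)"
proof -
  note sym = chr_symmetric[OF diff(1) S(1) _ symS]
  have p: "partial l (christoffel G k a b) y = dmat l (chr G a) y $ k $ b" for l k a b
    using partial_entry[OF diff(2)[of a], of l k b] by (simp add: chr_def)
  have p': "partial k (christoffel G k i j) y = dmat k (chr G j) y $ k $ i" for k
  proof -
    have "partial k (christoffel G k i j) y = partial k (christoffel G k j i) y"
      by (rule partial_cong_open[OF S]) (use sym in \<open>simp add: chr_def\<close>)
    then show ?thesis by (simp add: p)
  qed
  have p'': "partial j (christoffel G k i k) y = dmat j (chr G k) y $ k $ i" for k
  proof -
    have "partial j (christoffel G k i k) y = partial j (christoffel G k k i) y"
      by (rule partial_cong_open[OF S]) (use sym in \<open>simp add: chr_def\<close>)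
    then show ?thesis by (simp add: p)
  qed
  have s: "chr G i y $ l $ b = chr G b y $ l $ i" for l b by (rule sym[OF S(2) S(2)])
  have c: "christoffel G k a b y = chr G a y $ k $ b" for k a b by (simp add: chr_def)
  show ?thesis unfolding ricci_def
  proof (rule sum.cong[OF refl])
    fix k
    have "curv (chr G) k j y $ k $ i = dmat k (chr G j) y $ k $ i - dmat j (chr G k) y $ k $ i +
        (\<Sum>l\<in>UNIV. chr G k y $ k $ l * chr G j y $ l $ i - chr G j y $ k $ l * chr G k y $ l $ i)"
      by (simp add: curv_def matrix_matrix_mult_def sum_subtractf)
    then show "partial k (christoffel G k i j) y - partial j (christoffel G k i k) y
        + (\<Sum>l\<in>UNIV. christoffel G k k l y * christoffel G l i j y
                     - christoffel G k j l y * christoffel G l i k y) = curv (chr G) k j y $ k $ i"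
      unfolding p' p'' c s[of _ j] s[of _ k] by simp
  qed
qed

subsection \<open>Change of coordinates\<close>

lemma chr_smooth:
  fixes G :: "real^'m \<Rightarrow> real^'m^'m"
  assumes "open S" "smooth_on S G" "\<And>y. y \<in> S \<Longrightarrow> invertible (G y)"
  shows "smooth_on S (chr G i)"
  unfolding smooth_on_def
proof
  fix k
  have p: "Ck_on k S (partial i (\<lambda>z. G z $ a $ b))" for i a b
    by (intro Ck_on_partial Ck_on_vec_nth assms(1)) (use assms(2) in \<open>auto simp: smooth_on_def\<close>)
  have "Ck_on k S (\<lambda>y. \<chi> a j. (\<Sum>l\<in>UNIV. matrix_inv (G y) $ a $ l *
        (partial i (\<lambda>z. G z $ j $ l) y + partial j (\<lambda>z. G z $ i $ l) y
          - partial l (\<lambda>z. G z $ i $ j) y)) * (1 / 2))"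
    by (intro Ck_on_matrix Ck_on_mult Ck_on_sum Ck_on_diff Ck_on_add Ck_on_const assms p
        Ck_on_matrix_inv_nth Ck_on_vec_nth) (use assms(2) in \<open>auto simp: smooth_on_def\<close>)
  then show "Ck_on k S (chr G i)" by (simp add: chr_def[abs_def] christoffel_def)
qed

locale coord_change =
  fixes S T :: "(real^'m::finite) set" and \<Phi> :: "real^'m \<Rightarrow> real^'m" and G H :: "real^'m \<Rightarrow> real^'m^'m"
    and J :: "real^'m \<Rightarrow> real^'m^'m"
  assumes S: "open S" and T: "open T" and maps: "\<And>y. y \<in> S \<Longrightarrow> \<Phi> y \<in> T"
    and smooth_\<Phi>: "smooth_on S \<Phi>" and smooth_G: "smooth_on S G" and smooth_H: "smooth_on T H"
    and sym_H: "\<And>z. z \<in> T \<Longrightarrow> transpose (H z) = H z" and inv_H: "\<And>z. z \<in> T \<Longrightarrow> invertible (H z)"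
    and J_def: "\<And>y. J y = matrix (frechet_derivative \<Phi> (at y))"
    and inv_J: "\<And>y. y \<in> S \<Longrightarrow> invertible (J y)"
    and G_eq: "\<And>y. y \<in> S \<Longrightarrow> G y = transpose (J y) ** H (\<Phi> y) ** J y"
begin

text \<open>
  The pull-back under \<open>\<Phi>\<close> of the connection of \<open>H\<close>, in the frame of the target coordinates; passing
  to the frame of the source coordinates is the gauge transformation by \<open>J\<close>.
\<close>

definition pulled :: "'m \<Rightarrow> real^'m \<Rightarrow> real^'m^'m" where
  "pulled i y = (\<Sum>b\<in>UNIV. J y $ b $ i *\<^sub>R chr H b (\<Phi> y))"

lemma smooth_J_entry: "smooth_on S (\<lambda>y. J y $ a $ b)"
  unfolding J_def matrix_def by (simp add: smooth_on_vec_nth smooth_on_derivative S smooth_\<Phi>)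

lemma smooth_J: "smooth_on S J"
proof -
  have "Ck_on k S (\<lambda>y. \<chi> a b. J y $ a $ b)" for k
    by (intro Ck_on_matrix S) (use smooth_J_entry in \<open>auto simp: smooth_on_def\<close>)
  then show ?thesis by (simp add: smooth_on_def)
qed

lemma diff_J: "y \<in> S \<Longrightarrow> J differentiable (at y)" "y \<in> S \<Longrightarrow> (\<lambda>y. J y $ a $ b) differentiable (at y)"
  using smooth_on_Suc smooth_J smooth_J_entry by blast+

lemma diff_\<Phi>: "y \<in> S \<Longrightarrow> \<Phi> differentiable (at y)"
  using smooth_on_Suc smooth_\<Phi> by blast

lemma diff_compose: "y \<in> S \<Longrightarrow> F differentiable (at (\<Phi> y)) \<Longrightarrow> (\<lambda>y. F (\<Phi> y)) differentiable (at y)"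
  for F :: "real^'m \<Rightarrow> real^'m^'m"
  using differentiable_chain_at[OF diff_\<Phi>, of y F] by (simp add: o_def)

lemma diff_H: "z \<in> T \<Longrightarrow> H differentiable (at z)"
  using smooth_on_Suc smooth_H by blast

lemma diff_chr_H: "z \<in> T \<Longrightarrow> chr H i differentiable (at z)"
  using smooth_on_Suc chr_smooth[OF T smooth_H inv_H] by blast

lemma dmat_J_symmetric:
  assumes "y \<in> S"
  shows "dmat i J y $ a $ b = dmat b J y $ a $ i"
proof -
  have C: "Ck_on 2 S (\<lambda>y. \<Phi> y $ a)"
    by (intro Ck_on_vec_nth S) (use smooth_\<Phi> in \<open>auto simp: smooth_on_def\<close>)
  have fd: "frechet_derivative (\<lambda>y. \<Phi> y $ a) (at z) v = frechet_derivative \<Phi> (at z) v $ a" if "z \<in> S" for z v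
    using frechet_derivative_at[OF bounded_linear.has_derivative[OF bounded_linear_vec_nth
        differentiable_has_derivative[OF diff_\<Phi>[OF that]], of a], symmetric] by simp
  have J: "J z $ a $ b = frechet_derivative (\<lambda>y. \<Phi> y $ a) (at z) (axis b 1)" if "z \<in> S" for z b
    unfolding fd[OF that] by (simp add: J_def matrix_def)
  have "dmat i J y $ a $ b = frechet_derivative (\<lambda>z. frechet_derivative (\<lambda>y. \<Phi> y $ a) (at z) (axis b 1)) (at y) (axis i 1)" for i b
    unfolding partial_entry[OF diff_J(1)[OF assms], symmetric] partial_def
    using frechet_derivative_cong_open(1)[OF S assms J] by simp
  then show ?thesis using frechet_derivative_commute[OF S C assms] by simp
qed

lemma diff_pulled: "y \<in> S \<Longrightarrow> pulled i differentiable (at y)"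
  unfolding pulled_def[abs_def]
  by (auto intro!: differentiable_sum differentiable_scaleR diff_J diff_compose diff_chr_H maps)

lemma diff_G: "y \<in> S \<Longrightarrow> G differentiable (at y)"
  using smooth_on_Suc smooth_G by blast

lemma inv_G: "y \<in> S \<Longrightarrow> invertible (G y)"
  by (simp add: G_eq invertible_mult inv_J inv_H maps transpose_invertible)

lemma sym_G: "y \<in> S \<Longrightarrow> transpose (G y) = G y"
  by (simp add: G_eq matrix_transpose_mul sym_H maps matrix_mul_assoc)

text \<open>
  The pulled-back connection, gauge transformed by the Jacobian, is symmetric and compatible with
  the pulled-back metric, hence is its Levi-Civita connection.
\<close>

lemma chr_transform:
  assumes y: "y \<in> S"
  shows "J y ** chr G i y = dmat i J y + pulled i y ** J y"
proof -
  define C where "C i = matrix_inv (J y) ** (dmat i J y + pulled i y ** J y)" for i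
  have JC: "J y ** C i = dmat i J y + pulled i y ** J y" for i
    by (simp add: C_def matrix_mul_assoc matrix_inv_right[OF inv_J[OF y]])
  have entry: "C i $ k $ j = (\<Sum>a\<in>UNIV. matrix_inv (J y) $ k $ a * (dmat i J y $ a $ j +
      (\<Sum>b\<in>UNIV. \<Sum>c\<in>UNIV. J y $ b $ i * chr H b (\<Phi> y) $ a $ c * J y $ c $ j)))" for i k j
  proof -
    have "(pulled i y ** J y) $ a $ j = (\<Sum>b\<in>UNIV. \<Sum>c\<in>UNIV. J y $ b $ i * chr H b (\<Phi> y) $ a $ c * J y $ c $ j)" for a
      unfolding pulled_def mm_sum_left
      by (simp add: mm_simps matrix_matrix_mult_def sum_distrib_left mult.assoc)
    then show ?thesis by (simp add: C_def matrix_matrix_mult_def[of "matrix_inv (J y)"])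
  qed
  have Csym: "C i $ k $ j = C j $ k $ i" for i j k
  proof -
    have "(\<Sum>b\<in>UNIV. \<Sum>c\<in>UNIV. J y $ b $ i * chr H b (\<Phi> y) $ a $ c * J y $ c $ j) =
       (\<Sum>b\<in>UNIV. \<Sum>c\<in>UNIV. J y $ b $ j * chr H b (\<Phi> y) $ a $ c * J y $ c $ i)" for a
      by (subst sum.swap) (intro sum.cong refl,
        simp add: chr_symmetric[OF diff_H[OF maps[OF y]] T maps[OF y] sym_H] mult_ac)
    then show ?thesis unfolding entry by (simp add: dmat_J_symmetric[OF y, of i])
  qed
  have compat: "dmat i G y = transpose (C i) ** G y + G y ** C i" for i
  proof -
    have LC: "dmat b H (\<Phi> y) = transpose (chr H b (\<Phi> y)) ** H (\<Phi> y) + H (\<Phi> y) ** chr H b (\<Phi> y)" for b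
      by (rule levi_civita_compatible[OF diff_H[OF maps[OF y]] inv_H[OF maps[OF y]] T maps[OF y] sym_H])
    have H': "dmat i (\<lambda>y. H (\<Phi> y)) y = transpose (pulled i y) ** H (\<Phi> y) + H (\<Phi> y) ** pulled i y"
      unfolding dmat_compose[where H = H, OF diff_H[OF maps[OF y]] diff_\<Phi>[OF y]] pulled_def LC
      by (simp add: transpose_sum transpose_scaleR mm_sum_left mm_sum_right mm_simps
          scaleR_add_right sum.distrib flip: J_def)
    have "dmat i G y = dmat i (\<lambda>y. transpose (J y) ** H (\<Phi> y) ** J y) y"
      by (rule dmat_cong[OF S y G_eq])
    also have "\<dots> = (transpose (dmat i J y) ** H (\<Phi> y) + transpose (J y) **
        (transpose (pulled i y) ** H (\<Phi> y) + H (\<Phi> y) ** pulled i y)) ** J y +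
        transpose (J y) ** H (\<Phi> y) ** dmat i J y"
      unfolding H'[symmetric]
      by (subst dmat_mult dmat_transpose,
          (intro differentiable_matrix_mult
          differentiable_transpose diff_J diff_compose diff_H maps y)+)+
        (rule refl)
    also have "\<dots> = transpose (J y ** C i) ** H (\<Phi> y) ** J y + transpose (J y) ** H (\<Phi> y) ** (J y ** C i)"
      unfolding JC by (simp add: transpose_add matrix_transpose_mul mm_simps matrix_mul_assoc)
    also have "\<dots> = transpose (C i) ** G y + G y ** C i"
      by (simp add: G_eq[OF y] matrix_transpose_mul matrix_mul_assoc)
    finally show ?thesis .
  qed
  have "chr G i y = C i" by (rule levi_civita_unique[OF diff_G[OF y] inv_G[OF y] sym_G[OF y] Csym compat])
  then show ?thesis using JC by simp
qed

lemma diff_chr_G: "y \<in> S \<Longrightarrow> chr G i differentiable (at y)"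
  using smooth_on_Suc chr_smooth[OF S smooth_G inv_G] by blast

text \<open>
  Differentiate the transformation law of the connection matrices and antisymmetrize: the second
  derivatives of \<open>J\<close> cancel, and replacing its first derivatives by means of the law itself
  leaves the commutators that complete the two curvatures.
\<close>

lemma curv_gauge:
  assumes y: "y \<in> S"
  shows "J y ** curv (chr G) i j y = curv pulled i j y ** J y"
proof -
  have dd: "dmat i (dmat j J) y = dmat j (dmat i J) y"
  proof -
    have sm: "smooth_on S (dmat j J)" for j
      unfolding dmat_def by (rule smooth_on_derivative[OF smooth_J])
    have "dmat i (dmat j J) y $ a $ b = dmat j (dmat i J) y $ a $ b" for a b
    proof -
      have C: "Ck_on 2 S (\<lambda>y. J y $ a $ b)" using smooth_J_entry by (auto simp: smooth_on_def)
      have "dmat i (dmat j J) y $ a $ b = frechet_derivative (\<lambda>z. frechet_derivative (\<lambda>y. J y $ a $ b) (at z) (axis j 1)) (at y) (axis i 1)" for i j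
        unfolding partial_entry[OF smooth_on_Suc[OF sm y], symmetric]
        using partial_cong_open[OF S y, of "\<lambda>z. dmat j J z $ a $ b" "partial j (\<lambda>y. J y $ a $ b)"]
          partial_entry[OF diff_J(1)] by (simp add: partial_def[abs_def])
      then show ?thesis using frechet_derivative_commute[OF S C y] by simp
    qed
    then show ?thesis by (simp add: vec_eq_iff)
  qed
  have dJ: "dmat i J differentiable (at y)" for i
    unfolding dmat_def[abs_def] by (rule smooth_on_Suc[OF smooth_on_derivative[OF smooth_J] y])
  have D: "dmat i J y ** chr G j y + J y ** dmat i (chr G j) y =
      dmat i (dmat j J) y + (dmat i (pulled j) y ** J y + pulled j y ** dmat i J y)" for i j
  proof -
    have "dmat i (\<lambda>y. J y ** chr G j y) y = dmat i (\<lambda>y. dmat j J y + pulled j y ** J y) y"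
      by (rule dmat_cong[OF S y chr_transform])
    then show ?thesis
      by (simp add: dmat_mult dmat_add dJ diff_J diff_chr_G diff_pulled y
          differentiable_matrix_mult)
  qed
  have P: "dmat i J y = J y ** chr G i y - pulled i y ** J y" for i
    using chr_transform[OF y, of i] by simp
  have 1: "J y ** dmat i (chr G j) y = dmat i (dmat j J) y + (dmat i (pulled j) y ** J y +
      pulled j y ** (J y ** chr G i y - pulled i y ** J y)) - (J y ** chr G i y - pulled i y ** J y) ** chr G j y" for i j
    using D[of i j] unfolding P[symmetric] by (simp add: algebra_simps)
  have "J y ** curv (chr G) i j y = J y ** dmat i (chr G j) y - J y ** dmat j (chr G i) y +
      J y ** chr G i y ** chr G j y - J y ** chr G j y ** chr G i y"
    by (simp only: curv_def mm_simps matrix_mul_assoc)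
  also have "\<dots> = (dmat i (pulled j) y - dmat j (pulled i) y + pulled i y ** pulled j y - pulled j y ** pulled i y) ** J y"
    unfolding 1 dd mm_simps matrix_mul_assoc by simp
  finally show ?thesis by (simp only: curv_def)
qed

text \<open>
  Curvature is a two-form: the chain rule produces the expected terms and a multiple of the second
  derivatives of \<open>\<Phi>\<close>, which is symmetric in \<open>i\<close> and \<open>j\<close> and drops out.
\<close>

lemma curv_pulled:
  assumes y: "y \<in> S"
  shows "curv pulled i j y = (\<Sum>b\<in>UNIV. \<Sum>c\<in>UNIV. (J y $ b $ i * J y $ c $ j) *\<^sub>R curv (chr H) b c (\<Phi> y))"
proof -
  have D: "dmat i (pulled j) y = (\<Sum>c\<in>UNIV. dmat i J y $ c $ j *\<^sub>R chr H c (\<Phi> y)) +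
      (\<Sum>b\<in>UNIV. \<Sum>c\<in>UNIV. (J y $ b $ i * J y $ c $ j) *\<^sub>R dmat b (chr H c) (\<Phi> y))" for i j
  proof -
    have "dmat i (pulled j) y = (\<Sum>c\<in>UNIV. dmat i (\<lambda>y. J y $ c $ j *\<^sub>R chr H c (\<Phi> y)) y)"
      unfolding pulled_def[abs_def]
      by (rule dmat_sum) (auto intro!: differentiable_scaleR diff_J diff_compose diff_chr_H maps y)
    also have "\<dots> = (\<Sum>c\<in>UNIV. dmat i J y $ c $ j *\<^sub>R chr H c (\<Phi> y) +
        J y $ c $ j *\<^sub>R (\<Sum>b\<in>UNIV. J y $ b $ i *\<^sub>R dmat b (chr H c) (\<Phi> y)))"
      by (intro sum.cong refl, subst dmat_scaleR)
        (auto intro!: diff_J diff_compose diff_chr_H maps y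
          simp: partial_entry[OF diff_J(1)[OF y]] dmat_compose[OF diff_chr_H[OF maps[OF y]] diff_\<Phi>[OF y], folded J_def])
    also have "\<dots> = (\<Sum>c\<in>UNIV. dmat i J y $ c $ j *\<^sub>R chr H c (\<Phi> y)) +
      (\<Sum>c\<in>UNIV. \<Sum>b\<in>UNIV. (J y $ b $ i * J y $ c $ j) *\<^sub>R dmat b (chr H c) (\<Phi> y))"
      by (simp add: sum.distrib scaleR_sum_right mult.commute)
    finally show ?thesis by (subst sum.swap)
  qed
  have M: "pulled i y ** pulled j y = (\<Sum>b\<in>UNIV. \<Sum>c\<in>UNIV. (J y $ b $ i * J y $ c $ j) *\<^sub>R (chr H b (\<Phi> y) ** chr H c (\<Phi> y)))" for i j
    unfolding pulled_def mm_sum_left by (simp add: mm_sum_right mm_simps mult.commute)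
  have swap: "(\<Sum>b\<in>UNIV. \<Sum>c\<in>UNIV. (J y $ b $ j * J y $ c $ i) *\<^sub>R X b c) =
      (\<Sum>b\<in>UNIV. \<Sum>c\<in>UNIV. (J y $ b $ i * J y $ c $ j) *\<^sub>R X c b)" for X :: "'m \<Rightarrow> 'm \<Rightarrow> real^'m^'m"
    by (subst sum.swap) (simp add: mult.commute)
  have "curv pulled i j y =
      (\<Sum>b\<in>UNIV. \<Sum>c\<in>UNIV. (J y $ b $ i * J y $ c $ j) *\<^sub>R dmat b (chr H c) (\<Phi> y)) -
      (\<Sum>b\<in>UNIV. \<Sum>c\<in>UNIV. (J y $ b $ i * J y $ c $ j) *\<^sub>R dmat c (chr H b) (\<Phi> y)) +
      (\<Sum>b\<in>UNIV. \<Sum>c\<in>UNIV. (J y $ b $ i * J y $ c $ j) *\<^sub>R (chr H b (\<Phi> y) ** chr H c (\<Phi> y))) -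
      (\<Sum>b\<in>UNIV. \<Sum>c\<in>UNIV. (J y $ b $ i * J y $ c $ j) *\<^sub>R (chr H c (\<Phi> y) ** chr H b (\<Phi> y)))"
    unfolding curv_def D[of i j] D[of j i] M[of i j] M[of j i] swap dmat_J_symmetric[OF y, of i _ j] by simp
  then show ?thesis
    by (simp add: curv_def scaleR_add_right scaleR_diff_right sum.distrib sum_subtractf)
qed

lemma ricci_transform:
  assumes y: "y \<in> S"
  shows "ricci G i j y = (\<Sum>d\<in>UNIV. \<Sum>c\<in>UNIV. J y $ d $ i * ricci H d c (\<Phi> y) * J y $ c $ j)"
proof -
  have C: "curv (chr G) k j y = matrix_inv (J y) ** curv pulled k j y ** J y" for k
    using arg_cong[OF curv_gauge[OF y, of k j], of "\<lambda>X. matrix_inv (J y) ** X"]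
    by (simp add: matrix_mul_assoc matrix_inv_left[OF inv_J[OF y]])
  define X where "X b = (\<Sum>c\<in>UNIV. J y $ c $ j *\<^sub>R curv (chr H) b c (\<Phi> y)) ** J y" for b
  have C': "curv (chr G) k j y = matrix_inv (J y) ** (\<Sum>b\<in>UNIV. J y $ b $ k *\<^sub>R X b)" for k
    unfolding C curv_pulled[OF y] X_def
    by (simp add: mm_sum_left mm_sum_right mm_simps scaleR_sum_right flip: matrix_mul_assoc)
  have tr: "(\<Sum>k\<in>UNIV. J y $ b $ k * matrix_inv (J y) $ k $ a) = (if b = a then 1 else 0)" for a b
    using matrix_inv_right[OF inv_J[OF y]] by (simp add: matrix_matrix_mult_def mat_def vec_eq_iff)
  have "ricci G i j y = (\<Sum>k\<in>UNIV. curv (chr G) k j y $ k $ i)"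
    by (rule ricci_eq_curv[OF diff_G diff_chr_G[OF y] S y sym_G])
  also have "\<dots> = (\<Sum>k\<in>UNIV. \<Sum>a\<in>UNIV. \<Sum>b\<in>UNIV. (J y $ b $ k * matrix_inv (J y) $ k $ a) * X b $ a $ i)"
    unfolding C' by (simp add: matrix_matrix_mult_def sum_distrib_left mult_ac)
  also have "\<dots> = (\<Sum>a\<in>UNIV. \<Sum>b\<in>UNIV. (\<Sum>k\<in>UNIV. J y $ b $ k * matrix_inv (J y) $ k $ a) * X b $ a $ i)"
    unfolding sum_distrib_right by (subst sum.swap, rule sum.cong[OF refl], rule sum.swap)
  also have "\<dots> = (\<Sum>a\<in>UNIV. X a $ a $ i)"
    unfolding tr by (simp add: if_distrib[of "\<lambda>x. x * _"] cong: if_cong)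
  also have "\<dots> = (\<Sum>a\<in>UNIV. \<Sum>d\<in>UNIV. \<Sum>c\<in>UNIV. J y $ d $ i * (curv (chr H) a c (\<Phi> y) $ a $ d) * J y $ c $ j)"
    unfolding X_def by (simp add: matrix_matrix_mult_def sum_distrib_left sum_distrib_right mult_ac)
  also have "\<dots> = (\<Sum>d\<in>UNIV. \<Sum>c\<in>UNIV. J y $ d $ i * (\<Sum>a\<in>UNIV. curv (chr H) a c (\<Phi> y) $ a $ d) * J y $ c $ j)"
    unfolding sum_distrib_left sum_distrib_right by (subst sum.swap, rule sum.cong[OF refl], rule sum.swap)
  finally show ?thesis
    by (simp add: ricci_eq_curv[OF diff_H diff_chr_H[OF maps[OF y]] T maps[OF y] sym_H])
qed

lemma matrix_inv_G:
  assumes y: "y \<in> S"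
  shows "matrix_inv (G y) = matrix_inv (J y) ** matrix_inv (H (\<Phi> y)) ** transpose (matrix_inv (J y))"
proof (rule matrix_inv_unique)
  have t: "transpose (J y) ** transpose (matrix_inv (J y)) = mat 1"
    by (simp add: matrix_inv_left[OF inv_J[OF y]] flip: matrix_transpose_mul)
  have "G y ** (matrix_inv (J y) ** matrix_inv (H (\<Phi> y)) ** transpose (matrix_inv (J y))) =
    transpose (J y) ** (H (\<Phi> y) ** (J y ** matrix_inv (J y)) ** matrix_inv (H (\<Phi> y))) ** transpose (matrix_inv (J y))"
    by (simp add: G_eq[OF y] matrix_mul_assoc)
  then show "G y ** (matrix_inv (J y) ** matrix_inv (H (\<Phi> y)) ** transpose (matrix_inv (J y))) = mat 1"
    by (simp add: matrix_inv_right inv_J inv_H maps y t)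
qed

text \<open>
  Scalar curvature is the trace of \<open>G\<^sup>-\<^sup>1 Ric\<close>, and under a change of coordinates this product is
  conjugated by \<open>J\<close>.
\<close>

theorem local_scal_transform:
  assumes y: "y \<in> S"
  shows "local_scal G y = local_scal H (\<Phi> y)"
proof -
  have tr: "local_scal G z = trace (matrix_inv (G z) ** transpose (\<chi> i j. ricci G i j z))" for G :: "real^'m \<Rightarrow> real^'m^'m" and z
    by (simp add: local_scal_def trace_def matrix_matrix_mult_def transpose_def)
  have R: "(\<chi> i j. ricci G i j y) = transpose (J y) ** (\<chi> i j. ricci H i j (\<Phi> y)) ** J y"
    by (simp add: vec_eq_iff ricci_transform[OF y] matrix_matrix_mult_def transpose_def sum_distrib_right sum_distrib_left)
      (subst sum.swap, simp)
  have "matrix_inv (G y) ** transpose (\<chi> i j. ricci G i j y) =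
     matrix_inv (J y) ** (matrix_inv (H (\<Phi> y)) ** transpose (\<chi> i j. ricci H i j (\<Phi> y)) ** J y)"
  proof -
    have t: "transpose (matrix_inv (J y)) ** transpose (J y) = mat 1"
      by (simp add: matrix_inv_right[OF inv_J[OF y]] flip: matrix_transpose_mul)
    have "matrix_inv (G y) ** transpose (\<chi> i j. ricci G i j y) =
      matrix_inv (J y) ** matrix_inv (H (\<Phi> y)) ** (transpose (matrix_inv (J y)) ** transpose (J y)) **
        (transpose (\<chi> i j. ricci H i j (\<Phi> y)) ** J y)"
      unfolding R matrix_inv_G[OF y] by (simp add: matrix_transpose_mul matrix_mul_assoc)
    then show ?thesis by (simp add: t matrix_mul_assoc)
  qed
  then have "local_scal G y = trace ((matrix_inv (H (\<Phi> y)) ** transpose (\<chi> i j. ricci H i j (\<Phi> y)) ** J y) ** matrix_inv (J y))"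
    unfolding tr[of G] by (simp only: trace_mul_sym[of "matrix_inv (J y)"])
  also have "\<dots> = local_scal H (\<Phi> y)"
    unfolding tr by (simp add: matrix_inv_right[OF inv_J[OF y]] flip: matrix_mul_assoc)
  finally show ?thesis .
qed

end

section \<open>Charts, gradients and scalar curvature\<close>

lemma posdef_invertible:
  fixes G :: "real^'m^'m"
  assumes "\<And>w. w \<noteq> 0 \<Longrightarrow> w \<bullet> (G *v w) > 0"
  shows "invertible G"
proof -
  have "\<forall>x. G *v x = 0 \<longrightarrow> x = 0" using assms by (metis inner_zero_right less_irrefl)
  then show ?thesis by (simp add: invertible_left_inverse matrix_left_invertible_ker)
qed

text \<open>
  Deform \<open>G\<close> linearly into the identity. All matrices on the way are positive definite, so the
  determinant has no zero and keeps the sign that it has at the identity.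
\<close>

lemma posdef_det_pos:
  fixes G :: "real^'m^'m"
  assumes "\<And>w. w \<noteq> 0 \<Longrightarrow> w \<bullet> (G *v w) > 0"
  shows "det G > 0"
proof (rule ccontr)
  assume neg: "\<not> det G > 0"
  define P where "P t = (1 - t) *\<^sub>R mat 1 + t *\<^sub>R G" for t :: real
  have inv: "invertible (P t)" if t: "0 \<le> t" "t \<le> 1" for t
  proof (rule posdef_invertible)
    fix w :: "real^'m" assume w: "w \<noteq> 0"
    have eq: "w \<bullet> (P t *v w) = (1 - t) * (w \<bullet> w) + t * (w \<bullet> (G *v w))"
      by (simp add: P_def matrix_vector_mult_add_rdistrib scaleR_matrix_vector_assoc[symmetric] inner_add_right)
    have "w \<bullet> w > 0" using w by simp
    then show "w \<bullet> (P t *v w) > 0"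
      using assms[OF w] t unfolding eq
      by (cases "t = 0") (auto intro!: add_nonneg_pos mult_nonneg_nonneg)
  qed
  have cont: "continuous_on {0..1} (\<lambda>t. det (P t))"
    unfolding det_def P_def by (intro continuous_intros)
  have "\<exists>t\<ge>0. t \<le> 1 \<and> det (P t) = 0"
    by (rule IVT2'[OF _ _ _ cont]) (use neg in \<open>auto simp: P_def\<close>)
  then show False using inv by (metis invertible_det_nz)
qed

lemma posdef_matrix_inv:
  fixes G :: "real^'m^'m"
  assumes "\<And>w. w \<noteq> 0 \<Longrightarrow> w \<bullet> (G *v w) > 0" "transpose G = G"
  shows "w \<bullet> (matrix_inv G *v w) \<ge> 0" and "transpose (matrix_inv G) = matrix_inv G"
proof -
  have inv: "invertible G" using assms(1) by (rule posdef_invertible)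
  define z where "z = matrix_inv G *v w"
  have "G *v z = w" by (simp add: z_def matrix_vector_mul_assoc matrix_inv_right[OF inv])
  then have "w \<bullet> (matrix_inv G *v w) = z \<bullet> (G *v z)" by (simp add: z_def[symmetric] inner_commute)
  then show "w \<bullet> (matrix_inv G *v w) \<ge> 0" using assms(1)[of z] by (cases "z = 0") (auto intro: less_imp_le)
  have "G ** transpose (matrix_inv G) = transpose (matrix_inv G ** G)"
    by (simp add: matrix_transpose_mul assms(2))
  then show "transpose (matrix_inv G) = matrix_inv G"
    by (intro matrix_inv_unique[symmetric]) (simp add: matrix_inv_left[OF inv])
qed

lemma continuous_on_local_scal:
  fixes G :: "real^'m \<Rightarrow> real^'m^'m"
  assumes "open S" "smooth_on S G" "\<And>y. y \<in> S \<Longrightarrow> invertible (G y)"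
  shows "continuous_on S (local_scal G)"
proof -
  have chr: "smooth_on S (christoffel G k i j)" for k i j
    using smooth_on_vec_nth[OF assms(1) smooth_on_vec_nth[OF assms(1) chr_smooth[OF assms]]]
    by (simp add: chr_def)
  have inv: "continuous_on S (\<lambda>y. matrix_inv (G y) $ i $ j)" for i j
    by (intro continuous_intros smooth_on_continuous smooth_on_matrix_inv assms)
  have "continuous_on S (\<lambda>y. local_scal G y)"
    unfolding local_scal_def ricci_def
    by (intro continuous_on_sum continuous_on_mult continuous_on_add continuous_on_diff inv
        smooth_on_continuous smooth_on_partial chr)
  then show ?thesis by simp
qed

subsection \<open>Charts of an atlas\<close>

definition chart_grad :: "('a, 'm::finite) rchart \<Rightarrow> ('a \<Rightarrow> real) \<Rightarrow> real^'m \<Rightarrow> real^'m" where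
  "chart_grad c f y = (\<chi> i. partial i (f \<circ> chart_inv c) y)"

lemma grad_sq_eq_chart_grad:
  "grad_sq A f x = (let c = chart_at A x; y = chart_map c x in
     chart_grad c f y \<bullet> (matrix_inv (chart_metric c y) *v chart_grad c f y))"
  by (simp add: grad_sq_def Let_def chart_grad_def inner_vec_def matrix_vector_mult_def sum_distrib_left mult_ac)

text \<open>
  The test functions of \<open>Cc_smooth\<close> without the condition on the support.
\<close>

definition smooth_fun :: "('a, 'm::finite) riem \<Rightarrow> ('a \<Rightarrow> real) \<Rightarrow> bool" where
  "smooth_fun A f \<longleftrightarrow> (\<forall>c\<in>A. smooth_on (chart_image c) (f \<circ> chart_inv c))"

lemma Cc_smooth_iff: "f \<in> Cc_smooth A \<longleftrightarrow> smooth_fun A f \<and> compact (supp f)"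
  by (simp add: Cc_smooth_def smooth_fun_def)

locale riemannian =
  fixes A :: "('a::{t2_space,second_countable_topology}, 'm::finite) riem"
  assumes manifold: "riemannian_manifold A"
begin

lemma chart_facts:
  assumes "c \<in> A"
  shows open_dom: "open (chart_dom c)" and open_image: "open (chart_image c)"
    and chart_homeo: "homeomorphism (chart_dom c) (chart_image c) (chart_map c) (chart_inv c)"
    and smooth_metric: "smooth_on (chart_image c) (chart_metric c)"
    and sym_metric: "\<And>y. y \<in> chart_image c \<Longrightarrow> transpose (chart_metric c y) = chart_metric c y"
    and pos_metric: "\<And>y w. y \<in> chart_image c \<Longrightarrow> w \<noteq> 0 \<Longrightarrow> w \<bullet> (chart_metric c y *v w) > 0"
  using assms manifold unfolding riemannian_manifold_def riemannian_chart_def by blast+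

lemma inv_metric: "c \<in> A \<Longrightarrow> y \<in> chart_image c \<Longrightarrow> invertible (chart_metric c y)"
  using pos_metric by (intro posdef_invertible) auto

lemma chart_inv_map: "c \<in> A \<Longrightarrow> x \<in> chart_dom c \<Longrightarrow> chart_inv c (chart_map c x) = x"
  using chart_homeo unfolding homeomorphism_def by blast

lemma chart_map_inv: "c \<in> A \<Longrightarrow> y \<in> chart_image c \<Longrightarrow> chart_map c (chart_inv c y) = y"
  using chart_homeo unfolding homeomorphism_def by blast

lemma chart_map_in: "c \<in> A \<Longrightarrow> x \<in> chart_dom c \<Longrightarrow> chart_map c x \<in> chart_image c"
  unfolding chart_image_def by blast

lemma chart_inv_in: "c \<in> A \<Longrightarrow> y \<in> chart_image c \<Longrightarrow> chart_inv c y \<in> chart_dom c"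
  using chart_homeo unfolding homeomorphism_def by blast

lemma chart_at_works: "chart_at A x \<in> A \<and> x \<in> chart_dom (chart_at A x)"
proof -
  have "\<exists>c. c \<in> A \<and> x \<in> chart_dom c"
    using manifold unfolding riemannian_manifold_def by blast
  then show ?thesis unfolding chart_at_def by (rule someI_ex)
qed

lemma open_chart_image:
  assumes "c \<in> A" "open U" "U \<subseteq> chart_dom c"
  shows "open (chart_map c ` U)"
proof -
  have "openin (top_of_set (chart_dom c)) U" using assms(2,3) by (auto simp: openin_open)
  then have "openin (top_of_set (chart_image c)) (chart_map c ` U)"
    using homeomorphism_imp_open_map[OF chart_homeo[OF assms(1)]] by blast
  then show ?thesis using open_image[OF assms(1)] openin_open_trans by blast
qed

lemma transition_inverse:
  assumes "c \<in> A" "d \<in> A" "y \<in> chart_map c ` (chart_dom c \<inter> chart_dom d)"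
  shows "transition c d y \<in> chart_map d ` (chart_dom c \<inter> chart_dom d)"
    and "transition d c (transition c d y) = y"
  using assms by (auto simp: transition_def chart_inv_map)

lemma smooth_transition:
  "c \<in> A \<Longrightarrow> d \<in> A \<Longrightarrow> smooth_on (chart_map c ` (chart_dom c \<inter> chart_dom d)) (transition c d)"
  using manifold unfolding riemannian_manifold_def compatible_charts_def by blast

text \<open>
  The transitions in the two directions are inverse to each other, hence so are their derivatives.
\<close>

lemma transition_jacobian_invertible:
  assumes c: "c \<in> A" and d: "d \<in> A" and y: "y \<in> chart_map c ` (chart_dom c \<inter> chart_dom d)"
  shows "invertible (matrix (frechet_derivative (transition c d) (at y)))"
proof -
  let ?S = "chart_map c ` (chart_dom c \<inter> chart_dom d)"
  let ?D = "frechet_derivative (transition c d) (at y)" and ?E = "frechet_derivative (transition d c) (at (transition c d y))"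
  have opn: "open ?S" by (intro open_chart_image[OF c] open_Int open_dom c d) auto
  have D: "(transition c d has_derivative ?D) (at y)"
    by (rule smooth_on_has_derivative[OF smooth_transition[OF c d] y])
  have E: "(transition d c has_derivative ?E) (at (transition c d y))"
    by (rule smooth_on_has_derivative[OF smooth_transition[OF d c]])
      (use transition_inverse(1)[OF c d y] in \<open>simp add: Int_commute\<close>)
  have "((\<lambda>y. transition d c (transition c d y)) has_derivative (\<lambda>w. ?E (?D w))) (at y)"
    by (rule has_derivative_compose[OF D E])
  moreover have "((\<lambda>y. transition d c (transition c d y)) has_derivative (\<lambda>w. w)) (at y)"
    by (rule has_derivative_transform_within_open[OF has_derivative_ident opn y])
      (simp add: transition_inverse(2)[OF c d])
  ultimately have "(\<lambda>w. ?E (?D w)) = (\<lambda>w. w)" by (rule has_derivative_unique)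
  then have "matrix (?E \<circ> ?D) = mat 1" using matrix_id_mat_1 by (simp add: o_def id_def)
  moreover have "matrix (?E \<circ> ?D) = matrix ?E ** matrix ?D"
    using D E by (intro matrix_compose) (auto intro: has_derivative_linear)
  ultimately show ?thesis unfolding invertible_left_inverse by metis
qed

lemma coord_change_transition:
  assumes c: "c \<in> A" and d: "d \<in> A"
  shows "coord_change (chart_map c ` (chart_dom c \<inter> chart_dom d)) (chart_image d) (transition c d)
    (chart_metric c) (chart_metric d) (\<lambda>y. matrix (frechet_derivative (transition c d) (at y)))"
proof
  show "open (chart_map c ` (chart_dom c \<inter> chart_dom d))"
    by (intro open_chart_image[OF c] open_Int open_dom c d) auto
  show "transition c d y \<in> chart_image d" if "y \<in> chart_map c ` (chart_dom c \<inter> chart_dom d)" for y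
    using transition_inverse(1)[OF c d that] unfolding chart_image_def by blast
  show "smooth_on (chart_map c ` (chart_dom c \<inter> chart_dom d)) (chart_metric c)"
    by (rule smooth_on_subset[OF smooth_metric[OF c]]) (auto intro: chart_map_in[OF c])
  show "chart_metric c y = transpose (matrix (frechet_derivative (transition c d) (at y))) **
      chart_metric d (transition c d y) ** matrix (frechet_derivative (transition c d) (at y))"
    if y: "y \<in> chart_map c ` (chart_dom c \<inter> chart_dom d)" for y
  proof -
    obtain x where x: "x \<in> chart_dom c \<inter> chart_dom d" "y = chart_map c x" using y by blast
    have "compatible_charts c d" using manifold c d unfolding riemannian_manifold_def by blast
    then show ?thesis using x c
      by (auto simp: compatible_charts_def Let_def transition_def chart_inv_map)
  qed
qed (use assms open_image smooth_transition smooth_metric sym_metric inv_metric transition_jacobian_invertible in auto)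

text \<open>
  Invariance of the local formula under transitions. It is what makes scalar curvature continuous, and
  what lets the charts selected on a product and on its factor be compared.
\<close>

lemma scal_chart:
  assumes c: "c \<in> A" and x: "x \<in> chart_dom c"
  shows "scal A x = local_scal (chart_metric c) (chart_map c x)"
proof -
  let ?d = "chart_at A x"
  have d: "?d \<in> A" "x \<in> chart_dom ?d" using chart_at_works by auto
  interpret coord_change "chart_map c ` (chart_dom c \<inter> chart_dom ?d)" "chart_image ?d" "transition c ?d"
    "chart_metric c" "chart_metric ?d" "\<lambda>y. matrix (frechet_derivative (transition c ?d) (at y))"
    by (rule coord_change_transition[OF c d(1)])
  have "local_scal (chart_metric c) (chart_map c x) = local_scal (chart_metric ?d) (transition c ?d (chart_map c x))"
    by (rule local_scal_transform) (use x d in blast)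
  then show ?thesis by (simp add: scal_def Let_def transition_def chart_inv_map c x)
qed

lemma smooth_fun_differentiable:
  "smooth_fun A f \<Longrightarrow> c \<in> A \<Longrightarrow> y \<in> chart_image c \<Longrightarrow> (f \<circ> chart_inv c) differentiable (at y)"
  unfolding smooth_fun_def using smooth_on_Suc by blast

text \<open>
  Gradients transform with the transpose of \<open>J\<close> and the inverse metric with \<open>J\<^sup>-\<^sup>1\<close>, so the factors
  cancel.
\<close>

lemma grad_sq_chart:
  assumes f: "smooth_fun A f" and c: "c \<in> A" and x: "x \<in> chart_dom c"
  shows "grad_sq A f x = chart_grad c f (chart_map c x) \<bullet>
    (matrix_inv (chart_metric c (chart_map c x)) *v chart_grad c f (chart_map c x))"
proof -
  let ?d = "chart_at A x"
  have d: "?d \<in> A" "x \<in> chart_dom ?d" using chart_at_works by auto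
  let ?S = "chart_map c ` (chart_dom c \<inter> chart_dom ?d)"
  define J where "J y = matrix (frechet_derivative (transition c ?d) (at y))" for y
  interpret coord_change ?S "chart_image ?d" "transition c ?d" "chart_metric c" "chart_metric ?d" J
    unfolding J_def[abs_def] by (rule coord_change_transition[OF c d(1)])
  define y where "y = chart_map c x"
  have y: "y \<in> ?S" using x d by (auto simp: y_def)
  have ty: "transition c ?d y = chart_map ?d x" by (simp add: y_def transition_def chart_inv_map c x)
  define u where "u = chart_grad c f y"
  define v where "v = chart_grad ?d f (chart_map ?d x)"
  have "u = transpose (J y) *v v"
  proof -
    have lin: "linear (frechet_derivative (f \<circ> chart_inv ?d) (at (chart_map ?d x)))"
      by (intro linear_frechet_derivative smooth_fun_differentiable[OF f d(1)] chart_map_in d)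
    have D: "((\<lambda>y. (f \<circ> chart_inv ?d) (transition c ?d y)) has_derivative
       (\<lambda>w. frechet_derivative (f \<circ> chart_inv ?d) (at (chart_map ?d x)) (frechet_derivative (transition c ?d) (at y) w))) (at y)"
      by (rule has_derivative_compose[OF differentiable_has_derivative[OF diff_\<Phi>[OF y]]], unfold ty,
          intro differentiable_has_derivative smooth_fun_differentiable[OF f d(1)] chart_map_in d)
    have "((f \<circ> chart_inv c) has_derivative
       (\<lambda>w. frechet_derivative (f \<circ> chart_inv ?d) (at (chart_map ?d x)) (frechet_derivative (transition c ?d) (at y) w))) (at y)"
      by (rule has_derivative_transform_within_open[OF D S y])
        (use c d in \<open>auto simp: transition_def chart_inv_map\<close>)
    then have "u $ i = frechet_derivative (f \<circ> chart_inv ?d) (at (chart_map ?d x)) (frechet_derivative (transition c ?d) (at y) (axis i 1))" for i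
      by (simp add: u_def chart_grad_def partial_eq)
    then have "u $ i = (\<Sum>b\<in>UNIV. J y $ b $ i * v $ b)" for i
      by (simp add: frechet_derivative_eq_sum_partial[OF smooth_fun_differentiable[OF f d(1) chart_map_in[OF d]]]
          J_def matrix_def v_def chart_grad_def)
    then show ?thesis
      by (simp add: vec_eq_iff matrix_vector_mult_def transpose_def del: transpose_matrix_vector)
  qed
  then have tv: "transpose (matrix_inv (J y)) *v u = v"
    by (simp add: matrix_vector_mul_assoc matrix_inv_right[OF inv_J[OF y]]
        flip: matrix_transpose_mul del: transpose_matrix_vector)
  have "u \<bullet> (matrix_inv (chart_metric c y) *v u) =
      u \<bullet> (matrix_inv (J y) *v (matrix_inv (chart_metric ?d (chart_map ?d x)) *v v))"
    unfolding matrix_inv_G[OF y] ty tv[symmetric] by (simp only: matrix_vector_mul_assoc matrix_mul_assoc)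
  also have "\<dots> = v \<bullet> (matrix_inv (chart_metric ?d (chart_map ?d x)) *v v)"
    unfolding tv[symmetric] by (simp only: dot_lmul_matrix transpose_matrix_vector)
  finally show ?thesis
    by (simp add: grad_sq_eq_chart_grad Let_def u_def v_def y_def)
qed

subsection \<open>Continuity\<close>

text \<open>
  Continuity is local, so it suffices to have a continuous coordinate expression in every chart.
\<close>

lemma continuous_in_charts:
  fixes F :: "'a \<Rightarrow> real"
  assumes "\<And>c. c \<in> A \<Longrightarrow> \<exists>h. continuous_on (chart_image c) h \<and> (\<forall>x\<in>chart_dom c. F x = h (chart_map c x))"
  shows "continuous_on UNIV F"
proof (intro continuous_at_imp_continuous_on ballI)
  fix x
  let ?c = "chart_at A x"
  have c: "?c \<in> A" "x \<in> chart_dom ?c" using chart_at_works by auto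
  obtain h where h: "continuous_on (chart_image ?c) h" "\<forall>x\<in>chart_dom ?c. F x = h (chart_map ?c x)"
    using assms[OF c(1)] by blast
  have "continuous_on (chart_dom ?c) (\<lambda>x. h (chart_map ?c x))"
    by (rule continuous_on_compose2[OF h(1)])
      (use chart_homeo[OF c(1)] in \<open>auto simp: homeomorphism_def\<close>)
  then have "continuous_on (chart_dom ?c) F" using h(2) by (simp cong: continuous_on_cong)
  then show "isCont F x" using continuous_on_eq_continuous_at[OF open_dom[OF c(1)]] c(2) by blast
qed

lemma continuous_scal: "continuous_on UNIV (scal A)"
  by (rule continuous_in_charts, rule exI[of _ "local_scal (chart_metric _)"])
    (auto simp: scal_chart intro!: continuous_on_local_scal open_image smooth_metric inv_metric)

lemma continuous_smooth_fun:
  assumes "smooth_fun A f"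
  shows "continuous_on UNIV f"
proof (rule continuous_in_charts)
  fix c assume c: "c \<in> A"
  have "continuous_on (chart_image c) (f \<circ> chart_inv c)"
    using assms c smooth_on_continuous unfolding smooth_fun_def by blast
  then show "\<exists>h. continuous_on (chart_image c) h \<and> (\<forall>x\<in>chart_dom c. f x = h (chart_map c x))"
    by (intro exI[of _ "f \<circ> chart_inv c"]) (simp add: chart_inv_map c)
qed

lemma continuous_grad_sq:
  assumes f: "smooth_fun A f"
  shows "continuous_on UNIV (grad_sq A f)"
proof (rule continuous_in_charts)
  fix c assume c: "c \<in> A"
  have p: "continuous_on (chart_image c) (partial i (f \<circ> chart_inv c))" for i
    using f c by (auto simp: smooth_fun_def intro!: smooth_on_continuous smooth_on_partial)
  have inv: "continuous_on (chart_image c) (\<lambda>y. matrix_inv (chart_metric c y) $ i $ j)" for i j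
    by (intro continuous_intros smooth_on_continuous smooth_on_matrix_inv open_image smooth_metric inv_metric c)
  have "continuous_on (chart_image c) (\<lambda>y. chart_grad c f y \<bullet> (matrix_inv (chart_metric c y) *v chart_grad c f y))"
    by (simp add: inner_vec_def matrix_vector_mult_def chart_grad_def)
      (intro continuous_intros p inv)
  then show "\<exists>h. continuous_on (chart_image c) h \<and> (\<forall>x\<in>chart_dom c. grad_sq A f x = h (chart_map c x))"
    using grad_sq_chart[OF f c] by blast
qed

subsection \<open>Algebra of the gradient\<close>

lemma grad_sq_nonneg: "grad_sq A f x \<ge> 0"
proof -
  let ?c = "chart_at A x"
  have c: "?c \<in> A" "x \<in> chart_dom ?c" using chart_at_works by auto
  show ?thesis unfolding grad_sq_eq_chart_grad Let_def
    by (rule posdef_matrix_inv(1)) (use c chart_map_in pos_metric sym_metric in auto)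
qed

lemma smooth_fun_lin:
  assumes "smooth_fun A f" "smooth_fun A g"
  shows "smooth_fun A (\<lambda>x. a * f x + b * g x)"
  using assms unfolding smooth_fun_def
  by (auto simp: o_def intro!: smooth_on_add smooth_on_mult smooth_on_const open_image)

text \<open>
  The inner product of two gradients, obtained by polarization; the factors 1 let it match a general
  linear combination.
\<close>

definition grad_inner :: "('a \<Rightarrow> real) \<Rightarrow> ('a \<Rightarrow> real) \<Rightarrow> 'a \<Rightarrow> real" where
  "grad_inner f g x = (grad_sq A (\<lambda>x. 1 * f x + 1 * g x) x - grad_sq A f x - grad_sq A g x) / 2"

lemma grad_sq_lin:
  assumes f: "smooth_fun A f" and g: "smooth_fun A g"
  shows "grad_sq A (\<lambda>x. a * f x + b * g x) x =
    a\<^sup>2 * grad_sq A f x + 2 * a * b * grad_inner f g x + b\<^sup>2 * grad_sq A g x"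
proof -
  let ?c = "chart_at A x"
  have c: "?c \<in> A" "x \<in> chart_dom ?c" using chart_at_works by auto
  let ?y = "chart_map ?c x"
  let ?M = "matrix_inv (chart_metric ?c ?y)"
  have y: "?y \<in> chart_image ?c" by (rule chart_map_in[OF c])
  have cg: "chart_grad ?c (\<lambda>x. a * f x + b * g x) ?y = a *\<^sub>R chart_grad ?c f ?y + b *\<^sub>R chart_grad ?c g ?y" for a b
  proof -
    have "(((\<lambda>x. a * f x + b * g x) \<circ> chart_inv ?c) has_derivative
      (\<lambda>w. a * frechet_derivative (f \<circ> chart_inv ?c) (at ?y) w + b * frechet_derivative (g \<circ> chart_inv ?c) (at ?y) w)) (at ?y)"
      unfolding o_def
      by (intro has_derivative_add has_derivative_mult_right
          differentiable_has_derivative smooth_fun_differentiable[unfolded o_def] f g c y)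
    then show ?thesis by (simp add: vec_eq_iff chart_grad_def partial_eq) (simp add: partial_def)
  qed
  have sym: "v \<bullet> (?M *v w) = w \<bullet> (?M *v v)" for v w
  proof -
    have "transpose ?M = ?M"
      by (rule posdef_matrix_inv(2)) (use c y pos_metric sym_metric in auto)
    then show ?thesis by (metis dot_lmul_matrix inner_commute transpose_matrix_vector)
  qed
  have E: "grad_sq A (\<lambda>x. a * f x + b * g x) x = a\<^sup>2 * grad_sq A f x +
      2 * a * b * (chart_grad ?c f ?y \<bullet> (?M *v chart_grad ?c g ?y)) + b\<^sup>2 * grad_sq A g x" for a b
    unfolding grad_sq_eq_chart_grad Let_def cg
    by (simp add: matrix_vector_right_distrib inner_add_left inner_add_right algebra_simps power2_eq_square
        sym[of "chart_grad ?c g ?y" "chart_grad ?c f ?y"])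
  show ?thesis unfolding grad_inner_def E[of a b] E[of 1 1] by simp
qed

lemma grad_sq_compose:
  assumes f: "smooth_fun A f" and \<phi>: "(\<phi> has_real_derivative d) (at (f x))"
  shows "grad_sq A (\<lambda>x. \<phi> (f x)) x = d\<^sup>2 * grad_sq A f x"
proof -
  let ?c = "chart_at A x"
  have c: "?c \<in> A" "x \<in> chart_dom ?c" using chart_at_works by auto
  let ?y = "chart_map ?c x"
  have y: "?y \<in> chart_image ?c" by (rule chart_map_in[OF c])
  have "(\<phi> has_derivative (\<lambda>h. d * h)) (at ((f \<circ> chart_inv ?c) ?y))"
    using \<phi> by (simp add: chart_inv_map c has_field_derivative_def)
  from has_derivative_compose[OF differentiable_has_derivative[OF smooth_fun_differentiable[OF f c(1) y]] this]
  have "(((\<lambda>x. \<phi> (f x)) \<circ> chart_inv ?c) has_derivative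
      (\<lambda>w. d * frechet_derivative (f \<circ> chart_inv ?c) (at ?y) w)) (at ?y)"
    by (simp add: o_def)
  then have "chart_grad ?c (\<lambda>x. \<phi> (f x)) ?y = d *\<^sub>R chart_grad ?c f ?y"
    by (simp add: vec_eq_iff chart_grad_def partial_eq) (simp add: partial_def)
  then show ?thesis
    unfolding grad_sq_eq_chart_grad Let_def by (simp add: algebra_simps power2_eq_square)
qed

lemma grad_sq_cong_open:
  assumes "open U" "x \<in> U" "\<And>z. z \<in> U \<Longrightarrow> f z = g z"
  shows "grad_sq A f x = grad_sq A g x"
proof -
  let ?c = "chart_at A x"
  have c: "?c \<in> A" "x \<in> chart_dom ?c" using chart_at_works by auto
  have "open (chart_map ?c ` (U \<inter> chart_dom ?c))"
    by (rule open_chart_image[OF c(1)]) (use assms open_dom[OF c(1)] in auto)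
  then have "chart_grad ?c f (chart_map ?c x) = chart_grad ?c g (chart_map ?c x)"
    unfolding chart_grad_def vec_eq_iff
    using assms(2,3) c by (auto intro!: partial_cong_open simp: chart_inv_map)
  then show ?thesis by (simp add: grad_sq_eq_chart_grad Let_def)
qed

lemma grad_sq_zero: "grad_sq A (\<lambda>x. 0) x = 0"
  by (simp add: grad_sq_def Let_def o_def partial_def)

lemma grad_sq_outside_supp:
  assumes "x \<notin> supp f"
  shows "grad_sq A f x = 0"
proof -
  have "grad_sq A f x = grad_sq A (\<lambda>x. 0) x"
    by (rule grad_sq_cong_open[of "- supp f"])
      (use assms closure_subset[of "{x. f x \<noteq> 0}"] in \<open>auto simp: supp_def\<close>)
  then show ?thesis by (simp add: grad_sq_zero)
qed

end

section \<open>Change of variables\<close>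

subsection \<open>A well-ordered copy of a finite index type\<close>

text \<open>
  The change of variables theorem concerns vectors whose index type is well-ordered. Every finite
  type has a well-ordered copy, and since neither Lebesgue measure nor the determinant depends on
  the names of the indices, the theorem carries over to all finite index types.
\<close>

typedef 'm wo = "UNIV :: 'm set" morphisms of_wo to_wo by simp

lemma to_wo_of_wo: "to_wo (of_wo i) = i" and of_wo_to_wo: "of_wo (to_wo j) = j"
  by (simp_all add: of_wo_inverse to_wo_inverse)

lemma inj_of_wo: "inj of_wo" and inj_to_wo: "inj to_wo"
  by (metis injI to_wo_of_wo, metis injI of_wo_to_wo)

lemma to_wo_eq_iff: "to_wo a = to_wo b \<longleftrightarrow> a = b" and of_wo_eq_iff: "of_wo i = a \<longleftrightarrow> i = to_wo a"
  by (metis of_wo_to_wo, metis of_wo_to_wo to_wo_of_wo)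

lemma UNIV_wo: "(UNIV :: 'm wo set) = range to_wo"
  by (metis UNIV_eq_I rangeI to_wo_of_wo)

instance wo :: (finite) finite
  by standard (simp add: UNIV_wo)

instantiation wo :: (finite) wellorder
begin

text \<open>
  An arbitrary injection into the natural numbers, along which the order is pulled back.
\<close>

definition wo_rank :: "'a wo \<Rightarrow> nat" where
  "wo_rank = (SOME f. inj f)"

definition less_eq_wo :: "'a wo \<Rightarrow> 'a wo \<Rightarrow> bool" where "less_eq_wo i j \<longleftrightarrow> wo_rank i \<le> wo_rank j"
definition less_wo :: "'a wo \<Rightarrow> 'a wo \<Rightarrow> bool" where "less_wo i j \<longleftrightarrow> wo_rank i < wo_rank j"

lemma inj_wo_rank: "inj (wo_rank :: 'a wo \<Rightarrow> nat)"
proof -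
  have "\<exists>f :: 'a wo \<Rightarrow> nat. inj f"
    using finite_imp_inj_to_nat_seg[of "UNIV :: 'a wo set"] by auto
  then show ?thesis unfolding wo_rank_def by (rule someI_ex)
qed

instance
proof
  fix P :: "'a wo \<Rightarrow> bool" and a
  assume step: "\<And>x. (\<And>y. y < x \<Longrightarrow> P y) \<Longrightarrow> P x"
  show "P a"
  proof (induction a rule: measure_induct_rule[where f = wo_rank])
    case (less x)
    show ?case by (rule step, rule less.IH) (simp add: less_wo_def)
  qed
next
  fix i j :: "'a wo"
  assume "i \<le> j" "j \<le> i"
  then have "wo_rank i = wo_rank j" by (simp add: less_eq_wo_def)
  then show "i = j" by (rule injD[OF inj_wo_rank])
qed (auto simp: less_eq_wo_def less_wo_def)

end

lemma bij_of_wo: "bij of_wo" and bij_to_wo: "bij to_wo"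
  by (auto simp: bij_def inj_of_wo inj_to_wo) (metis rangeI of_wo_to_wo, metis rangeI to_wo_of_wo)

text \<open>
  A factorization into transpositions can be relabelled, so the sign of a permutation does not
  depend on the labels.
\<close>

lemma swapidseq_to_wo:
  fixes p :: "'m \<Rightarrow> 'm"
  shows "swapidseq n p \<Longrightarrow> swapidseq n (to_wo \<circ> p \<circ> of_wo)"
proof (induction rule: swapidseq.induct)
  case id
  have "to_wo \<circ> (id :: 'm \<Rightarrow> 'm) \<circ> of_wo = id" by (rule ext) (simp add: to_wo_of_wo)
  then show ?case by (simp only: swapidseq.id)
next
  case (comp_Suc n p a b)
  have "to_wo \<circ> (Transposition.transpose a b \<circ> p) \<circ> of_wo = Transposition.transpose (to_wo a) (to_wo b) \<circ> (to_wo \<circ> p \<circ> of_wo)"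
    by (rule ext) (simp add: Transposition.transpose_def to_wo_eq_iff of_wo_eq_iff if_distrib)
  moreover have "to_wo a \<noteq> to_wo b" using comp_Suc by (simp add: to_wo_eq_iff)
  ultimately show ?case
    using swapidseq.comp_Suc[OF comp_Suc.IH, of "to_wo a" "to_wo b"] by argo
qed

lemma sign_to_wo:
  fixes p :: "'m::finite \<Rightarrow> 'm"
  assumes "p permutes UNIV"
  shows "sign (to_wo \<circ> p \<circ> of_wo) = sign p"
proof -
  have "permutation p" using assms by (auto intro: permutes_imp_permutation)
  then obtain n where n: "swapidseq n p" by (auto simp: permutation_def)
  have "evenperm p = even n" by (rule evenperm_unique[OF n refl])
  moreover have "evenperm (to_wo \<circ> p \<circ> of_wo) = even n"
    by (rule evenperm_unique[OF swapidseq_to_wo[OF n] refl])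
  ultimately show ?thesis by (simp add: sign_def)
qed

lemma det_to_wo:
  fixes A :: "real^'m^'m"
  shows "det (\<chi> i j. A $ of_wo i $ of_wo j) = det A"
proof -
  have bij: "bij_betw (\<lambda>p. to_wo \<circ> p \<circ> of_wo) {p. p permutes (UNIV :: 'm set)} {p. p permutes UNIV}"
  proof (rule bij_betwI[where g = "\<lambda>q. of_wo \<circ> q \<circ> to_wo"])
    show "(\<lambda>p. to_wo \<circ> p \<circ> of_wo) \<in> {p. p permutes (UNIV :: 'm set)} \<rightarrow> {p. p permutes UNIV}"
      using bij_of_wo bij_to_wo by (auto intro!: bij_imp_permutes bij_comp simp: permutes_bij)
    show "(\<lambda>q. of_wo \<circ> q \<circ> to_wo) \<in> {p. p permutes (UNIV :: 'm wo set)} \<rightarrow> {p. p permutes UNIV}"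
      using bij_of_wo bij_to_wo by (auto intro!: bij_imp_permutes bij_comp simp: permutes_bij)
  qed (auto simp: fun_eq_iff to_wo_of_wo of_wo_to_wo)
  have "det (\<chi> i j. A $ of_wo i $ of_wo j) =
      (\<Sum>p\<in>{p. p permutes (UNIV :: 'm wo set)}. of_int (sign p) * (\<Prod>i\<in>UNIV. A $ of_wo i $ of_wo (p i)))"
    by (simp add: det_def)
  also have "\<dots> = (\<Sum>p\<in>{p. p permutes (UNIV :: 'm set)}. of_int (sign (to_wo \<circ> p \<circ> of_wo)) *
      (\<Prod>i\<in>UNIV. A $ of_wo i $ of_wo ((to_wo \<circ> p \<circ> of_wo) i)))"
    by (rule sum.reindex_bij_betw[OF bij, symmetric])
  also have "\<dots> = (\<Sum>p\<in>{p. p permutes (UNIV :: 'm set)}. of_int (sign p) * (\<Prod>i\<in>UNIV. A $ i $ p i))"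
  proof (rule sum.cong[OF refl])
    fix p assume "p \<in> {p. p permutes (UNIV :: 'm set)}"
    moreover have "(\<Prod>i\<in>UNIV. A $ of_wo i $ p (of_wo i)) = (\<Prod>i\<in>UNIV. A $ i $ p i)"
      by (rule prod.reindex_bij_betw[OF bij_of_wo])
    ultimately show "of_int (sign (to_wo \<circ> p \<circ> of_wo)) * (\<Prod>i\<in>UNIV. A $ of_wo i $ of_wo ((to_wo \<circ> p \<circ> of_wo) i)) =
        of_int (sign p) * (\<Prod>i\<in>UNIV. A $ i $ p i)"
      by (simp add: sign_to_wo of_wo_to_wo)
  qed
  finally show ?thesis by (simp add: det_def)
qed

definition vec_wo :: "real^'m \<Rightarrow> real^('m wo)" where "vec_wo x = (\<chi> i. x $ of_wo i)"
definition wo_vec :: "real^('m wo) \<Rightarrow> real^'m" where "wo_vec z = (\<chi> i. z $ to_wo i)"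

lemma vec_wo_inverse: "wo_vec (vec_wo x) = x" "vec_wo (wo_vec z) = z"
  by (simp_all add: vec_wo_def wo_vec_def vec_eq_iff to_wo_of_wo of_wo_to_wo)

lemma bounded_linear_vec_wo: "bounded_linear (vec_wo :: real^'m \<Rightarrow> real^('m::finite wo))"
  and bounded_linear_wo_vec: "bounded_linear (wo_vec :: real^('m wo) \<Rightarrow> real^'m)"
  unfolding linear_conv_bounded_linear[symmetric]
  by (auto intro!: linearI simp: vec_wo_def wo_vec_def vec_eq_iff)

lemma borel_vec_wo[measurable]:
  "vec_wo \<in> borel_measurable borel" "(wo_vec :: real^('m wo) \<Rightarrow> real^'m::finite) \<in> borel_measurable borel"
  by (auto intro!: borel_measurable_continuous_onI linear_continuous_on bounded_linear_vec_wo bounded_linear_wo_vec)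

lemma lborel_vec_box:
  fixes l u :: "real^'m"
  assumes "\<And>i. l $ i \<le> u $ i"
  shows "emeasure lborel (box l u) = (\<Prod>i\<in>UNIV. ennreal (u $ i - l $ i))"
proof -
  have le: "l \<bullet> b \<le> u \<bullet> b" if "b \<in> Basis" for b
    using that assms by (auto simp: Basis_vec_def inner_axis)
  have "emeasure lborel (box l u) = (\<Prod>b\<in>Basis. ennreal ((u - l) \<bullet> b))"
    using le by (subst prod_ennreal) (auto simp: emeasure_lborel_box inner_diff_left)
  also have "(Basis :: (real^'m) set) = (\<lambda>i. axis i 1) ` UNIV" by (auto simp: Basis_vec_def)
  also have "(\<Prod>b\<in>(\<lambda>i. axis i 1) ` UNIV. ennreal ((u - l) \<bullet> b)) = (\<Prod>i\<in>UNIV. ennreal (u $ i - l $ i))"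
    by (subst prod.reindex) (auto simp: inj_on_def axis_eq_axis inner_axis)
  finally show ?thesis .
qed

text \<open>
  Lebesgue measure is determined by its values on boxes; here the boxes are given by coordinates.
\<close>

lemma lborel_vec_eqI:
  fixes M :: "(real^'m) measure"
  assumes "\<And>l u. (\<And>i. l $ i \<le> u $ i) \<Longrightarrow> emeasure M (box l u) = (\<Prod>i\<in>UNIV. ennreal (u $ i - l $ i))"
    and "sets M = sets borel"
  shows "lborel = M"
proof (rule lborel_eqI[OF _ assms(2)])
  fix l u :: "real^'m" assume le: "\<And>b. b \<in> Basis \<Longrightarrow> l \<bullet> b \<le> u \<bullet> b"
  have "l $ i \<le> u $ i" for i using le[OF axis_in_Basis_iff[THEN iffD2], of 1 i] by (simp add: inner_axis)
  from assms(1)[OF this] lborel_vec_box[OF this] le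
  show "emeasure M (box l u) = ennreal (\<Prod>b\<in>Basis. (u - l) \<bullet> b)"
    by (simp add: emeasure_lborel_box)
qed

lemma mem_box_vec: "(x :: real^'m) \<in> box l u \<longleftrightarrow> (\<forall>i. l $ i < x $ i \<and> x $ i < u $ i)"
  by (auto simp: mem_box Basis_vec_def inner_axis)

lemma distr_vec_wo: "distr lborel borel (vec_wo :: real^'m \<Rightarrow> real^('m::finite wo)) = lborel"
proof (rule lborel_vec_eqI[symmetric])
  fix l u :: "real^('m wo)" assume le: "\<And>i. l $ i \<le> u $ i"
  have "vec_wo -` box l u = box (wo_vec l) (wo_vec u)"
    by (auto simp: mem_box_vec vec_wo_def wo_vec_def) (metis of_wo_to_wo, metis of_wo_to_wo, metis to_wo_of_wo, metis to_wo_of_wo)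
  then have "emeasure (distr lborel borel vec_wo) (box l u) = (\<Prod>i\<in>UNIV. ennreal (wo_vec u $ i - wo_vec l $ i))"
    using lborel_vec_box[of "wo_vec l" "wo_vec u"] le by (simp add: emeasure_distr wo_vec_def)
  also have "\<dots> = (\<Prod>i\<in>UNIV. ennreal (u $ to_wo i - l $ to_wo i))" by (simp add: wo_vec_def)
  also have "\<dots> = (\<Prod>i\<in>UNIV. ennreal (u $ i - l $ i))"
    by (rule prod.reindex_bij_betw[OF bij_to_wo])
  finally show "emeasure (distr lborel borel vec_wo) (box l u) = (\<Prod>i\<in>UNIV. ennreal (u $ i - l $ i))" .
qed simp

lemma nn_integral_vec_wo:
  fixes F :: "real^'m \<Rightarrow> ennreal"
  assumes [measurable]: "F \<in> borel_measurable borel"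
  shows "(\<integral>\<^sup>+z. F (wo_vec z) \<partial>lborel) = (\<integral>\<^sup>+x. F x \<partial>lborel)"
  by (subst distr_vec_wo[symmetric], subst nn_integral_distr) (auto simp: vec_wo_inverse)

subsection \<open>Change of variables for non-negative Borel functions\<close>

lemma ennreal_indicator_mult: "ennreal (indicator S z * x) = ennreal x * indicator S z"
  by (simp split: split_indicator)

lemma has_integral_iff_nn_integral_on:
  fixes f :: "real^'n \<Rightarrow> real"
  assumes "\<And>z. f z \<ge> 0" "b \<ge> 0" and m: "(\<lambda>z. indicator S z * f z) \<in> borel_measurable borel"
  shows "(f has_integral b) S \<longleftrightarrow> (\<integral>\<^sup>+z. ennreal (f z) * indicator S z \<partial>lborel) = ennreal b"
proof -
  have "(f has_integral b) S \<longleftrightarrow> ((\<lambda>z. indicator S z * f z) has_integral b) UNIV"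
  proof -
    have "(\<lambda>z. indicator S z * f z) = (\<lambda>z. if z \<in> S then f z else 0)"
      by (auto simp: indicator_def)
    then show ?thesis by (simp only: has_integral_restrict_UNIV)
  qed
  also have "\<dots> \<longleftrightarrow> (\<integral>\<^sup>+z. ennreal (indicator S z * f z) \<partial>lborel) = ennreal b"
  proof -
    have "(\<lambda>z. indicator S z * f z) \<in> borel_measurable lborel" using m by simp
    then have "(\<lambda>z. indicator S z * f z) \<in> borel_measurable lebesgue" by (rule measurable_completion)
    then show ?thesis
      by (subst has_integral_iff_nn_integral_lebesgue) (simp_all add: nn_integral_completion assms(1,2))
  qed
  also have "(\<integral>\<^sup>+z. ennreal (indicator S z * f z) \<partial>lborel) = (\<integral>\<^sup>+z. ennreal (f z) * indicator S z \<partial>lborel)"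
    by (intro nn_integral_cong) (auto simp: indicator_def)
  finally show ?thesis .
qed

text \<open>
  The Henstock-Kurzweil version says that both sides are finite together and then equal. For
  non-negative functions this determines the Lebesgue integrals, infinite values included.
\<close>

lemma nn_integral_change_of_variables_wellorder:
  fixes g :: "real^'n::{finite,wellorder} \<Rightarrow> real^'n::_" and f :: "real^'n::_ \<Rightarrow> real"
  assumes S: "S \<in> sets borel" and g: "\<And>x. x \<in> S \<Longrightarrow> (g has_derivative g' x) (at x)" and inj: "inj_on g S"
    and f: "\<And>z. f z \<ge> 0"
    and m1: "(\<lambda>z. indicator (g ` S) z * f z) \<in> borel_measurable borel"
    and m2: "(\<lambda>y. indicator S y * (\<bar>det (matrix (g' y))\<bar> * f (g y))) \<in> borel_measurable borel"
  shows "(\<integral>\<^sup>+z. ennreal (f z) * indicator (g ` S) z \<partial>lborel) =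
    (\<integral>\<^sup>+y. ennreal (\<bar>det (matrix (g' y))\<bar> * f (g y)) * indicator S y \<partial>lborel)" (is "?L = ?R")
proof -
  have S': "S \<in> sets lebesgue" using S by auto
  have "((\<lambda>y. \<bar>det (matrix (g' y))\<bar> * f (g y)) has_integral b) S \<longleftrightarrow> (f has_integral b) (g ` S)" for b
  proof -
    have ai: "(\<lambda>y. \<bar>det (matrix (g' y))\<bar> * f (g y)) absolutely_integrable_on S \<longleftrightarrow>
        (\<lambda>y. \<bar>det (matrix (g' y))\<bar> * f (g y)) integrable_on S"
      "f absolutely_integrable_on (g ` S) \<longleftrightarrow> f integrable_on (g ` S)"
      using f by (auto intro!: absolutely_integrable_on_iff_nonneg)
    from has_absolute_integral_change_of_variables[OF S' has_derivative_at_withinI[OF g] inj,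
        of "\<lambda>z. vec (f z) :: real^1" "vec b"] show ?thesis
      by (simp add: absolutely_integrable_on_1_iff integral_on_1_eq ai has_integral_iff)
  qed
  then have *: "?R = ennreal b \<longleftrightarrow> ?L = ennreal b" if "b \<ge> 0" for b
    using has_integral_iff_nn_integral_on[OF f that m1] has_integral_iff_nn_integral_on[OF _ that m2] f by simp
  show ?thesis
    by (cases ?L; cases ?R) (use * in \<open>auto simp: top_unique, metis+\<close>)
qed

theorem nn_integral_change_of_variables:
  fixes g :: "real^'m \<Rightarrow> real^'m" and f :: "real^'m \<Rightarrow> real"
  assumes S: "S \<in> sets borel" and g: "\<And>x. x \<in> S \<Longrightarrow> (g has_derivative g' x) (at x)" and inj: "inj_on g S"
    and f: "\<And>z. f z \<ge> 0"
    and m1: "(\<lambda>z. indicator (g ` S) z * f z) \<in> borel_measurable borel"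
    and m2: "(\<lambda>y. indicator S y * (\<bar>det (matrix (g' y))\<bar> * f (g y))) \<in> borel_measurable borel"
  shows "(\<integral>\<^sup>+z. ennreal (f z) * indicator (g ` S) z \<partial>lborel) =
    (\<integral>\<^sup>+y. ennreal (\<bar>det (matrix (g' y))\<bar> * f (g y)) * indicator S y \<partial>lborel)"
proof -
  define h where "h = vec_wo \<circ> g \<circ> wo_vec"
  define h' where "h' z = vec_wo \<circ> g' (wo_vec z) \<circ> wo_vec" for z
  have mem: "z \<in> vec_wo ` T \<longleftrightarrow> wo_vec z \<in> T" for z and T :: "(real^'m) set"
    by (metis image_iff vec_wo_inverse)
  have hS: "h ` vec_wo ` S = vec_wo ` g ` S"
    by (simp add: h_def image_comp o_def vec_wo_inverse)
  have eqS: "indicator (vec_wo ` S) z = (indicator S (wo_vec z) :: real)"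
      "indicator (vec_wo ` S) z = (indicator S (wo_vec z) :: ennreal)" for z
    by (simp_all add: indicator_def mem)
  have eqgS: "indicator (h ` vec_wo ` S) z = (indicator (g ` S) (wo_vec z) :: real)"
    "indicator (h ` vec_wo ` S) z = (indicator (g ` S) (wo_vec z) :: ennreal)" for z
    by (simp_all add: indicator_def mem hS)
  have det: "det (matrix (h' z)) = det (matrix (g' (wo_vec z)))" for z
  proof -
    have "wo_vec (axis j 1) = axis (of_wo j) 1" for j :: "'m wo"
      by (simp add: wo_vec_def vec_eq_iff axis_def of_wo_eq_iff eq_commute[of _ "of_wo _"] to_wo_of_wo)
    then have "matrix (h' z) = (\<chi> i j. matrix (g' (wo_vec z)) $ of_wo i $ of_wo j)"
      by (simp add: matrix_def h'_def vec_wo_def)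
    then show ?thesis by (simp add: det_to_wo)
  qed
  have "(\<integral>\<^sup>+z. ennreal (f (wo_vec z)) * indicator (h ` vec_wo ` S) z \<partial>lborel) =
    (\<integral>\<^sup>+y. ennreal (\<bar>det (matrix (h' y))\<bar> * f (wo_vec (h y))) * indicator (vec_wo ` S) y \<partial>lborel)"
  proof (rule nn_integral_change_of_variables_wellorder)
    have "vec_wo ` S = wo_vec -` S \<inter> space borel"
      by (auto simp: mem vec_wo_inverse)
    then show "vec_wo ` S \<in> sets borel"
      using measurable_sets[OF borel_vec_wo(2) S] by simp
    fix x assume "x \<in> vec_wo ` S"
    then have x: "wo_vec x \<in> S" by (simp add: mem)
    show "(h has_derivative h' x) (at x)"
      unfolding h_def h'_def
      by (intro diff_chain_at bounded_linear_imp_has_derivative bounded_linear_vec_wo bounded_linear_wo_vec)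
        (auto intro!: g x)
  next
    show "inj_on h (vec_wo ` S)"
    proof (rule inj_onI)
      fix x y assume xy: "x \<in> vec_wo ` S" "y \<in> vec_wo ` S" "h x = h y"
      then have "wo_vec (h x) = wo_vec (h y)" by simp
      then have "g (wo_vec x) = g (wo_vec y)" by (simp add: h_def vec_wo_inverse)
      then have "wo_vec x = wo_vec y" using xy(1,2) inj by (simp add: mem inj_on_def)
      then show "x = y" by (metis vec_wo_inverse(2))
    qed
    show "(\<lambda>z. indicator (h ` vec_wo ` S) z * f (wo_vec z)) \<in> borel_measurable borel"
      unfolding eqgS by (rule measurable_compose[OF borel_vec_wo(2) m1])
    show "(\<lambda>y. indicator (vec_wo ` S) y * (\<bar>det (matrix (h' y))\<bar> * f (wo_vec (h y)))) \<in> borel_measurable borel"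
      unfolding eqS det using measurable_compose[OF borel_vec_wo(2) m2] by (simp add: h_def vec_wo_inverse)
  qed (rule f)
  then have E: "(\<integral>\<^sup>+z. ennreal (indicator (g ` S) (wo_vec z) * f (wo_vec z)) \<partial>lborel) =
    (\<integral>\<^sup>+y. ennreal (indicator S (wo_vec y) * (\<bar>det (matrix (g' (wo_vec y)))\<bar> * f (g (wo_vec y)))) \<partial>lborel)"
    unfolding eqgS eqS det ennreal_indicator_mult by (simp add: h_def vec_wo_inverse)
  have "(\<integral>\<^sup>+z. ennreal (indicator (g ` S) z * f z) \<partial>lborel) =
    (\<integral>\<^sup>+y. ennreal (indicator S y * (\<bar>det (matrix (g' y))\<bar> * f (g y))) \<partial>lborel)"
    using E nn_integral_vec_wo[OF measurable_compose[OF m1 measurable_ennreal]]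
      nn_integral_vec_wo[OF measurable_compose[OF m2 measurable_ennreal]] by simp
  then show ?thesis unfolding ennreal_indicator_mult .
qed

section \<open>The Riemannian volume\<close>

definition vol_density :: "('a, 'm::finite) rchart \<Rightarrow> real^'m \<Rightarrow> real" where
  "vol_density c y = sqrt (det (chart_metric c y))"

text \<open>
  The property by which \<open>vol\<close> is described; that some measure has it, and only one, is shown below.
\<close>

definition volume_spec :: "('a::topological_space, 'm::finite) riem \<Rightarrow> 'a measure \<Rightarrow> bool" where
  "volume_spec A \<mu> \<longleftrightarrow> sets \<mu> = sets borel \<and>
     (\<forall>c\<in>A. \<forall>B\<in>sets borel. B \<subseteq> chart_dom c \<longrightarrow>
        emeasure \<mu> B = (\<integral>\<^sup>+y. ennreal (vol_density c y) * indicator (chart_map c ` B) y \<partial>lborel))"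

lemma vol_eq_The: "vol A = (THE \<mu>. volume_spec A \<mu>)"
  unfolding vol_def volume_spec_def vol_density_def ..

context riemannian
begin

lemma vol_density_pos: "c \<in> A \<Longrightarrow> y \<in> chart_image c \<Longrightarrow> vol_density c y > 0"
  unfolding vol_density_def using posdef_det_pos[OF pos_metric] by simp

lemma continuous_vol_density: "c \<in> A \<Longrightarrow> continuous_on (chart_image c) (vol_density c)"
proof -
  assume c: "c \<in> A"
  show ?thesis unfolding vol_density_def[abs_def] det_def
    by (intro continuous_intros smooth_on_continuous smooth_metric c)
qed

lemma chart_map_image_eq:
  assumes "c \<in> A" "B \<subseteq> chart_dom c"
  shows "chart_map c ` B = {y \<in> chart_image c. chart_inv c y \<in> B}"
proof safe
  fix x assume "x \<in> B"
  then show "chart_map c x \<in> chart_image c" "chart_inv c (chart_map c x) \<in> B"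
    using assms chart_map_in[OF assms(1)] chart_inv_map[OF assms(1)] by auto
next
  fix y assume "y \<in> chart_image c" "chart_inv c y \<in> B"
  then show "y \<in> chart_map c ` B" using chart_map_inv[OF assms(1)] by (metis imageI)
qed

lemma borel_chart_map_image:
  assumes c: "c \<in> A" and B: "B \<in> sets borel" "B \<subseteq> chart_dom c"
  shows "chart_map c ` B \<in> sets borel"
proof -
  have "continuous_on (chart_image c) (chart_inv c)"
    using chart_homeo[OF c] by (simp add: homeomorphism_def)
  then have "chart_inv c \<in> borel_measurable (restrict_space borel (chart_image c))"
    by (rule borel_measurable_continuous_on_restrict)
  from measurable_sets[OF this B(1)] have "chart_inv c -` B \<inter> chart_image c \<in> sets (restrict_space borel (chart_image c))"
    by (simp add: space_restrict_space)
  then have "chart_inv c -` B \<inter> chart_image c \<in> sets borel"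
    using open_image[OF c] by (auto simp: sets_restrict_space_iff)
  moreover have "chart_map c ` B = chart_inv c -` B \<inter> chart_image c"
    unfolding chart_map_image_eq[OF c B(2)] by auto
  ultimately show ?thesis by simp
qed

lemma borel_density_on:
  assumes c: "c \<in> A" and T: "T \<in> sets borel" "T \<subseteq> chart_image c"
  shows "(\<lambda>y. indicator T y * vol_density c y) \<in> borel_measurable borel"
proof -
  have "(\<lambda>y. indicator T y *\<^sub>R vol_density c y) \<in> borel_measurable borel"
    by (rule borel_measurable_continuous_on_indicator[OF T(1) continuous_on_subset[OF continuous_vol_density[OF c] T(2)]])
  then show ?thesis by simp
qed

definition chart_vol :: "('a, 'm) rchart \<Rightarrow> 'a set \<Rightarrow> ennreal" where
  "chart_vol c B = (\<integral>\<^sup>+y. ennreal (vol_density c y) * indicator (chart_map c ` B) y \<partial>lborel)"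

text \<open>
  Since \<open>det G = (det J)\<^sup>2 det H\<close>, the densities of two charts differ by \<open>\<bar>det J\<bar>\<close>, which is the
  factor in the change of variables formula.
\<close>

lemma chart_vol_compatible:
  assumes c: "c \<in> A" and d: "d \<in> A" and B: "B \<in> sets borel" "B \<subseteq> chart_dom c" "B \<subseteq> chart_dom d"
  shows "chart_vol c B = chart_vol d B"
proof -
  define J where "J y = matrix (frechet_derivative (transition c d) (at y))" for y
  interpret coord_change "chart_map c ` (chart_dom c \<inter> chart_dom d)" "chart_image d" "transition c d" "chart_metric c" "chart_metric d" J
    unfolding J_def[abs_def] by (rule coord_change_transition[OF c d])
  have sub: "y \<in> chart_map c ` (chart_dom c \<inter> chart_dom d)" if "y \<in> chart_map c ` B" for y
    using that B by auto
  have im: "transition c d ` chart_map c ` B = chart_map d ` B"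
    using B(2) by (force simp: transition_def chart_inv_map c image_image)
  have dens: "\<bar>det (J y)\<bar> * vol_density d (transition c d y) = vol_density c y" if "y \<in> chart_map c ` B" for y
    unfolding vol_density_def G_eq[OF sub[OF that]]
    by (simp add: det_mul real_sqrt_mult)
  have ind: "indicator (chart_map c ` B) y * (\<bar>det (J y)\<bar> * vol_density d (transition c d y)) =
      indicator (chart_map c ` B) y * vol_density c y" for y
    by (simp add: dens split: split_indicator)
  \<comment> \<open>The density is replaced by zero off \<open>B\<close>, as it may be negative or non-measurable off the chart image.\<close>
  have "(\<integral>\<^sup>+z. ennreal (vol_density' z) * indicator (transition c d ` chart_map c ` B) z \<partial>lborel) =
    (\<integral>\<^sup>+y. ennreal (\<bar>det (J y)\<bar> * vol_density' (transition c d y)) * indicator (chart_map c ` B) y \<partial>lborel)"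
    if v: "vol_density' = (\<lambda>z. indicator (chart_map d ` B) z * vol_density d z)" for vol_density'
    unfolding J_def
  proof (rule nn_integral_change_of_variables)
    show "chart_map c ` B \<in> sets borel" by (rule borel_chart_map_image[OF c B(1,2)])
    show "(transition c d has_derivative frechet_derivative (transition c d) (at y)) (at y)"
      if "y \<in> chart_map c ` B" for y
      by (rule differentiable_has_derivative[OF diff_\<Phi>[OF sub[OF that]]])
    show "inj_on (transition c d) (chart_map c ` B)"
      by (rule inj_on_inverseI[of _ "transition d c"]) (rule transition_inverse(2)[OF c d sub])
    show "0 \<le> vol_density' z" for z
      using vol_density_pos[OF d] chart_map_in[OF d] B(3) by (force simp: v indicator_def intro: less_imp_le)
    show "(\<lambda>z. indicator (transition c d ` chart_map c ` B) z * vol_density' z) \<in> borel_measurable borel"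
      unfolding im v
      by (intro borel_measurable_times borel_measurable_indicator borel_density_on d borel_chart_map_image B)
        (use B(3) chart_map_in[OF d] in auto)
    have "(\<lambda>y. indicator (chart_map c ` B) y * (\<bar>det (J y)\<bar> * vol_density' (transition c d y))) =
       (\<lambda>y. indicator (chart_map c ` B) y * vol_density c y)"
      using im by (auto simp: v ind fun_eq_iff dens split: split_indicator)
    moreover have "(\<lambda>y. indicator (chart_map c ` B) y * vol_density c y) \<in> borel_measurable borel"
      by (intro borel_density_on c borel_chart_map_image B) (use B(2) chart_map_in[OF c] in auto)
    ultimately show "(\<lambda>y. indicator (chart_map c ` B) y * (\<bar>det (matrix (frechet_derivative (transition c d) (at y)))\<bar> * vol_density' (transition c d y))) \<in> borel_measurable borel"
      unfolding J_def by simp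
  qed
  from this[OF refl] have "(\<integral>\<^sup>+z. ennreal (vol_density d z) * indicator (chart_map d ` B) z \<partial>lborel) =
    (\<integral>\<^sup>+y. ennreal (vol_density c y) * indicator (chart_map c ` B) y \<partial>lborel)"
  proof -
    assume E: "(\<integral>\<^sup>+z. ennreal (indicator (chart_map d ` B) z * vol_density d z) * indicator (transition c d ` chart_map c ` B) z \<partial>lborel) =
    (\<integral>\<^sup>+y. ennreal (\<bar>det (J y)\<bar> * (indicator (chart_map d ` B) (transition c d y) * vol_density d (transition c d y))) * indicator (chart_map c ` B) y \<partial>lborel)"
    have "(\<lambda>z. ennreal (indicator (chart_map d ` B) z * vol_density d z) * indicator (transition c d ` chart_map c ` B) z) =
       (\<lambda>z. ennreal (vol_density d z) * indicator (chart_map d ` B) z)"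
      unfolding im by (auto simp: fun_eq_iff split: split_indicator)
    moreover have "(\<lambda>y. ennreal (\<bar>det (J y)\<bar> * (indicator (chart_map d ` B) (transition c d y) * vol_density d (transition c d y))) * indicator (chart_map c ` B) y) =
       (\<lambda>y. ennreal (vol_density c y) * indicator (chart_map c ` B) y)"
      using im by (auto simp: fun_eq_iff dens split: split_indicator)
    ultimately show ?thesis using E by simp
  qed
  then show ?thesis by (simp add: chart_vol_def)
qed

text \<open>Countable additivity is that of the Lebesgue integral, since charts are injective.\<close>

lemma chart_vol_suminf:
  assumes c: "c \<in> A" and B: "range B \<subseteq> sets borel" "disjoint_family B" "\<And>i. B i \<subseteq> chart_dom c"
  shows "(\<Sum>i. chart_vol c (B i)) = chart_vol c (\<Union>i. B i)"
proof -
  have m: "(\<lambda>y. ennreal (vol_density c y) * indicator (chart_map c ` B i) y) \<in> borel_measurable lborel" for i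
  proof -
    have "(\<lambda>y. indicator (chart_map c ` B i) y * vol_density c y) \<in> borel_measurable borel"
      by (intro borel_density_on borel_chart_map_image c) (use B(1) B(3)[of i] chart_map_in[OF c] in auto)
    from measurable_compose[OF this measurable_ennreal] show ?thesis by (simp add: ennreal_indicator_mult)
  qed
  have disj: "disjoint_family (\<lambda>i. chart_map c ` B i)"
  proof -
    have "inj_on (chart_map c) (chart_dom c)" by (rule inj_on_inverseI[of _ "chart_inv c"]) (rule chart_inv_map[OF c])
    then show ?thesis using B(2,3) unfolding disjoint_family_on_def inj_on_def by blast
  qed
  have "(\<Sum>i. chart_vol c (B i)) = (\<integral>\<^sup>+y. (\<Sum>i. ennreal (vol_density c y) * indicator (chart_map c ` B i) y) \<partial>lborel)"
    unfolding chart_vol_def by (rule nn_integral_suminf[OF m, symmetric])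
  also have "\<dots> = chart_vol c (\<Union>i. B i)"
    unfolding chart_vol_def image_UN
    by (intro nn_integral_cong) (simp add: ennreal_suminf_cmult suminf_indicator[OF disj])
  finally show ?thesis .
qed

lemma countable_atlas: "\<exists>e :: nat \<Rightarrow> ('a, 'm) rchart. range e \<subseteq> A \<and> (\<Union>n. chart_dom (e n)) = UNIV"
proof -
  have "\<And>S. S \<in> chart_dom ` A \<Longrightarrow> open S" using open_dom by auto
  then obtain F where F: "F \<subseteq> chart_dom ` A" "countable F" "\<Union>F = \<Union>(chart_dom ` A)"
    using Lindelof[of "chart_dom ` A"] by blast
  have U: "\<Union>F = UNIV" using F(3) manifold unfolding riemannian_manifold_def by simp
  then have ne: "F \<noteq> {}" by auto
  have "\<forall>S\<in>F. \<exists>c\<in>A. chart_dom c = S" using F(1) by blast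
  then obtain h where h: "\<forall>S\<in>F. h S \<in> A \<and> chart_dom (h S) = S" by metis
  have r: "range (from_nat_into F) = F" using range_from_nat_into[OF ne F(2)] .
  have fi: "from_nat_into F n \<in> F" for n using r by blast
  then have "(\<Union>n. chart_dom (h (from_nat_into F n))) = (\<Union>n. from_nat_into F n)" using h by auto
  also have "\<dots> = UNIV" using r U by simp
  finally show ?thesis using h fi by (intro exI[of _ "\<lambda>n. h (from_nat_into F n)"]) auto
qed

text \<open>
  A second countable manifold is covered by countably many charts, and removing from each the
  preceding ones leaves disjoint Borel pieces.
\<close>

lemma chart_partition:
  "\<exists>(e :: nat \<Rightarrow> ('a, 'm) rchart) D. range e \<subseteq> A \<and> (\<forall>n. D n \<subseteq> chart_dom (e n)) \<and> range D \<subseteq> sets borel \<and>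
     disjoint_family D \<and> (\<Union>n. D n) = UNIV"
proof -
  obtain e :: "nat \<Rightarrow> ('a, 'm) rchart" where e: "range e \<subseteq> A" "(\<Union>n. chart_dom (e n)) = UNIV"
    using countable_atlas by blast
  let ?D = "disjointed (\<lambda>n. chart_dom (e n))"
  have "chart_dom (e n) \<in> sets borel" for n using e(1) open_dom by (auto intro: borel_open)
  then have "range ?D \<subseteq> sets borel" by (intro sets.range_disjointed_sets) auto
  moreover have "(\<Union>n. ?D n) = UNIV" using e(2) by (simp only: UN_disjointed_eq)
  ultimately show ?thesis
    using e(1) disjointed_subset[of "\<lambda>n. chart_dom (e n)"] disjoint_family_disjointed[of "\<lambda>n. chart_dom (e n)"]
    by (intro exI[of _ e] exI[of _ ?D]) blast
qed

lemma volume_spec_unique: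
  assumes "volume_spec A \<mu>" "volume_spec A \<nu>"
  shows "\<mu> = \<nu>"
proof -
  obtain e :: "nat \<Rightarrow> ('a, 'm) rchart" and D where e: "range e \<subseteq> A" "\<And>n. D n \<subseteq> chart_dom (e n)"
    "range D \<subseteq> sets borel" "disjoint_family D" "(\<Union>n. D n) = UNIV"
    using chart_partition by blast
  have E: "emeasure \<rho> B = (\<Sum>n. chart_vol (e n) (B \<inter> D n))" if "volume_spec A \<rho>" "B \<in> sets borel" for \<rho> B
  proof -
    have s: "sets \<rho> = sets borel" using that(1) by (simp add: volume_spec_def)
    have "emeasure \<rho> B = emeasure \<rho> (\<Union>n. B \<inter> D n)" using e(5) by (simp flip: Int_UN_distrib)
    also have "\<dots> = (\<Sum>n. emeasure \<rho> (B \<inter> D n))"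
    proof (rule suminf_emeasure[symmetric])
      show "disjoint_family (\<lambda>n. B \<inter> D n)" using e(4) unfolding disjoint_family_on_def by blast
    qed (use e that s in auto)
    also have "\<dots> = (\<Sum>n. chart_vol (e n) (B \<inter> D n))"
    proof (rule suminf_cong)
      fix n
      have "e n \<in> A" "B \<inter> D n \<in> sets borel" "B \<inter> D n \<subseteq> chart_dom (e n)" using e that by auto
      then show "emeasure \<rho> (B \<inter> D n) = chart_vol (e n) (B \<inter> D n)"
        using that(1) unfolding volume_spec_def chart_vol_def by blast
    qed
    finally show ?thesis .
  qed
  show ?thesis
    by (rule measure_eqI) (use assms E in \<open>auto simp: volume_spec_def\<close>)
qed

text \<open>
  Glue the chart volumes along a partition into pieces of charts; compatibility makes the result
  independent of the chart in which a set is measured.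
\<close>

lemma volume_spec_exists: "\<exists>\<mu>. volume_spec A \<mu>"
proof -
  obtain e :: "nat \<Rightarrow> ('a, 'm) rchart" and D where e: "range e \<subseteq> A" "\<And>n. D n \<subseteq> chart_dom (e n)"
    "range D \<subseteq> sets borel" "disjoint_family D" "(\<Union>n. D n) = UNIV"
    using chart_partition by blast
  define F where "F B = (\<Sum>n. chart_vol (e n) (B \<inter> D n))" for B
  define \<mu> where "\<mu> = measure_of UNIV (sets borel) F"
  have DB: "D n \<in> sets borel" "e n \<in> A" for n using e by auto
  have ca: "countably_additive (sets borel) F"
  proof (rule countably_additiveI)
    fix B :: "nat \<Rightarrow> 'a set" assume B: "range B \<subseteq> sets borel" "disjoint_family B" "(\<Union>i. B i) \<in> sets borel"
    have "(\<Sum>i. F (B i)) = (\<Sum>i. \<integral>\<^sup>+n. chart_vol (e n) (B i \<inter> D n) \<partial>count_space UNIV)"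
      by (simp add: F_def nn_integral_count_space_nat)
    also have "\<dots> = (\<integral>\<^sup>+n. (\<Sum>i. chart_vol (e n) (B i \<inter> D n)) \<partial>count_space UNIV)"
      by (rule nn_integral_suminf[symmetric]) simp
    also have "\<dots> = (\<integral>\<^sup>+n. chart_vol (e n) ((\<Union>i. B i) \<inter> D n) \<partial>count_space UNIV)"
    proof (intro nn_integral_cong)
      fix n
      have "(\<Sum>i. chart_vol (e n) (B i \<inter> D n)) = chart_vol (e n) (\<Union>i. B i \<inter> D n)"
      proof (rule chart_vol_suminf)
        show "disjoint_family (\<lambda>i. B i \<inter> D n)" using B(2) unfolding disjoint_family_on_def by blast
      qed (use B DB e(2)[of n] in auto)
      then show "(\<Sum>i. chart_vol (e n) (B i \<inter> D n)) = chart_vol (e n) ((\<Union>i. B i) \<inter> D n)" by simp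
    qed
    also have "\<dots> = F (\<Union>i. B i)" by (simp add: F_def nn_integral_count_space_nat)
    finally show "(\<Sum>i. F (B i)) = F (\<Union>i. B i)" .
  qed
  have s: "sets \<mu> = sets borel" unfolding \<mu>_def
    by (metis sets.sigma_sets_eq sets_measure_of space_borel sets.space_closed)
  have em: "emeasure \<mu> B = F B" if "B \<in> sets borel" for B
  proof (rule emeasure_measure_of[OF \<mu>_def])
    show "positive (sets \<mu>) F" by (simp add: positive_def F_def chart_vol_def)
    show "countably_additive (sets \<mu>) F" using ca s by simp
  qed (use that s in auto)
  have "volume_spec A \<mu>" unfolding volume_spec_def
  proof (intro conjI ballI impI s)
    fix c B assume c: "c \<in> A" and B: "B \<in> sets borel" "B \<subseteq> chart_dom c"
    have "emeasure \<mu> B = (\<Sum>n. chart_vol c (B \<inter> D n))"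
      unfolding em[OF B(1)] F_def
      by (intro suminf_cong chart_vol_compatible) (use B DB c e(2)[THEN subsetD] in auto)
    also have "\<dots> = chart_vol c (\<Union>n. B \<inter> D n)"
    proof (rule chart_vol_suminf)
      show "disjoint_family (\<lambda>n. B \<inter> D n)" using e(4) unfolding disjoint_family_on_def by blast
    qed (use B DB c in auto)
    also have "(\<Union>n. B \<inter> D n) = B" using e(5) by (simp flip: Int_UN_distrib)
    finally show "emeasure \<mu> B = (\<integral>\<^sup>+y. ennreal (vol_density c y) * indicator (chart_map c ` B) y \<partial>lborel)"
      by (simp add: chart_vol_def)
  qed
  then show ?thesis by blast
qed

lemma vol_spec: "volume_spec A (vol A)"
  unfolding vol_eq_The by (rule theI') (use volume_spec_exists volume_spec_unique in blast)

lemma vol_eqI: "volume_spec A \<mu> \<Longrightarrow> vol A = \<mu>"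
  by (rule volume_spec_unique[OF vol_spec])

lemma sets_vol[measurable_cong, simp]: "sets (vol A) = sets borel"
  using vol_spec by (simp add: volume_spec_def)

lemma space_vol[simp]: "space (vol A) = UNIV"
  using sets_eq_imp_space_eq[OF sets_vol] by simp

lemma emeasure_vol_chart:
  "c \<in> A \<Longrightarrow> B \<in> sets borel \<Longrightarrow> B \<subseteq> chart_dom c \<Longrightarrow>
    emeasure (vol A) B = (\<integral>\<^sup>+y. ennreal (vol_density c y) * indicator (chart_map c ` B) y \<partial>lborel)"
  using vol_spec by (simp add: volume_spec_def)

lemma vol_open_pos:
  assumes U: "open U" "U \<noteq> {}"
  shows "emeasure (vol A) U > 0"
proof (rule ccontr)
  assume "\<not> emeasure (vol A) U > 0"
  then have z: "emeasure (vol A) U = 0" by (simp add: not_gr_zero)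
  obtain x where x: "x \<in> U" using U by auto
  let ?c = "chart_at A x"
  have c: "?c \<in> A" "x \<in> chart_dom ?c" using chart_at_works by auto
  let ?V = "U \<inter> chart_dom ?c"
  have oV: "open ?V" using U open_dom[OF c(1)] by auto
  have "emeasure (vol A) ?V = 0"
    using z emeasure_mono[of ?V U "vol A"] U by auto
  then have int0: "(\<integral>\<^sup>+y. ennreal (vol_density ?c y) * indicator (chart_map ?c ` ?V) y \<partial>lborel) = 0"
    using emeasure_vol_chart[OF c(1), of ?V] oV by auto
  have oI: "open (chart_map ?c ` ?V)" by (rule open_chart_image[OF c(1) oV]) auto
  have "(\<lambda>y. ennreal (indicator (chart_map ?c ` ?V) y * vol_density ?c y)) \<in> borel_measurable borel"
    by (intro measurable_compose[OF borel_density_on[OF c(1)] measurable_ennreal])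
      (use oI in \<open>auto intro: chart_map_in[OF c(1)]\<close>)
  then have "AE y in lborel. ennreal (vol_density ?c y) * indicator (chart_map ?c ` ?V) y = 0"
    using int0 by (subst (asm) nn_integral_0_iff_AE) (auto simp: ennreal_indicator_mult)
  then have "AE y in lborel. y \<notin> chart_map ?c ` ?V"
  proof (rule AE_mp, intro AE_I2 impI notI)
    fix y assume 1: "ennreal (vol_density ?c y) * indicator (chart_map ?c ` ?V) y = 0" and y: "y \<in> chart_map ?c ` ?V"
    then have "y \<in> chart_image ?c" using chart_map_in[OF c(1)] by auto
    then show False using 1 y vol_density_pos[OF c(1)] by (auto simp: ennreal_eq_0_iff dest: leD)
  qed
  then have "emeasure lborel (chart_map ?c ` ?V) = 0"
    using oI by (subst (asm) AE_iff_measurable[of "chart_map ?c ` ?V"]) auto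
  then have "negligible (chart_map ?c ` ?V)"
    using oI by (auto simp: negligible_iff_null_sets null_sets_def)
  moreover have "chart_map ?c ` ?V \<noteq> {}" using x c by auto
  ultimately show False using open_not_negligible[OF oI] by blast
qed

lemma vol_locally_finite: "\<exists>U. open U \<and> x \<in> U \<and> emeasure (vol A) U < \<infinity>"
proof -
  let ?c = "chart_at A x"
  have c: "?c \<in> A" "x \<in> chart_dom ?c" using chart_at_works by auto
  let ?y = "chart_map ?c x"
  have "?y \<in> chart_image ?c" by (rule chart_map_in[OF c])
  then obtain r where r: "r > 0" "cball ?y r \<subseteq> chart_image ?c"
    using open_image[OF c(1)] open_contains_cball by blast
  define U where "U = chart_inv ?c ` ball ?y r"
  have bsub: "ball ?y r \<subseteq> chart_image ?c" using r(2) by auto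
  have cU: "chart_map ?c ` U = ball ?y r"
    using chart_map_inv[OF c(1)] bsub by (force simp: U_def image_image)
  have Us: "U \<subseteq> chart_dom ?c" using chart_inv_in[OF c(1)] bsub by (auto simp: U_def)
  have "openin (top_of_set (chart_image ?c)) (ball ?y r)" using bsub by (auto simp: openin_open)
  then have "openin (top_of_set (chart_dom ?c)) U"
    using homeomorphism_imp_open_map[OF homeomorphism_symD[OF chart_homeo[OF c(1)]]] by (simp add: U_def)
  then have oU: "open U" using open_dom[OF c(1)] openin_open_trans by blast
  have xU: "x \<in> U" using r(1) chart_inv_map[OF c] unfolding U_def by (metis centre_in_ball imageI)
  have "compact (vol_density ?c ` cball ?y r)"
    by (intro compact_continuous_image continuous_on_subset[OF continuous_vol_density[OF c(1)] r(2)]) simp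
  then obtain C where C: "\<forall>y\<in>cball ?y r. norm (vol_density ?c y) \<le> C"
    using compact_imp_bounded bounded_iff by (metis (mono_tags, lifting) imageI)
  have "emeasure (vol A) U = (\<integral>\<^sup>+y. ennreal (vol_density ?c y) * indicator (ball ?y r) y \<partial>lborel)"
    using emeasure_vol_chart[OF c(1) _ Us] oU cU by auto
  also have "\<dots> \<le> (\<integral>\<^sup>+y. ennreal C * indicator (ball ?y r) y \<partial>lborel)"
  proof (intro nn_integral_mono)
    fix y
    have "vol_density ?c y \<le> C" if "y \<in> ball ?y r"
      using C[rule_format, of y] that by auto
    then show "ennreal (vol_density ?c y) * indicator (ball ?y r) y \<le> ennreal C * indicator (ball ?y r) y"
      by (auto simp: indicator_def intro!: ennreal_leI)
  qed
  also have "\<dots> = ennreal C * emeasure lborel (ball ?y r)"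
    by (rule nn_integral_cmult_indicator) simp
  also have "\<dots> < \<infinity>"
    using emeasure_lborel_ball_finite[of ?y r] by (simp add: ennreal_mult_less_top)
  finally show ?thesis using oU xU by blast
qed

lemma vol_compact_finite:
  assumes "compact K"
  shows "emeasure (vol A) K < \<infinity>"
proof -
  define \<U> where "\<U> = {U. open U \<and> emeasure (vol A) U < \<infinity>}"
  have "K \<subseteq> \<Union>\<U>" using vol_locally_finite unfolding \<U>_def by blast
  then obtain F where F: "F \<subseteq> \<U>" "finite F" "K \<subseteq> \<Union>F"
    using compactE[OF assms, of \<U>] unfolding \<U>_def by (metis (no_types, lifting) mem_Collect_eq)
  have Fs: "F \<subseteq> sets (vol A)" using F(1) by (auto simp: \<U>_def)
  have "emeasure (vol A) K \<le> emeasure (vol A) (\<Union>F)"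
    by (intro emeasure_mono F) (use Fs F(2) in \<open>auto intro!: sets.finite_Union simp del: sets_vol\<close>)
  also have "\<dots> \<le> (\<Sum>U\<in>F. emeasure (vol A) U)"
    using emeasure_subadditive_finite[of F "\<lambda>U. U" "vol A"] F(2) Fs by simp
  also have "\<dots> < \<infinity>" using F by (auto simp: \<U>_def)
  finally show ?thesis .
qed

end

section \<open>Hoelder's inequality and antipodal points\<close>

text \<open>
  After normalizing both factors this is Young's inequality, integrated.
\<close>

lemma Holder_inequality:
  fixes f g :: "'a \<Rightarrow> real"
  assumes r: "r > 1" "q > 1" "1 / r + 1 / q = 1"
    and m: "f \<in> borel_measurable M" "g \<in> borel_measurable M"
    and nonneg: "\<And>x. f x \<ge> 0" "\<And>x. g x \<ge> 0"
    and int: "integrable M (\<lambda>x. f x powr r)" "integrable M (\<lambda>x. g x powr q)"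
  shows "(\<integral>x. f x * g x \<partial>M) \<le> (\<integral>x. f x powr r \<partial>M) powr (1 / r) * (\<integral>x. g x powr q \<partial>M) powr (1 / q)"
proof -
  define F where "F = (\<integral>x. f x powr r \<partial>M)"
  define G where "G = (\<integral>x. g x powr q \<partial>M)"
  have FG: "F \<ge> 0" "G \<ge> 0" by (auto simp: F_def G_def intro: integral_nonneg_AE)
  show ?thesis
  proof (cases "F = 0 \<or> G = 0")
    case True
    then have "AE x in M. f x * g x = 0"
    proof
      assume "F = 0"
      then have "AE x in M. f x powr r = 0"
        unfolding F_def by (subst (asm) integral_nonneg_eq_0_iff_AE) (use int in auto)
      then show ?thesis by eventually_elim simp
    next
      assume "G = 0"
      then have "AE x in M. g x powr q = 0"
        unfolding G_def by (subst (asm) integral_nonneg_eq_0_iff_AE) (use int in auto)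
      then show ?thesis by eventually_elim simp
    qed
    then have "(\<integral>x. f x * g x \<partial>M) = (\<integral>x. 0 \<partial>M)" by (intro integral_cong_AE) (use m in auto)
    then show ?thesis by simp
  next
    case False
    then have pos: "F > 0" "G > 0" using FG by auto
    define a where "a = F powr (1 / r)"
    define b where "b = G powr (1 / q)"
    have ab: "a > 0" "b > 0" "a powr r = F" "b powr q = G"
      using pos r by (auto simp: a_def b_def powr_powr)
    have Y: "f x / a * (g x / b) \<le> (f x powr r / F) / r + (g x powr q / G) / q" for x
      using Youngs_inequality[of r q "f x / a" "g x / b"] r nonneg ab by (simp add: powr_divide)
    have "(\<integral>x. f x / a * (g x / b) \<partial>M) \<le> (\<integral>x. (f x powr r / F) / r + (g x powr q / G) / q \<partial>M)"
      by (rule integral_mono_AE') (use Y int ab r in \<open>auto intro!: add_nonneg_nonneg divide_nonneg_nonneg\<close>)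
    also have "\<dots> = (F / F) / r + (G / G) / q"
      using int by (simp add: F_def G_def)
    also have "\<dots> = 1" using pos r(3) by simp
    finally have "(\<integral>x. f x * g x \<partial>M) / (a * b) \<le> 1" by simp
    then show ?thesis using ab by (simp add: a_def b_def F_def G_def divide_le_eq)
  qed
qed

lemma continuous_parametric_integral:
  fixes F :: "real \<Rightarrow> 'a \<Rightarrow> real"
  assumes "\<And>t. F t \<in> borel_measurable M" "\<And>x. continuous_on UNIV (\<lambda>t. F t x)"
    and "integrable M G" "\<And>t x. \<bar>F t x\<bar> \<le> G x"
  shows "continuous_on UNIV (\<lambda>t. \<integral>x. F t x \<partial>M)"
proof (intro continuous_at_imp_continuous_on ballI, unfold continuous_at_sequentially, intro allI impI)
  fix t and \<tau> :: "nat \<Rightarrow> real" assume \<tau>: "\<tau> \<longlonglongrightarrow> t"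
  show "((\<lambda>t. \<integral>x. F t x \<partial>M) \<circ> \<tau>) \<longlonglongrightarrow> (\<integral>x. F t x \<partial>M)"
    unfolding o_def
  proof (rule integral_dominated_convergence[where w = G])
    show "AE x in M. (\<lambda>n. F (\<tau> n) x) \<longlonglongrightarrow> F t x"
    proof (rule AE_I2)
      fix x
      have "isCont (\<lambda>t. F t x) t" using assms(2)[of x] continuous_on_eq_continuous_at[OF open_UNIV] by blast
      then show "(\<lambda>n. F (\<tau> n) x) \<longlonglongrightarrow> F t x" by (rule isCont_tendsto_compose[OF _ \<tau>])
    qed
  qed (use assms in auto)
qed

text \<open>
  On the unit circle the difference of the values of a periodic function at antipodal points is odd
  under the antipodal map, so it vanishes somewhere.
\<close>

lemma antipodal_equal_value:
  fixes f :: "real \<Rightarrow> real"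
  assumes "continuous_on UNIV f" "\<And>t. f (t + 2 * pi) = f t"
  shows "\<exists>t. f t = f (t + pi)"
proof -
  define h where "h t = f t - f (t + pi)" for t
  have c: "continuous_on {0..pi} h" unfolding h_def
    by (intro continuous_intros continuous_on_compose2[OF assms(1)]) auto
  have hpi: "h pi = - h 0" using assms(2)[of 0] by (simp add: h_def)
  have "\<exists>t. 0 \<le> t \<and> t \<le> pi \<and> h t = 0"
  proof (cases "h 0 \<le> 0")
    case True
    then show ?thesis using IVT'[of h 0 0 pi] c hpi by auto
  next
    case False
    then show ?thesis using IVT2'[of h pi 0 0] c hpi by auto
  qed
  then show ?thesis by (auto simp: h_def)
qed

section \<open>Weighted second eigenvalues on a Riemannian manifold\<close>

lemma supp_subsetI: "closed K \<Longrightarrow> (\<And>x. x \<notin> K \<Longrightarrow> f x = 0) \<Longrightarrow> supp f \<subseteq> K"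
  unfolding supp_def by (rule closure_minimal) auto

lemma notin_supp: "x \<notin> supp f \<Longrightarrow> f x = 0"
  unfolding supp_def using closure_subset[of "{x. f x \<noteq> 0}"] by auto

lemma compact_suppI:
  fixes f :: "'a::t2_space \<Rightarrow> real"
  assumes "compact K" "\<And>x. x \<notin> K \<Longrightarrow> f x = 0"
  shows "compact (supp f)"
proof -
  have "supp f \<subseteq> K" using assms by (intro supp_subsetI compact_imp_closed) auto
  moreover have "closed (supp f)" by (simp add: supp_def)
  ultimately show ?thesis using assms(1) closed_Int_compact[of "supp f" K] by (simp add: Int_absorb2)
qed

lemma lin_comb_2: "lin_comb 2 v c = (\<lambda>x. c 0 * v 0 x + c 1 * v 1 x)"
  by (rule ext) (simp add: lin_comb_def numeral_2_eq_2)

context riemannian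
begin

lemma borel_measurable_vol_iff: "f \<in> borel_measurable (vol A) \<longleftrightarrow> f \<in> borel_measurable borel"
  using measurable_cong_sets[OF sets_vol refl, of borel] by blast

lemma integrable_bounded_compact:
  fixes f g :: "'a \<Rightarrow> real"
  assumes "f \<in> borel_measurable borel" "compact K" "\<And>x. x \<notin> K \<Longrightarrow> f x = 0" "\<And>x. \<bar>f x\<bar> \<le> C"
  shows "integrable (vol A) f"
  by (rule integrableI_bounded_set[where A = K and B = C])
    (use assms vol_compact_finite[OF assms(2)] compact_imp_closed[OF assms(2)] borel_measurable_vol_iff in auto)

lemma continuous_compact_bounded:
  fixes f :: "'a \<Rightarrow> real"
  assumes "continuous_on UNIV f" "compact K" "\<And>x. x \<notin> K \<Longrightarrow> f x = 0"
  shows "\<exists>C\<ge>0. \<forall>x. \<bar>f x\<bar> \<le> C"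
proof -
  have "compact (f ` K)" by (intro compact_continuous_image continuous_on_subset[OF assms(1)] assms(2)) auto
  then obtain C where "\<forall>x\<in>K. norm (f x) \<le> C" using compact_imp_bounded bounded_iff by (metis imageI)
  then have "\<bar>f x\<bar> \<le> max C 0" for x using assms(3)[of x] by (cases "x \<in> K") (auto simp: max_def)
  then show ?thesis by (intro exI[of _ "max C 0"]) auto
qed

lemma integrable_continuous_compact:
  fixes f :: "'a \<Rightarrow> real"
  assumes "continuous_on UNIV f" "compact K" "\<And>x. x \<notin> K \<Longrightarrow> f x = 0"
  shows "integrable (vol A) f"
proof -
  obtain C where "\<And>x. \<bar>f x\<bar> \<le> C" using continuous_compact_bounded[OF assms(1,2)] assms(3) by blast
  then show ?thesis
    using integrable_bounded_compact[OF borel_measurable_continuous_onI[OF assms(1)] assms(2)] assms(3) by blast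
qed

text \<open>
  Open sets have positive volume, so a continuous function cannot hide its non-zero values in a
  null set.
\<close>

lemma AE_zero_continuous:
  fixes f :: "'a \<Rightarrow> real"
  assumes "continuous_on UNIV f" "AE x in vol A. f x = 0"
  shows "f x = 0"
proof (rule ccontr)
  assume x: "f x \<noteq> 0"
  have U: "open {x. f x \<noteq> 0}"
  proof -
    have "open (f -` (- {0}))" by (rule open_vimage[OF _ assms(1)]) (simp add: open_Compl)
    then show ?thesis by (simp add: vimage_def)
  qed
  then have "emeasure (vol A) {x. f x \<noteq> 0} > 0" by (rule vol_open_pos) (use x in auto)
  moreover have "emeasure (vol A) {x. f x \<noteq> 0} = 0"
    using assms(2) U by (subst (asm) AE_iff_measurable[of "{x. f x \<noteq> 0}"]) auto
  ultimately show False by simp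
qed

lemma Cc_smooth_lin:
  assumes "f \<in> Cc_smooth A" "g \<in> Cc_smooth A"
  shows "(\<lambda>x. a * f x + b * g x) \<in> Cc_smooth A"
proof -
  have "compact (supp (\<lambda>x. a * f x + b * g x))"
    by (rule compact_suppI[of "supp f \<union> supp g"]) (use assms in \<open>auto simp: Cc_smooth_iff notin_supp[of _ f] notin_supp[of _ g]\<close>)
  then show ?thesis using assms by (simp add: Cc_smooth_iff smooth_fun_lin)
qed

lemma Cc_smooth_pos_cut:
  assumes "f \<in> Cc_smooth A" "\<epsilon> > 0"
  shows "(\<lambda>x. pos_cut \<epsilon> (f x)) \<in> Cc_smooth A"
proof -
  have "smooth_fun A (\<lambda>x. pos_cut \<epsilon> (f x))"
    using assms smooth_on_pos_cut[OF assms(2) open_image, of _ "f \<circ> chart_inv _"]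
    unfolding Cc_smooth_iff smooth_fun_def by (simp add: o_def)
  moreover have "compact (supp (\<lambda>x. pos_cut \<epsilon> (f x)))"
    by (rule compact_suppI[of "supp f"]) (use assms(1) in \<open>auto simp: Cc_smooth_iff notin_supp[of _ f] pos_cut_zero\<close>)
  ultimately show ?thesis by (simp add: Cc_smooth_iff)
qed

end

text \<open>
  Both parts of the main theorem are instances of one statement about a quadratic form
  \<open>a \<bar>\<nabla>v\<bar>\<^sup>2 + s v\<^sup>2\<close> with a continuous non-negative potential \<open>s\<close>. The number \<open>k\<close> only enters through the
  exponents: on the product it is the dimension, on Euclidean space it is larger than the
  dimension.
\<close>

locale yamabe_data = riemannian A for A :: "('a::{t2_space,second_countable_topology}, 'm::finite) riem" +
  fixes s :: "'a \<Rightarrow> real" and a :: real and k :: nat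
  assumes s_cont: "continuous_on UNIV s" and s_nonneg: "\<And>x. s x \<ge> 0" and a_nonneg: "a \<ge> 0" and k_ge: "k \<ge> 3"
begin

definition p :: real where "p = yam_p k"

lemma p_facts: "p > 2" "2 / p = 1 - 2 / real k" "(p - 2) * (real k / 2) = p" "1 / (real k / 2) + 1 / (p / 2) = 1"
proof -
  have k: "real k - 2 > 0" "real k \<noteq> 0" using k_ge by auto
  show "p > 2" using k by (simp add: p_def yam_p_def less_divide_eq)
  show "2 / p = 1 - 2 / real k" using k by (simp add: p_def yam_p_def divide_simps)
  show "(p - 2) * (real k / 2) = p" using k by (simp add: p_def yam_p_def divide_simps)
  show "1 / (real k / 2) + 1 / (p / 2) = 1" using k by (simp add: p_def yam_p_def divide_simps)
qed

definition dens :: "('a \<Rightarrow> real) \<Rightarrow> 'a \<Rightarrow> real" where "dens v x = a * grad_sq A v x + s x * (v x)\<^sup>2"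
definition energy :: "('a \<Rightarrow> real) \<Rightarrow> real" where "energy v = (\<integral>x. dens v x \<partial>vol A)"
definition weighted :: "('a \<Rightarrow> real) \<Rightarrow> ('a \<Rightarrow> real) \<Rightarrow> real" where
  "weighted u v = (\<integral>x. u x powr (p - 2) * (v x)\<^sup>2 \<partial>vol A)"
definition mass :: "('a \<Rightarrow> real) \<Rightarrow> real" where "mass v = (\<integral>x. \<bar>v x\<bar> powr p \<partial>vol A)"

definition yamabe_inf :: ereal where
  "yamabe_inf = (INF v \<in> Cc_smooth A - {\<lambda>_. 0}. ereal (energy v / mass v powr (2 / p)))"

definition second_inf :: ereal where
  "second_inf = (INF u \<in> Lp_nonneg_c A p. INF V \<in> Gr A p 2 u. SUP v \<in> V - {\<lambda>_. 0}.
     ereal (energy v / weighted u v * (\<integral>x. u x powr p \<partial>vol A) powr (2 / real k)))"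

subsection \<open>The energy\<close>

lemma dens_nonneg: "dens v x \<ge> 0"
  unfolding dens_def using a_nonneg s_nonneg grad_sq_nonneg by (intro add_nonneg_nonneg mult_nonneg_nonneg) auto

lemma energy_nonneg: "energy v \<ge> 0"
  unfolding energy_def using dens_nonneg by (intro integral_nonneg_AE) auto

lemma Cc_continuous: "v \<in> Cc_smooth A \<Longrightarrow> continuous_on UNIV v"
  by (simp add: Cc_smooth_iff continuous_smooth_fun)

lemma Cc_smooth_fun: "v \<in> Cc_smooth A \<Longrightarrow> smooth_fun A v" and Cc_compact: "v \<in> Cc_smooth A \<Longrightarrow> compact (supp v)"
  by (simp_all add: Cc_smooth_iff)

lemma Cc_borel: "v \<in> Cc_smooth A \<Longrightarrow> v \<in> borel_measurable borel"
  by (intro borel_measurable_continuous_onI Cc_continuous)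

lemma continuous_dens: "v \<in> Cc_smooth A \<Longrightarrow> continuous_on UNIV (dens v)"
  unfolding dens_def[abs_def]
  by (intro continuous_intros continuous_grad_sq s_cont Cc_continuous Cc_smooth_fun)

lemma dens_outside: "x \<notin> supp v \<Longrightarrow> dens v x = 0"
  by (simp add: dens_def grad_sq_outside_supp notin_supp[of _ v])

lemma integrable_dens: "v \<in> Cc_smooth A \<Longrightarrow> integrable (vol A) (dens v)"
  by (rule integrable_continuous_compact[OF continuous_dens Cc_compact dens_outside])

lemma mass_integrable: "v \<in> Cc_smooth A \<Longrightarrow> integrable (vol A) (\<lambda>x. \<bar>v x\<bar> powr p)"
proof (rule integrable_continuous_compact[where K = "supp v"])
  assume v: "v \<in> Cc_smooth A"
  show "continuous_on UNIV (\<lambda>x. \<bar>v x\<bar> powr p)"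
    by (intro continuous_on_powr' continuous_on_rabs continuous_on_const Cc_continuous v) (use p_facts(1) in auto)
  show "compact (supp v)" by (rule Cc_compact[OF v])
qed (simp add: notin_supp[of _ v])

lemma mass_nonneg: "mass v \<ge> 0"
  unfolding mass_def by (intro integral_nonneg_AE) auto

lemma mass_pos:
  assumes "v \<in> Cc_smooth A" "v \<noteq> (\<lambda>_. 0)"
  shows "mass v > 0"
proof (rule ccontr)
  assume "\<not> mass v > 0"
  then have "mass v = 0" using mass_nonneg[of v] by simp
  then have "AE x in vol A. \<bar>v x\<bar> powr p = 0" unfolding mass_def
    by (subst (asm) integral_nonneg_eq_0_iff_AE) (use mass_integrable[OF assms(1)] in auto)
  then have "AE x in vol A. v x = 0" by eventually_elim simp
  then have "v x = 0" for x by (rule AE_zero_continuous[OF Cc_continuous[OF assms(1)]])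
  then show False using assms(2) by auto
qed

subsection \<open>The weight\<close>

text \<open>
  From \<open>u\<^sup>p\<^sup>-\<^sup>2 \<le> 1 + u\<^sup>p\<close>, since \<open>p > 2\<close>; the constant is integrable on compact sets.
\<close>

lemma weight_integrable:
  assumes u: "u \<in> Lp_nonneg_c A p" and h: "h \<in> borel_measurable borel" "compact K" "\<And>x. x \<notin> K \<Longrightarrow> h x = 0" "\<And>x. \<bar>h x\<bar> \<le> C"
  shows "integrable (vol A) (\<lambda>x. u x powr (p - 2) * h x)"
proof -
  have um: "u \<in> borel_measurable borel" and un: "\<And>x. u x \<ge> 0" and ui: "integrable (vol A) (\<lambda>x. u x powr p)"
    using u by (auto simp: Lp_nonneg_c_def)
  have le: "u x powr (p - 2) \<le> 1 + u x powr p" for x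
  proof (cases "u x \<le> 1")
    case True
    then have "u x powr (p - 2) \<le> 1" using un p_facts(1) powr_mono2[of "p - 2" "u x" 1] by simp
    then show ?thesis by (simp add: add_increasing2)
  next
    case False
    then have "u x powr (p - 2) \<le> u x powr p" by (intro powr_mono) auto
    then show ?thesis by simp
  qed
  have "integrable (vol A) (\<lambda>x. \<bar>C\<bar> * (indicator K x + u x powr p))"
    using ui vol_compact_finite[OF h(2)] compact_imp_closed[OF h(2)] by (auto intro!: integrable_mult_right integrable_add)
  then show ?thesis
  proof (rule Bochner_Integration.integrable_bound)
    show "(\<lambda>x. u x powr (p - 2) * h x) \<in> borel_measurable (vol A)"
      using um h(1) by (simp add: borel_measurable_vol_iff)
    show "AE x in vol A. norm (u x powr (p - 2) * h x) \<le> norm (\<bar>C\<bar> * (indicator K x + u x powr p))"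
    proof (rule AE_I2)
      fix x
      have "\<bar>u x powr (p - 2) * h x\<bar> \<le> \<bar>C\<bar> * (indicator K x + u x powr p)"
      proof (cases "x \<in> K")
        case True
        have "\<bar>u x powr (p - 2) * h x\<bar> = u x powr (p - 2) * \<bar>h x\<bar>" by (simp add: abs_mult)
        also have "\<dots> \<le> (1 + u x powr p) * \<bar>C\<bar>"
          by (intro mult_mono le) (use h(4)[of x] in auto)
        finally show ?thesis using True by (simp add: mult.commute)
      qed (use h(3) in auto)
      then show "norm (u x powr (p - 2) * h x) \<le> norm (\<bar>C\<bar> * (indicator K x + u x powr p))" by simp
    qed
  qed
qed

lemma weight_integrable_continuous:
  assumes "u \<in> Lp_nonneg_c A p" "continuous_on UNIV h" "compact K" "\<And>x. x \<notin> K \<Longrightarrow> h x = 0"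
  shows "integrable (vol A) (\<lambda>x. u x powr (p - 2) * h x)"
proof -
  obtain C where "\<And>x. \<bar>h x\<bar> \<le> C" using continuous_compact_bounded[OF assms(2,3)] assms(4) by blast
  then show ?thesis
    using weight_integrable[OF assms(1) borel_measurable_continuous_onI[OF assms(2)] assms(3)] assms(4) by blast
qed

lemma weighted_integrable:
  "u \<in> Lp_nonneg_c A p \<Longrightarrow> v \<in> Cc_smooth A \<Longrightarrow> integrable (vol A) (\<lambda>x. u x powr (p - 2) * (v x)\<^sup>2)"
proof (rule weight_integrable_continuous[where K = "supp v"])
  assume v: "v \<in> Cc_smooth A"
  show "continuous_on UNIV (\<lambda>x. (v x)\<^sup>2)" by (intro continuous_on_power Cc_continuous v)
  show "compact (supp v)" by (rule Cc_compact[OF v])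
qed (simp_all add: notin_supp[of _ v])

lemma weighted_nonneg: "weighted u v \<ge> 0"
  unfolding weighted_def by (intro integral_nonneg_AE) auto

text \<open>
  Hoelder's inequality, keeping track of the part of the weight that meets the function: this is
  where the disjointness of the two nodal domains will pay off.
\<close>

lemma weighted_le:
  assumes u: "u \<in> Lp_nonneg_c A p" and w: "w \<in> Cc_smooth A" and D: "D \<in> sets borel" "\<And>x. x \<notin> D \<Longrightarrow> w x = 0"
  shows "weighted u w \<le> (\<integral>x. indicator D x * u x powr p \<partial>vol A) powr (2 / real k) * mass w powr (2 / p)"
proof -
  have um: "u \<in> borel_measurable borel" and un: "\<And>x. u x \<ge> 0" and ui: "integrable (vol A) (\<lambda>x. u x powr p)"
    using u by (auto simp: Lp_nonneg_c_def)
  define f where "f x = indicator D x * u x powr (p - 2)" for x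
  have fr: "f x powr (real k / 2) = indicator D x * u x powr p" for x
    using p_facts(3) by (auto simp: f_def indicator_def powr_powr)
  have gq: "((w x)\<^sup>2) powr (p / 2) = \<bar>w x\<bar> powr p" for x
  proof -
    have "((w x)\<^sup>2) powr (p / 2) = (\<bar>w x\<bar> powr 2) powr (p / 2)" by (cases "w x = 0") (auto simp: powr_numeral)
    then show ?thesis by (simp only: powr_powr) simp
  qed
  have "(\<integral>x. f x * (w x)\<^sup>2 \<partial>vol A) \<le>
    (\<integral>x. f x powr (real k / 2) \<partial>vol A) powr (1 / (real k / 2)) * (\<integral>x. ((w x)\<^sup>2) powr (p / 2) \<partial>vol A) powr (1 / (p / 2))"
  proof (rule Holder_inequality)
    show "integrable (vol A) (\<lambda>x. f x powr (real k / 2))"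
      unfolding fr using integrable_mult_indicator[OF _ ui, of D] D(1) by simp
    show "integrable (vol A) (\<lambda>x. ((w x)\<^sup>2) powr (p / 2))"
      unfolding gq by (rule mass_integrable[OF w])
    show "f \<in> borel_measurable (vol A)" "(\<lambda>x. (w x)\<^sup>2) \<in> borel_measurable (vol A)"
      using um D(1) Cc_borel[OF w] unfolding borel_measurable_vol_iff f_def[abs_def] by measurable
  qed (use k_ge p_facts in \<open>auto simp: f_def\<close>)
  moreover have "(\<integral>x. f x * (w x)\<^sup>2 \<partial>vol A) = weighted u w"
    unfolding weighted_def by (intro Bochner_Integration.integral_cong) (use D(2) in \<open>auto simp: f_def indicator_def\<close>)
  ultimately show ?thesis by (simp add: fr gq mass_def)
qed

subsection \<open>The lower bound\<close>

text \<open>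
  The parallelogram law, dropping one non-negative term.
\<close>

lemma grad_sq_lin_le:
  assumes "smooth_fun A f" "smooth_fun A g"
  shows "grad_sq A (\<lambda>x. b * f x + c * g x) x \<le> 2 * (b\<^sup>2 * grad_sq A f x + c\<^sup>2 * grad_sq A g x)"
  using grad_sq_nonneg[of "\<lambda>x. b * f x + (- c) * g x" x]
  unfolding grad_sq_lin[OF assms, of b c] grad_sq_lin[OF assms, of b "- c"] by (simp add: algebra_simps)

lemma dens_lin_le:
  assumes "v0 \<in> Cc_smooth A" "v1 \<in> Cc_smooth A" "b\<^sup>2 \<le> 1" "c\<^sup>2 \<le> 1"
  shows "dens (\<lambda>x. b * v0 x + c * v1 x) x \<le> 2 * (dens v0 x + dens v1 x)"
proof -
  have "grad_sq A (\<lambda>x. b * v0 x + c * v1 x) x \<le> 2 * (b\<^sup>2 * grad_sq A v0 x + c\<^sup>2 * grad_sq A v1 x)"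
    by (rule grad_sq_lin_le[OF assms(1,2)[THEN Cc_smooth_fun]])
  also have "\<dots> \<le> 2 * (1 * grad_sq A v0 x + 1 * grad_sq A v1 x)"
    by (intro mult_left_mono add_mono mult_right_mono assms grad_sq_nonneg) auto
  finally have 1: "a * grad_sq A (\<lambda>x. b * v0 x + c * v1 x) x \<le> a * (2 * (grad_sq A v0 x + grad_sq A v1 x))"
    by (intro mult_left_mono a_nonneg) simp
  have "(b * v0 x + c * v1 x)\<^sup>2 \<le> 2 * (b\<^sup>2 * (v0 x)\<^sup>2 + c\<^sup>2 * (v1 x)\<^sup>2)"
    using sum_squares_bound[of "b * v0 x" "c * v1 x"] by (simp add: power2_sum power_mult_distrib)
  also have "\<dots> \<le> 2 * (1 * (v0 x)\<^sup>2 + 1 * (v1 x)\<^sup>2)"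
    by (intro mult_left_mono add_mono mult_right_mono assms) auto
  finally have 2: "s x * (b * v0 x + c * v1 x)\<^sup>2 \<le> s x * (2 * ((v0 x)\<^sup>2 + (v1 x)\<^sup>2))"
    by (intro mult_left_mono s_nonneg) simp
  show ?thesis using add_mono[OF 1 2] by (simp add: dens_def algebra_simps)
qed

lemma dens_pos_cut:
  assumes "v \<in> Cc_smooth A" "\<epsilon> > 0"
  shows "dens (\<lambda>x. pos_cut \<epsilon> (v x)) x = a * ((pos_cut' \<epsilon> (v x))\<^sup>2 * grad_sq A v x) + s x * (pos_cut \<epsilon> (v x))\<^sup>2"
  unfolding dens_def grad_sq_compose[OF Cc_smooth_fun[OF assms(1)] pos_cut_deriv[OF assms(2)]] ..

lemma pos_cut_sq_le: "\<epsilon> > 0 \<Longrightarrow> (pos_cut \<epsilon> t)\<^sup>2 \<le> t\<^sup>2"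
  by (cases "t \<ge> 0") (auto intro!: power_mono pos_cut_le pos_cut_nonneg simp: pos_cut_zero)

lemma pos_cut'_sq_le: "\<epsilon> > 0 \<Longrightarrow> (pos_cut' \<epsilon> t)\<^sup>2 \<le> 1"
  using power_mono[OF pos_cut'_le_1 pos_cut'_nonneg, of \<epsilon> t 2] by simp

lemma dens_pos_cut_le:
  assumes "v \<in> Cc_smooth A" "\<epsilon> > 0"
  shows "dens (\<lambda>x. pos_cut \<epsilon> (v x)) x \<le> dens v x"
proof -
  have "(pos_cut' \<epsilon> (v x))\<^sup>2 * grad_sq A v x \<le> 1 * grad_sq A v x"
    by (intro mult_right_mono pos_cut'_sq_le assms grad_sq_nonneg)
  then show ?thesis
    unfolding dens_pos_cut[OF assms] dens_def
    by (intro add_mono mult_left_mono a_nonneg s_nonneg pos_cut_sq_le assms(2)) simp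
qed

lemma dens_uminus: "v \<in> Cc_smooth A \<Longrightarrow> dens (\<lambda>x. - v x) x = dens v x"
  unfolding dens_def
  by (subst grad_sq_compose[where \<phi> = uminus and d = "-1"]) (auto intro!: derivative_eq_intros Cc_smooth_fun)

text \<open>The two truncations live on disjoint sets, so the energy does not increase.\<close>

lemma dens_split:
  assumes v: "v \<in> Cc_smooth A" and e: "\<epsilon> > 0"
  shows "dens (\<lambda>x. pos_cut \<epsilon> (v x)) x + dens (\<lambda>x. pos_cut \<epsilon> (- v x)) x \<le> dens v x"
proof -
  have mv: "(\<lambda>x. - v x) \<in> Cc_smooth A" using Cc_smooth_lin[OF v v, of "-1" 0] by simp
  consider "v x \<le> 0" | "v x \<ge> 0" by linarith
  then show ?thesis
  proof cases
    case 1
    then have "dens (\<lambda>x. pos_cut \<epsilon> (v x)) x = 0" by (simp add: dens_pos_cut[OF v e] pos_cut_zero pos_cut'_zero)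
    then show ?thesis using dens_pos_cut_le[OF mv e, of x] dens_uminus[OF v, of x] by simp
  next
    case 2
    then have "dens (\<lambda>x. pos_cut \<epsilon> (- v x)) x = 0" by (simp add: dens_pos_cut[OF mv e] pos_cut_zero pos_cut'_zero)
    then show ?thesis using dens_pos_cut_le[OF v e, of x] by simp
  qed
qed

text \<open>
  The two truncations together lose little of the function, which compensates for replacing the
  positive part by its smooth approximation.
\<close>

lemma pos_cut_split: "\<epsilon> > 0 \<Longrightarrow> t\<^sup>2 - 2 * \<epsilon> * \<bar>t\<bar> \<le> (pos_cut \<epsilon> t)\<^sup>2 + (pos_cut \<epsilon> (- t))\<^sup>2"
proof -
  assume e: "\<epsilon> > 0"
  have *: "t\<^sup>2 - 2 * \<epsilon> * t \<le> (pos_cut \<epsilon> t)\<^sup>2" if t: "t \<ge> 0" for t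
  proof -
    have "t\<^sup>2 - (pos_cut \<epsilon> t)\<^sup>2 = (t - pos_cut \<epsilon> t) * (t + pos_cut \<epsilon> t)" by (simp add: power2_eq_square algebra_simps)
    also have "\<dots> \<le> \<epsilon> * (t + t)"
      using pos_cut_ge[OF e t] pos_cut_le[OF e t] pos_cut_nonneg[of \<epsilon> t] e by (intro mult_mono) auto
    finally show ?thesis by (simp add: algebra_simps)
  qed
  show ?thesis
    using *[of t] *[of "- t"] by (cases "t \<ge> 0") (auto simp: add_increasing add_increasing2)
qed

text \<open>
  The heart of the lower bound. Among the functions \<open>cos t v\<^sub>0 + sin t v\<^sub>1\<close> there is one whose
  truncated positive and negative part both have Rayleigh quotient below \<open>\<kappa>\<close>: the defect of the
  truncated positive part is a continuous function of \<open>t\<close>, its values at antipodal points have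
  negative sum, and by the intermediate value theorem they are equal somewhere.
\<close>

lemma nodal_splitting:
  assumes u: "u \<in> Lp_nonneg_c A p" and v: "v0 \<in> Cc_smooth A" "v1 \<in> Cc_smooth A"
    and q: "\<And>t. weighted u (\<lambda>x. cos t * v0 x + sin t * v1 x) > 0"
    and L: "\<And>t. energy (\<lambda>x. cos t * v0 x + sin t * v1 x) \<le> L * weighted u (\<lambda>x. cos t * v0 x + sin t * v1 x)"
    and \<kappa>: "\<kappa> > L" "L \<ge> 0"
  shows "\<exists>v \<epsilon>. v \<in> Cc_smooth A \<and> \<epsilon> > 0 \<and>
    energy (\<lambda>x. pos_cut \<epsilon> (v x)) < \<kappa> * weighted u (\<lambda>x. pos_cut \<epsilon> (v x)) \<and>
    energy (\<lambda>x. pos_cut \<epsilon> (- v x)) < \<kappa> * weighted u (\<lambda>x. pos_cut \<epsilon> (- v x))"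
proof -
  define V where "V t x = cos t * v0 x + sin t * v1 x" for t x
  have VC: "V t \<in> Cc_smooth A" for t unfolding V_def[abs_def] by (rule Cc_smooth_lin[OF v])
  have Vpi: "V (t + pi) x = - V t x" for t x by (simp add: V_def)
  have V2pi: "V (t + 2 * pi) = V t" for t by (rule ext) (simp add: V_def)
  have Vcont: "continuous_on UNIV (\<lambda>t. V t x)" for x unfolding V_def by (intro continuous_intros)
  have um: "u \<in> borel_measurable borel" using u by (simp add: Lp_nonneg_c_def)
  have Vle: "\<bar>V t x\<bar> \<le> \<bar>v0 x\<bar> + \<bar>v1 x\<bar>" for t x
  proof -
    have "\<bar>V t x\<bar> \<le> \<bar>cos t * v0 x\<bar> + \<bar>sin t * v1 x\<bar>" unfolding V_def by (rule abs_triangle_ineq)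
    also have "\<dots> \<le> 1 * \<bar>v0 x\<bar> + 1 * \<bar>v1 x\<bar>" unfolding abs_mult by (intro add_mono mult_right_mono) auto
    finally show ?thesis by simp
  qed
  have Z: "v0 x = 0" "v1 x = 0" if "x \<notin> supp v0 \<union> supp v1" for x using that notin_supp[of x v0] notin_supp[of x v1] by auto
  have K: "compact (supp v0 \<union> supp v1)" using v Cc_compact by auto
  define W1 where "W1 x = u x powr (p - 2) * (\<bar>v0 x\<bar> + \<bar>v1 x\<bar>)" for x
  define W2 where "W2 x = u x powr (p - 2) * (\<bar>v0 x\<bar> + \<bar>v1 x\<bar>)\<^sup>2" for x
  have W1: "integrable (vol A) W1" unfolding W1_def[abs_def]
    by (rule weight_integrable_continuous[OF u _ K]) (use Z in \<open>auto intro!: continuous_intros Cc_continuous[OF v(1)] Cc_continuous[OF v(2)]\<close>)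
  have W2: "integrable (vol A) W2" unfolding W2_def[abs_def]
    by (rule weight_integrable_continuous[OF u _ K]) (use Z in \<open>auto intro!: continuous_intros Cc_continuous[OF v(1)] Cc_continuous[OF v(2)]\<close>)
  have wVle: "u x powr (p - 2) * (V t x)\<^sup>2 \<le> W2 x" for t x
    unfolding W2_def using power_mono[OF Vle[of t x], of 2] by (intro mult_left_mono) auto
  have qcont: "continuous_on UNIV (\<lambda>t. weighted u (V t))"
    unfolding weighted_def
  proof (rule continuous_parametric_integral[OF _ _ W2])
    show "(\<lambda>x. u x powr (p - 2) * (V t x)\<^sup>2) \<in> borel_measurable (vol A)" for t
      using weighted_integrable[OF u VC] by auto
    show "continuous_on UNIV (\<lambda>t. u x powr (p - 2) * (V t x)\<^sup>2)" for x by (intro continuous_intros Vcont)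
    show "\<bar>u x powr (p - 2) * (V t x)\<^sup>2\<bar> \<le> W2 x" for t x using wVle by simp
  qed
  obtain t0 where t0: "\<And>t. t \<in> {0..2 * pi} \<Longrightarrow> weighted u (V t0) \<le> weighted u (V t)"
    using continuous_attains_inf[of "{0..2 * pi}" "\<lambda>t. weighted u (V t)"] continuous_on_subset[OF qcont]
    by (metis atLeastAtMost_iff compact_Icc empty_iff order_refl pi_ge_zero subset_UNIV zero_le_mult_iff zero_le_numeral)
  define q0 where "q0 = weighted u (V t0)"
  have q0: "q0 > 0" using q[of t0] by (simp add: q0_def V_def[abs_def])
  define M where "M = (\<integral>x. W1 x \<partial>vol A)"
  have M: "M \<ge> 0" unfolding M_def W1_def by (intro integral_nonneg_AE) auto
  \<comment> \<open>The truncation costs at most \<open>2 \<epsilon> \<kappa> M\<close>, to be paid by the gap \<open>(\<kappa> - L) q0\<close>.\<close>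
  define \<epsilon> where "\<epsilon> = (\<kappa> - L) * q0 / (4 * \<kappa> * (M + 1))"
  have e: "\<epsilon> > 0" using \<kappa> q0 M by (simp add: \<epsilon>_def)
  have k0: "\<kappa> > 0" using \<kappa> by simp
  have eM: "2 * \<epsilon> * \<kappa> * M < (\<kappa> - L) * q0"
  proof -
    have "2 * \<epsilon> * \<kappa> * M = (\<kappa> - L) * q0 * (M / (2 * (M + 1)))"
      using k0 M by (simp add: \<epsilon>_def divide_simps)
    also have "\<dots> < (\<kappa> - L) * q0 * 1"
      using \<kappa> q0 M by (intro mult_strict_left_mono) (auto simp: divide_less_eq)
    finally show ?thesis by simp
  qed
  have PC: "(\<lambda>x. pos_cut \<epsilon> (V t x)) \<in> Cc_smooth A" for t by (rule Cc_smooth_pos_cut[OF VC e])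
  define f where "f t = energy (\<lambda>x. pos_cut \<epsilon> (V t x)) - \<kappa> * weighted u (\<lambda>x. pos_cut \<epsilon> (V t x))" for t
  define F where "F t x = dens (\<lambda>x. pos_cut \<epsilon> (V t x)) x - \<kappa> * (u x powr (p - 2) * (pos_cut \<epsilon> (V t x))\<^sup>2)" for t x
  have fF: "f t = (\<integral>x. F t x \<partial>vol A)" for t
    unfolding f_def F_def energy_def weighted_def
    using integrable_dens[OF PC] weighted_integrable[OF u PC] by simp
  have fcont: "continuous_on UNIV f"
    unfolding fF[abs_def]
  proof (rule continuous_parametric_integral)
    show "F t \<in> borel_measurable (vol A)" for t
      unfolding F_def[abs_def] using integrable_dens[OF PC] weighted_integrable[OF u PC] by auto
    show "continuous_on UNIV (\<lambda>t. F t x)" for x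
    proof -
      have "continuous_on UNIV (\<lambda>t. grad_sq A (V t) x)"
        unfolding V_def[abs_def] grad_sq_lin[OF v[THEN Cc_smooth_fun]] by (intro continuous_intros)
      then show ?thesis
        unfolding F_def dens_pos_cut[OF VC e]
        by (intro continuous_intros continuous_on_compose2[OF continuous_on_pos_cut[OF e] Vcont]
            continuous_on_compose2[OF continuous_on_pos_cut'[OF e] Vcont]) auto
    qed
    show "integrable (vol A) (\<lambda>x. 2 * (dens v0 x + dens v1 x) + \<kappa> * W2 x)"
      using integrable_dens[OF v(1)] integrable_dens[OF v(2)] W2 by simp
    show "\<bar>F t x\<bar> \<le> 2 * (dens v0 x + dens v1 x) + \<kappa> * W2 x" for t x
    proof -
      have 1: "dens (\<lambda>x. pos_cut \<epsilon> (V t x)) x \<le> 2 * (dens v0 x + dens v1 x)"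
        using dens_pos_cut_le[OF VC[of t] e, of x] dens_lin_le[OF v, of "cos t" "sin t" x]
        by (simp add: V_def[abs_def] abs_square_le_1)
      have "u x powr (p - 2) * (pos_cut \<epsilon> (V t x))\<^sup>2 \<le> u x powr (p - 2) * (V t x)\<^sup>2"
        by (intro mult_left_mono pos_cut_sq_le e) auto
      also have "\<dots> \<le> W2 x" by (rule wVle)
      finally have 2: "\<kappa> * (u x powr (p - 2) * (pos_cut \<epsilon> (V t x))\<^sup>2) \<le> \<kappa> * W2 x"
        using \<kappa> by (intro mult_left_mono) auto
      have 3: "\<kappa> * (u x powr (p - 2) * (pos_cut \<epsilon> (V t x))\<^sup>2) \<ge> 0" using \<kappa> by (intro mult_nonneg_nonneg) auto
      show ?thesis unfolding F_def using 1 2 3 dens_nonneg[of "\<lambda>x. pos_cut \<epsilon> (V t x)" x] by linarith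
    qed
  qed
  have neg: "f t + f (t + pi) < 0" if t: "t \<in> {0..2 * pi}" for t
  proof -
    have mV: "(\<lambda>x. - V t x) \<in> Cc_smooth A" using VC[of "t + pi"] by (simp add: Vpi[abs_def])
    have "F t x + F (t + pi) x \<le> dens (V t) x - \<kappa> * (u x powr (p - 2) * (V t x)\<^sup>2) + 2 * \<epsilon> * \<kappa> * W1 x" for x
    proof -
      have "u x powr (p - 2) * ((V t x)\<^sup>2 - 2 * \<epsilon> * (\<bar>v0 x\<bar> + \<bar>v1 x\<bar>)) \<le>
          u x powr (p - 2) * ((pos_cut \<epsilon> (V t x))\<^sup>2 + (pos_cut \<epsilon> (- V t x))\<^sup>2)"
      proof (rule mult_left_mono)
        have "2 * \<epsilon> * \<bar>V t x\<bar> \<le> 2 * \<epsilon> * (\<bar>v0 x\<bar> + \<bar>v1 x\<bar>)" using e by (intro mult_left_mono Vle) auto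
        then show "(V t x)\<^sup>2 - 2 * \<epsilon> * (\<bar>v0 x\<bar> + \<bar>v1 x\<bar>) \<le> (pos_cut \<epsilon> (V t x))\<^sup>2 + (pos_cut \<epsilon> (- V t x))\<^sup>2"
          using pos_cut_split[OF e, of "V t x"] by linarith
      qed auto
      then have "\<kappa> * (u x powr (p - 2) * ((V t x)\<^sup>2 - 2 * \<epsilon> * (\<bar>v0 x\<bar> + \<bar>v1 x\<bar>))) \<le>
          \<kappa> * (u x powr (p - 2) * ((pos_cut \<epsilon> (V t x))\<^sup>2 + (pos_cut \<epsilon> (- V t x))\<^sup>2))"
        by (rule mult_left_mono) (use k0 in simp)
      then show ?thesis
        using dens_split[OF VC e, of t x] unfolding F_def Vpi W1_def by (simp add: algebra_simps)
    qed
    then have "(\<integral>x. F t x + F (t + pi) x \<partial>vol A) \<le>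
        (\<integral>x. dens (V t) x - \<kappa> * (u x powr (p - 2) * (V t x)\<^sup>2) + 2 * \<epsilon> * \<kappa> * W1 x \<partial>vol A)"
      using integrable_dens[OF PC] weighted_integrable[OF u PC] integrable_dens[OF VC] weighted_integrable[OF u VC] W1
      by (intro integral_mono) (auto simp: F_def[abs_def])
    also have "\<dots> = energy (V t) - \<kappa> * weighted u (V t) + 2 * \<epsilon> * \<kappa> * M"
      using integrable_dens[OF VC] weighted_integrable[OF u VC] W1 by (simp add: energy_def weighted_def M_def)
    also have "\<dots> \<le> - (\<kappa> - L) * weighted u (V t) + 2 * \<epsilon> * \<kappa> * M"
      using L[of t] by (simp add: V_def[abs_def] algebra_simps)
    also have "\<dots> \<le> - (\<kappa> - L) * q0 + 2 * \<epsilon> * \<kappa> * M"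
      using t0[OF t] \<kappa> by (simp add: q0_def mult_left_mono)
    also have "\<dots> < 0" using eM by (simp add: algebra_simps)
    finally show ?thesis
      unfolding fF using integrable_dens[OF PC] weighted_integrable[OF u PC] by (simp add: F_def[abs_def])
  qed
  have fper: "f (t + 2 * pi) = f t" for t by (simp add: f_def V2pi)
  obtain t where t: "t \<in> {0..2 * pi}" "f t = f (t + pi)"
  proof -
    obtain t where t: "f t = f (t + pi)" using antipodal_equal_value[OF fcont fper] by blast
    \<comment> \<open>The minimum \<open>q0\<close> was taken over one period only, so the parameter is moved there.\<close>
    define n where "n = \<lfloor>t / (2 * pi)\<rfloor>"
    define r where "r = t - 2 * pi * of_int n"
    have per: "f (x + 2 * pi * of_int n) = f x" for x
    proof -
      have "V (x + 2 * pi * of_int n) = V x"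
        by (rule ext) (simp add: V_def cos_add sin_add cos_int_2pin sin_int_2pin)
      then show ?thesis by (simp add: f_def)
    qed
    have "of_int n \<le> t / (2 * pi)" "t / (2 * pi) < of_int n + 1" by (auto simp: n_def)
    then have "r \<in> {0..2 * pi}" by (simp add: r_def field_simps)
    moreover have "f r = f (r + pi)"
      using t per[of r] per[of "r + pi"] by (simp add: r_def algebra_simps)
    ultimately show ?thesis by (rule that)
  qed
  then have "f t < 0" "f (t + pi) < 0" using neg[OF t(1)] by auto
  then show ?thesis using VC[of t] e by (intro exI[of _ "V t"] exI[of _ \<epsilon>]) (simp add: f_def Vpi)
qed

text \<open>
  This is what the independence of the functions \<open>u\<^sup>p\<^sup>-\<^sup>2 v\<^sub>i\<close> modulo null sets is for.
\<close>

lemma weighted_lin_pos: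
  assumes u: "u \<in> Lp_nonneg_c A p" and v: "v 0 \<in> Cc_smooth A" "v 1 \<in> Cc_smooth A"
    and indep: "\<forall>c. (AE x in vol A. lin_comb 2 (\<lambda>i x. u x powr (p - 2) * v i x) c x = 0) \<longrightarrow> (\<forall>i<2. c i = 0)"
    and c: "c0 \<noteq> 0 \<or> c1 \<noteq> 0"
  shows "weighted u (\<lambda>x. c0 * v 0 x + c1 * v 1 x) > 0"
proof (rule ccontr)
  let ?w = "\<lambda>x. c0 * v 0 x + c1 * v 1 x"
  assume "\<not> weighted u ?w > 0"
  then have "weighted u ?w = 0" using weighted_nonneg[of u ?w] by simp
  then have "AE x in vol A. u x powr (p - 2) * (?w x)\<^sup>2 = 0"
    unfolding weighted_def
    by (subst (asm) integral_nonneg_eq_0_iff_AE) (use weighted_integrable[OF u Cc_smooth_lin[OF v]] in auto)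
  then have "AE x in vol A. lin_comb 2 (\<lambda>i x. u x powr (p - 2) * v i x) (\<lambda>i. if i = 0 then c0 else c1) x = 0"
  proof eventually_elim
    case (elim x)
    then have "u x powr (p - 2) * ?w x = 0" by auto
    moreover have "lin_comb 2 (\<lambda>i x. u x powr (p - 2) * v i x) (\<lambda>i. if i = 0 then c0 else c1) x = u x powr (p - 2) * ?w x"
      by (simp add: lin_comb_2 distrib_left mult.left_commute)
    ultimately show ?case by (simp only:)
  qed
  then have *: "\<forall>i<2::nat. (if i = 0 then c0 else c1) = 0" by (rule indep[THEN spec, THEN mp])
  have "c0 = 0" "c1 = 0" using *[rule_format, of 0] *[rule_format, of 1] by simp_all
  then show False using c by simp
qed

text \<open>
  Let \<open>\<kappa>\<close> exceed the supremum, up to normalization, and split a function of the plane into two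
  pieces of quotient below \<open>\<kappa>\<close> that are nowhere both non-zero. At most half of \<open>\<integral> u\<^sup>p\<close> comes from
  the set where one of them, say \<open>z\<close>, is non-zero. By Hoelder's inequality the Yamabe quotient of \<open>z\<close>
  is at most \<open>\<kappa> (\<integral> u\<^sup>p / 2)\<^sup>2\<^sup>/\<^sup>k\<close>, which is the claimed factor \<open>2\<^sup>2\<^sup>/\<^sup>k\<close>.
\<close>

lemma second_lower_bound:
  assumes u: "u \<in> Lp_nonneg_c A p" and V: "V \<in> Gr A p 2 u"
  shows "ereal (2 powr (2 / real k)) * yamabe_inf \<le> (SUP v \<in> V - {\<lambda>_. 0}.
     ereal (energy v / weighted u v * (\<integral>x. u x powr p \<partial>vol A) powr (2 / real k)))" (is "?l \<le> ?S")
proof -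
  have um: "u \<in> borel_measurable borel" and un: "\<And>x. u x \<ge> 0" and ui: "integrable (vol A) (\<lambda>x. u x powr p)"
    and unz: "\<not> (AE x in vol A. u x = 0)"
    using u by (auto simp: Lp_nonneg_c_def)
  obtain v where v: "\<forall>i<2. v i \<in> Cc_smooth A" and Vr: "V = range (lin_comb 2 v)"
    and indep: "\<forall>c. (AE x in vol A. lin_comb 2 (\<lambda>i x. u x powr (p - 2) * v i x) c x = 0) \<longrightarrow> (\<forall>i<2. c i = 0)"
    using V unfolding Gr_def by blast
  have v01: "v 0 \<in> Cc_smooth A" "v 1 \<in> Cc_smooth A" using v by auto
  define U where "U = (\<integral>x. u x powr p \<partial>vol A)"
  have U: "U > 0"
  proof (rule ccontr)
    assume "\<not> U > 0"
    moreover have "U \<ge> 0" unfolding U_def by (intro integral_nonneg_AE) auto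
    ultimately have "U = 0" by simp
    then have "AE x in vol A. u x powr p = 0" unfolding U_def
      by (subst (asm) integral_nonneg_eq_0_iff_AE) (use ui in auto)
    then have "AE x in vol A. u x = 0" by eventually_elim simp
    then show False using unz by simp
  qed
  define N where "N = U powr (2 / real k)"
  have N: "N > 0" using U by (simp add: N_def)
  define W where "W t x = cos t * v 0 x + sin t * v 1 x" for t x
  have Wq: "weighted u (W t) > 0" for t
  proof -
    have "cos t \<noteq> 0 \<or> sin t \<noteq> 0" using sin_zero_abs_cos_one by fastforce
    then show ?thesis unfolding W_def[abs_def] by (rule weighted_lin_pos[OF u v01 indep])
  qed
  have WV: "W t \<in> V - {\<lambda>_. 0}" for t
  proof -
    have "W t = lin_comb 2 v (\<lambda>i. if i = 0 then cos t else sin t)"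
      by (rule ext) (simp add: lin_comb_2 W_def)
    moreover have "W t \<noteq> (\<lambda>_. 0)" using Wq[of t] by (auto simp: weighted_def)
    ultimately show ?thesis unfolding Vr by auto
  qed
  have up: "ereal (energy (W t) / weighted u (W t) * N) \<le> ?S" for t
    unfolding N_def U_def by (rule SUP_upper[OF WV])
  show ?thesis
  proof (cases "?S = \<infinity>")
    case True
    then show ?thesis by simp
  next
    case False
    have "0 \<le> ereal (energy (W 0) / weighted u (W 0) * N)"
      using energy_nonneg[of "W 0"] Wq[of 0] N by simp
    then have "0 \<le> ?S" using up[of 0] by (rule order_trans)
    then obtain l where l: "?S = ereal l" "l \<ge> 0" using False by (cases ?S) auto
    define L where "L = l / N"
    have L0: "L \<ge> 0" using l N by (simp add: L_def)
    have EL: "energy (W t) \<le> L * weighted u (W t)" for t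
      using up[of t] Wq[of t] N unfolding l(1) by (simp add: L_def field_simps)
    have main: "?l \<le> ereal (\<kappa> * N)" if \<kappa>: "\<kappa> > L" for \<kappa>
    proof -
      obtain w \<epsilon> where w: "w \<in> Cc_smooth A" and e: "\<epsilon> > 0"
        and E1: "energy (\<lambda>x. pos_cut \<epsilon> (w x)) < \<kappa> * weighted u (\<lambda>x. pos_cut \<epsilon> (w x))"
        and E2: "energy (\<lambda>x. pos_cut \<epsilon> (- w x)) < \<kappa> * weighted u (\<lambda>x. pos_cut \<epsilon> (- w x))"
        using nodal_splitting[OF u v01 Wq[unfolded W_def[abs_def]] EL[unfolded W_def[abs_def]] \<kappa> L0] by blast
      have mw: "(\<lambda>x. - w x) \<in> Cc_smooth A" using Cc_smooth_lin[OF w w, of "-1" 0] by simp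
      define D1 where "D1 = {x. w x > 0}"
      define D2 where "D2 = {x. w x < 0}"
      have Dm: "D1 \<in> sets borel" "D2 \<in> sets borel"
        using Cc_borel[OF w] unfolding D1_def D2_def by measurable
      define U1 where "U1 = (\<integral>x. indicator D1 x * u x powr p \<partial>vol A)"
      define U2 where "U2 = (\<integral>x. indicator D2 x * u x powr p \<partial>vol A)"
      have int: "integrable (vol A) (\<lambda>x. indicator D1 x * u x powr p)" "integrable (vol A) (\<lambda>x. indicator D2 x * u x powr p)"
        using integrable_mult_indicator[OF _ ui, of D1] integrable_mult_indicator[OF _ ui, of D2] Dm by simp_all
      have "U1 + U2 = (\<integral>x. indicator D1 x * u x powr p + indicator D2 x * u x powr p \<partial>vol A)"
        unfolding U1_def U2_def using int by simp
      also have "\<dots> \<le> U" unfolding U_def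
        by (intro integral_mono Bochner_Integration.integrable_add int ui) (auto simp: D1_def D2_def indicator_def)
      finally have half: "U1 \<le> U / 2 \<or> U2 \<le> U / 2" by linarith
      have concl: "?l \<le> ereal (\<kappa> * N)"
        if z: "z \<in> Cc_smooth A" and Ez: "energy z < \<kappa> * weighted u z"
          and D: "D \<in> sets borel" "\<And>x. x \<notin> D \<Longrightarrow> z x = 0"
          and h: "(\<integral>x. indicator D x * u x powr p \<partial>vol A) \<le> U / 2" for z D
      proof -
        have "weighted u z \<noteq> 0" using Ez energy_nonneg[of z] by auto
        then have zn: "z \<noteq> (\<lambda>_. 0)" by (auto simp: weighted_def)
        define B where "B = mass z powr (2 / p)"
        have B: "B > 0" using mass_pos[OF z zn] by (simp add: B_def)
        have h0: "(\<integral>x. indicator D x * u x powr p \<partial>vol A) \<ge> 0" by (intro integral_nonneg_AE) auto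
        have "weighted u z \<le> (\<integral>x. indicator D x * u x powr p \<partial>vol A) powr (2 / real k) * B"
          unfolding B_def by (rule weighted_le[OF u z D])
        also have "\<dots> \<le> (U / 2) powr (2 / real k) * B"
          using B h h0 by (intro mult_right_mono powr_mono2) auto
        finally have "\<kappa> * weighted u z \<le> \<kappa> * ((U / 2) powr (2 / real k) * B)"
          using \<kappa> L0 by (intro mult_left_mono) auto
        then have "energy z / B \<le> \<kappa> * (U / 2) powr (2 / real k)"
          using Ez B by (simp add: divide_le_eq mult.assoc)
        moreover have "yamabe_inf \<le> ereal (energy z / B)"
          unfolding yamabe_inf_def B_def using z zn by (intro INF_lower) auto
        ultimately have "yamabe_inf \<le> ereal (\<kappa> * (U / 2) powr (2 / real k))"
          by (meson ereal_less_eq(3) order_trans)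
        then have "?l \<le> ereal (2 powr (2 / real k)) * ereal (\<kappa> * (U / 2) powr (2 / real k))"
          by (intro ereal_mult_left_mono) auto
        also have "\<dots> = ereal (\<kappa> * N)"
          using U by (simp add: N_def powr_divide)
        finally show ?thesis .
      qed
      show ?thesis using half
      proof
        assume "U1 \<le> U / 2"
        then show ?thesis
          by (intro concl[OF Cc_smooth_pos_cut[OF w e] E1 Dm(1)]) (auto simp: D1_def U1_def pos_cut_zero)
      next
        assume "U2 \<le> U / 2"
        then show ?thesis
          by (intro concl[OF Cc_smooth_pos_cut[OF mw e] E2 Dm(2)]) (auto simp: D2_def U2_def pos_cut_zero)
      qed
    qed
    have "?l \<le> ereal l + ereal \<delta>" if "\<delta> > 0" for \<delta>
    proof -
      have "L + \<delta> / N > L" using that N by simp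
      from main[OF this] show ?thesis using N by (simp add: L_def algebra_simps)
    qed
    then have "?l \<le> ereal l" by (rule ereal_le_epsilon2)
    then show ?thesis using l(1) by simp
  qed
qed

end

context yamabe_data
begin

subsection \<open>The upper bound\<close>

text \<open>
  At each point one of the two functions vanishes in a neighbourhood, so there are no cross terms.
\<close>

lemma dens_disjoint:
  assumes v: "v \<in> Cc_smooth A" "v' \<in> Cc_smooth A" and disj: "supp v \<inter> supp v' = {}"
  shows "dens (\<lambda>x. b * v x + c * v' x) x = b\<^sup>2 * dens v x + c\<^sup>2 * dens v' x"
proof -
  have cross: "grad_inner v v' x = 0 \<and> v x * v' x = 0"
  proof -
    have *: "grad_sq A (\<lambda>x. 1 * f x + 1 * g x) x = grad_sq A f x"
      "grad_sq A (\<lambda>x. 1 * g x + 1 * f x) x = grad_sq A f x" if g: "x \<notin> supp g" for f g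
    proof -
      have o: "open (- supp g)" by (simp add: supp_def open_Compl)
      show "grad_sq A (\<lambda>x. 1 * f x + 1 * g x) x = grad_sq A f x"
        by (rule grad_sq_cong_open[OF o]) (use g in \<open>simp_all add: notin_supp[of _ g]\<close>)
      show "grad_sq A (\<lambda>x. 1 * g x + 1 * f x) x = grad_sq A f x"
        by (rule grad_sq_cong_open[OF o]) (use g in \<open>simp_all add: notin_supp[of _ g]\<close>)
    qed
    consider "x \<notin> supp v" | "x \<notin> supp v'" using disj by auto
    then show ?thesis
    proof cases
      case 1
      then show ?thesis
        unfolding grad_inner_def *(2)[OF 1] by (simp add: notin_supp[OF 1] grad_sq_outside_supp[OF 1])
    next
      case 2
      then show ?thesis
        unfolding grad_inner_def *(1)[OF 2] by (simp add: notin_supp[OF 2] grad_sq_outside_supp[OF 2])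
    qed
  qed
  have "(b * v x + c * v' x)\<^sup>2 = b\<^sup>2 * (v x)\<^sup>2 + c\<^sup>2 * (v' x)\<^sup>2 + 2 * b * c * (v x * v' x)"
    by (simp add: power2_eq_square algebra_simps)
  then show ?thesis
    unfolding dens_def grad_sq_lin[OF v[THEN Cc_smooth_fun]] using cross by (simp add: algebra_simps)
qed

text \<open>
  Take the weight \<open>u = \<bar>v\<bar> + \<bar>v'\<bar>\<close> and the plane spanned by \<open>v\<close> and \<open>v'\<close>. By disjointness the Rayleigh
  quotient is constant on this plane, equal to that of \<open>v\<close>, whereas \<open>\<integral> u\<^sup>p\<close> is twice the integral
  for \<open>v\<close>.
\<close>

lemma second_upper_bound:
  assumes v: "v \<in> Cc_smooth A" "v \<noteq> (\<lambda>_. 0)" and v': "v' \<in> Cc_smooth A"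
    and disj: "supp v \<inter> supp v' = {}" and eq: "energy v' = energy v" "mass v' = mass v"
  shows "second_inf \<le> ereal (2 powr (2 / real k) * (energy v / mass v powr (2 / p)))"
proof -
  have P: "mass v > 0" by (rule mass_pos[OF v])
  have v'n: "v' \<noteq> (\<lambda>_. 0)" using eq(2) P by (auto simp: mass_def)
  have zero: "v x = 0 \<or> v' x = 0" for x using disj notin_supp[of x v] notin_supp[of x v'] by auto
  define u where "u x = \<bar>v x\<bar> + \<bar>v' x\<bar>" for x
  have vc: "continuous_on UNIV v" "continuous_on UNIV v'" using Cc_continuous v v' by auto
  have ucont: "continuous_on UNIV u" unfolding u_def[abs_def]
    by (intro continuous_on_add continuous_on_rabs vc)
  have up: "u x powr p = \<bar>v x\<bar> powr p + \<bar>v' x\<bar> powr p" for x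
    using zero[of x] by (auto simp: u_def)
  have uint: "integrable (vol A) (\<lambda>x. u x powr p)"
    unfolding up using mass_integrable v(1) v' by simp
  have umass: "(\<integral>x. u x powr p \<partial>vol A) = 2 * mass v"
    unfolding up using mass_integrable[OF v(1)] mass_integrable[OF v'] eq(2) by (simp add: mass_def)
  obtain x0 where x0: "v x0 \<noteq> 0" using v(2) by auto
  obtain x1 where x1: "v' x1 \<noteq> 0" using v'n by auto
  have z0: "v' x0 = 0" "u x0 > 0" and z1: "v x1 = 0" "u x1 > 0"
    using zero[of x0] zero[of x1] x0 x1 by (auto simp: u_def)
  have uL: "u \<in> Lp_nonneg_c A p"
    unfolding Lp_nonneg_c_def
  proof (intro CollectI conjI allI notI)
    show "u \<in> borel_measurable borel" by (rule borel_measurable_continuous_onI[OF ucont])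
    show "compact (supp u)"
      by (rule compact_suppI[of "supp v \<union> supp v'"])
        (use v(1) v' Cc_compact notin_supp[of _ v] notin_supp[of _ v'] in \<open>auto simp: u_def\<close>)
    assume "AE x in vol A. u x = 0"
    then have "u x0 = 0" by (rule AE_zero_continuous[OF ucont])
    then show False using z0 by simp
  qed (simp_all add: u_def uint[unfolded u_def])
  define w where "w i = (if i = 0 then v else v')" for i :: nat
  have w01: "w 0 = v" "w 1 = v'" "w (Suc 0) = v'" by (simp_all add: w_def)
  define V where "V = range (lin_comb 2 w)"
  have VG: "V \<in> Gr A p 2 u"
    unfolding Gr_def
  proof (intro CollectI exI conjI allI impI)
    show "V = range (lin_comb 2 w)" by (rule V_def)
    show "w i \<in> Cc_smooth A" if "i < 2" for i using v v' by (simp add: w_def)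
    show "c i = 0" if "\<forall>x. lin_comb 2 w c x = 0" "i < 2" for c i
    proof -
      have "lin_comb 2 w c x0 = 0" "lin_comb 2 w c x1 = 0" using that(1) by auto
      then have "c 0 = 0" "c 1 = 0" using x0 x1 z0 z1 by (simp_all add: lin_comb_2 w01)
      then show "c i = 0" using that(2) by (auto simp: less_2_cases_iff)
    qed
    show "c i = 0" if ae: "AE x in vol A. lin_comb 2 (\<lambda>i x. u x powr (p - 2) * w i x) c x = 0" and i: "i < 2" for c i
    proof -
      have cont: "continuous_on UNIV (\<lambda>x. lin_comb 2 (\<lambda>i x. u x powr (p - 2) * w i x) c x)"
        unfolding lin_comb_2 w01
        by (intro continuous_on_add continuous_on_mult continuous_on_const continuous_on_powr' ucont vc)
          (use p_facts(1) in \<open>auto simp: u_def\<close>)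
      have "lin_comb 2 (\<lambda>i x. u x powr (p - 2) * w i x) c x = 0" for x
        using AE_zero_continuous[OF cont ae] .
      from this[of x0] this[of x1] have "c 0 = 0" "c 1 = 0"
        using x0 x1 z0 z1 by (simp_all add: lin_comb_2 w01)
      then show "c i = 0" using i by (auto simp: less_2_cases_iff)
    qed
  qed
  have sup: "(SUP z \<in> V - {\<lambda>_. 0}. ereal (energy z / weighted u z * (\<integral>x. u x powr p \<partial>vol A) powr (2 / real k)))
      \<le> ereal (2 powr (2 / real k) * (energy v / mass v powr (2 / p)))"
  proof (rule SUP_least)
    fix z assume z: "z \<in> V - {\<lambda>_. 0}"
    then obtain c' where "z = lin_comb 2 w c'" by (auto simp: V_def)
    then obtain c :: "nat \<Rightarrow> real" where c: "z = (\<lambda>x. c 0 * v x + c 1 * v' x)"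
      by (simp only: lin_comb_2 w01)
    define q where "q = (c 0)\<^sup>2 + (c 1)\<^sup>2"
    have q: "q > 0"
    proof -
      have "c 0 \<noteq> 0 \<or> c 1 \<noteq> 0" using z c by auto
      then show ?thesis unfolding q_def by (auto intro: add_pos_nonneg add_nonneg_pos)
    qed
    have E: "energy z = q * energy v"
    proof -
      have "energy z = (\<integral>x. (c 0)\<^sup>2 * dens v x + (c 1)\<^sup>2 * dens v' x \<partial>vol A)"
        unfolding energy_def c dens_disjoint[OF v(1) v' disj] ..
      also have "\<dots> = (c 0)\<^sup>2 * energy v + (c 1)\<^sup>2 * energy v'"
        using integrable_dens[OF v(1)] integrable_dens[OF v'] by (simp add: energy_def)
      finally show ?thesis by (simp add: eq q_def algebra_simps)
    qed
    have W: "weighted u z = q * mass v"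
    proof -
      have sq: "\<bar>t\<bar> powr (p - 2) * t\<^sup>2 = \<bar>t\<bar> powr p" for t :: real
      proof (cases "t = 0")
        case False
        then have t2: "t\<^sup>2 = \<bar>t\<bar> powr 2" by (simp add: powr_numeral)
        show ?thesis unfolding t2 powr_add[symmetric] by simp
      qed simp
      have "u x powr (p - 2) * (z x)\<^sup>2 = (c 0)\<^sup>2 * \<bar>v x\<bar> powr p + (c 1)\<^sup>2 * \<bar>v' x\<bar> powr p" for x
        using zero[of x] by (auto simp: u_def c power_mult_distrib mult.left_commute sq)
      then have "weighted u z = (\<integral>x. (c 0)\<^sup>2 * \<bar>v x\<bar> powr p + (c 1)\<^sup>2 * \<bar>v' x\<bar> powr p \<partial>vol A)"
        by (simp add: weighted_def)
      also have "\<dots> = (c 0)\<^sup>2 * mass v + (c 1)\<^sup>2 * mass v'"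
        using mass_integrable[OF v(1)] mass_integrable[OF v'] by (simp add: mass_def)
      finally show ?thesis by (simp add: eq q_def algebra_simps)
    qed
    have pw: "mass v powr (2 / real k) / mass v = 1 / mass v powr (2 / p)"
    proof -
      have "mass v powr (2 / p) * mass v powr (2 / real k) = mass v powr 1"
        unfolding p_facts(2) powr_add[symmetric] by simp
      then show ?thesis using P by (simp add: field_simps)
    qed
    have "energy z / weighted u z * (\<integral>x. u x powr p \<partial>vol A) powr (2 / real k) =
        energy v * (2 powr (2 / real k) * (mass v powr (2 / real k) / mass v))"
      unfolding E W umass using q P by (simp add: powr_mult)
    also have "\<dots> = 2 powr (2 / real k) * (energy v / mass v powr (2 / p))"
      unfolding pw by simp
    finally show "ereal (energy z / weighted u z * (\<integral>x. u x powr p \<partial>vol A) powr (2 / real k))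
      \<le> ereal (2 powr (2 / real k) * (energy v / mass v powr (2 / p)))" by simp
  qed
  have "second_inf \<le> (INF V \<in> Gr A p 2 u. SUP v \<in> V - {\<lambda>_. 0}.
     ereal (energy v / weighted u v * (\<integral>x. u x powr p \<partial>vol A) powr (2 / real k)))"
    unfolding second_inf_def by (rule INF_lower[OF uL])
  also have "\<dots> \<le> (SUP z \<in> V - {\<lambda>_. 0}. ereal (energy z / weighted u z * (\<integral>x. u x powr p \<partial>vol A) powr (2 / real k)))"
    by (rule INF_lower[OF VG])
  finally show ?thesis using sup by (rule order_trans)
qed

theorem second_inf_eq:
  assumes far: "\<And>v. v \<in> Cc_smooth A \<Longrightarrow> \<exists>v'\<in>Cc_smooth A. supp v \<inter> supp v' = {} \<and> energy v' = energy v \<and> mass v' = mass v"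
  shows "second_inf = ereal (2 powr (2 / real k)) * yamabe_inf"
proof (rule antisym)
  have c: "0 < (2::real) powr (2 / real k)" by simp
  have "ereal (2 powr (2 / real k)) * yamabe_inf =
      (INF v \<in> Cc_smooth A - {\<lambda>_. 0}. ereal (2 powr (2 / real k)) * ereal (energy v / mass v powr (2 / p)))"
  proof -
    have "(INF v \<in> Cc_smooth A - {\<lambda>_. 0}. ereal (2 powr (2 / real k)) * ereal (energy v / mass v powr (2 / p))) =
        ereal (2 powr (2 / real k)) * (INF v \<in> Cc_smooth A - {\<lambda>_. 0}. ereal (energy v / mass v powr (2 / p)))"
      using ereal_Inf_cmult[OF c, of "\<lambda>x. x \<in> (\<lambda>v. ereal (energy v / mass v powr (2 / p))) ` (Cc_smooth A - {\<lambda>_. 0})"]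
      by (simp add: image_image setcompr_eq_image)
    then show ?thesis unfolding yamabe_inf_def by simp
  qed
  also have "second_inf \<le> \<dots>"
  proof (rule INF_greatest)
    fix v assume v: "v \<in> Cc_smooth A - {\<lambda>_. 0}"
    then obtain v' where "v' \<in> Cc_smooth A" "supp v \<inter> supp v' = {}" "energy v' = energy v" "mass v' = mass v"
      using far by blast
    then show "second_inf \<le> ereal (2 powr (2 / real k)) * ereal (energy v / mass v powr (2 / p))"
      using second_upper_bound[of v v'] v by simp
  qed
  finally show "second_inf \<le> ereal (2 powr (2 / real k)) * yamabe_inf" .
  show "ereal (2 powr (2 / real k)) * yamabe_inf \<le> second_inf"
    unfolding second_inf_def by (intro INF_greatest second_lower_bound)
qed

end

section \<open>Riemannian products with Euclidean space\<close>

subsection \<open>Block matrices\<close>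

lemma UNIV_eq_Inl_Inr: "(UNIV :: ('m + 'n) set) = Inl ` UNIV \<union> Inr ` UNIV"
proof (rule set_eqI)
  fix x :: "'m + 'n" show "x \<in> UNIV \<longleftrightarrow> x \<in> Inl ` UNIV \<union> Inr ` UNIV" by (cases x) auto
qed

lemma sum_UNIV_sum: "(\<Sum>i\<in>(UNIV :: ('m::finite + 'n::finite) set). f i) = (\<Sum>i\<in>UNIV. f (Inl i)) + (\<Sum>j\<in>UNIV. f (Inr j))"
  by (subst UNIV_eq_Inl_Inr, subst sum.union_disjoint) (auto simp: sum.reindex)

lemma prod_UNIV_sum: "(\<Prod>i\<in>(UNIV :: ('m::finite + 'n::finite) set). f i) = (\<Prod>i\<in>UNIV. f (Inl i)) * (\<Prod>j\<in>UNIV. f (Inr j))"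
  by (subst UNIV_eq_Inl_Inr, subst prod.union_disjoint) (auto simp: prod.reindex)

lemma all_sum_iff: "(\<forall>i :: 'm + 'n. P i) \<longleftrightarrow> (\<forall>i. P (Inl i)) \<and> (\<forall>j. P (Inr j))"
  by (metis sum.exhaust)

lemma vec_sum_eq_iff: "(x :: 'c^('m::finite + 'n::finite)) = y \<longleftrightarrow> (\<forall>i. x $ Inl i = y $ Inl i) \<and> (\<forall>j. x $ Inr j = y $ Inr j)"
  by (simp add: vec_eq_iff all_sum_iff)

lemma join_vec_nth [simp]: "join_vec a b $ Inl i = a $ i" "join_vec a b $ Inr j = b $ j"
  by (simp_all add: join_vec_def)

lemma left_right_nth [simp]: "left_vec z $ i = z $ Inl i" "right_vec z $ j = z $ Inr j"
  by (simp_all add: left_vec_def right_vec_def)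

lemma join_left_right [simp]: "join_vec (left_vec z) (right_vec z) = z" "left_vec (join_vec a b) = a" "right_vec (join_vec a b) = b"
  by (simp_all add: vec_sum_eq_iff) (simp_all add: vec_eq_iff)

lemma block_diag_nth [simp]:
  "block_diag P Q $ Inl i $ Inl j = P $ i $ j" "block_diag P Q $ Inr k $ Inr l = Q $ k $ l"
  "block_diag P Q $ Inl i $ Inr l = 0" "block_diag P Q $ Inr k $ Inl j = 0"
  by (simp_all add: block_diag_def)

lemma bounded_linear_left_right:
  "bounded_linear (left_vec :: real^('m::finite + 'n::finite) \<Rightarrow> real^'m)"
  "bounded_linear (right_vec :: real^('m::finite + 'n::finite) \<Rightarrow> real^'n)"
  unfolding linear_conv_bounded_linear[symmetric]
  by (auto intro!: linearI simp: vec_eq_iff)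

lemma bounded_linear_join: "bounded_linear (\<lambda>q. join_vec (fst q) (snd q) :: real^('m::finite + 'n::finite))"
  unfolding linear_conv_bounded_linear[symmetric]
  by (auto intro!: linearI simp: vec_sum_eq_iff)

lemma block_diag_mult:
  fixes P P' :: "real^'m^'m" and Q Q' :: "real^'n^'n"
  shows "block_diag P Q ** block_diag P' Q' = block_diag (P ** P') (Q ** Q')"
  by (simp add: vec_sum_eq_iff matrix_matrix_mult_def sum_UNIV_sum)

lemma block_diag_transpose:
  fixes P :: "real^'m^'m" and Q :: "real^'n^'n"
  shows "transpose (block_diag P Q) = block_diag (transpose P) (transpose Q)"
  by (simp add: vec_sum_eq_iff transpose_def)

lemma block_diag_one: "block_diag (mat 1 :: real^'m^'m) (mat 1 :: real^'n^'n) = mat 1"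
  by (simp add: vec_sum_eq_iff mat_def)

lemma block_diag_inv:
  fixes P :: "real^'m^'m"
  assumes "invertible P"
  shows "matrix_inv (block_diag P (mat 1 :: real^'n^'n)) = block_diag (matrix_inv P) (mat 1)"
  by (rule matrix_inv_unique) (simp add: block_diag_mult matrix_inv_right[OF assms] block_diag_one)

lemma block_diag_vec:
  fixes P :: "real^'m^'m" and Q :: "real^'n^'n"
  shows "block_diag P Q *v w = join_vec (P *v left_vec w) (Q *v right_vec w)"
  by (simp add: vec_sum_eq_iff matrix_vector_mult_def sum_UNIV_sum)

lemma inner_sum_vec: "(z :: real^('m::finite + 'n::finite)) \<bullet> w = left_vec z \<bullet> left_vec w + right_vec z \<bullet> right_vec w"
  by (simp add: inner_vec_def sum_UNIV_sum)

lemma left_axis: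
  "left_vec (axis (Inl i) 1 :: real^('m::finite + 'n::finite)) = axis i 1"
  "left_vec (axis (Inr j) 1 :: real^('m::finite + 'n::finite)) = 0"
  "right_vec (axis (Inl i) 1 :: real^('m::finite + 'n::finite)) = 0"
  "right_vec (axis (Inr j) 1 :: real^('m::finite + 'n::finite)) = axis j 1"
  by (simp_all add: vec_eq_iff axis_def)

subsection \<open>Scalar curvature of a product with a flat factor\<close>

lemma partial_const [simp]: "partial i (\<lambda>z. c) y = 0"
  by (rule partial_eq[of _ "\<lambda>w. 0", simplified]) simp

lemma partial_left:
  assumes "f differentiable (at (left_vec z))"
  shows "partial (Inl i) (\<lambda>z. f (left_vec z)) z = partial i f (left_vec z)"
    and "partial (Inr j) (\<lambda>z. f (left_vec z)) z = 0"
proof -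
  have D: "((\<lambda>z. f (left_vec z)) has_derivative (\<lambda>w. frechet_derivative f (at (left_vec z)) (left_vec w))) (at z)"
    by (rule has_derivative_compose[OF bounded_linear_imp_has_derivative[OF bounded_linear_left_right(1)]
          differentiable_has_derivative[OF assms]])
  have "linear (frechet_derivative f (at (left_vec z)))" using assms by (rule linear_frechet_derivative)
  then show "partial (Inl i) (\<lambda>z. f (left_vec z)) z = partial i f (left_vec z)"
    and "partial (Inr j) (\<lambda>z. f (left_vec z)) z = 0"
    unfolding partial_eq[OF D] left_axis by (simp_all add: partial_def linear_0)
qed

lemma partial_right:
  assumes "f differentiable (at (right_vec z))"
  shows "partial (Inr i) (\<lambda>z. f (right_vec z)) z = partial i f (right_vec z)"
    and "partial (Inl j) (\<lambda>z. f (right_vec z)) z = 0"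
proof -
  have D: "((\<lambda>z. f (right_vec z)) has_derivative (\<lambda>w. frechet_derivative f (at (right_vec z)) (right_vec w))) (at z)"
    by (rule has_derivative_compose[OF bounded_linear_imp_has_derivative[OF bounded_linear_left_right(2)]
          differentiable_has_derivative[OF assms]])
  have "linear (frechet_derivative f (at (right_vec z)))" using assms by (rule linear_frechet_derivative)
  then show "partial (Inr i) (\<lambda>z. f (right_vec z)) z = partial i f (right_vec z)"
    and "partial (Inl j) (\<lambda>z. f (right_vec z)) z = 0"
    unfolding partial_eq[OF D] left_axis by (simp_all add: partial_def linear_0)
qed

lemma open_left_preimage: "open S \<Longrightarrow> open {z :: real^('m::finite + 'n::finite). left_vec z \<in> S}"
  using open_vimage[OF _ linear_continuous_on[OF bounded_linear_left_right(1)], of S] by (simp add: vimage_def)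

text \<open>
  A constant block has vanishing derivatives, so only the Christoffel symbols of the first factor
  survive.
\<close>

lemma local_scal_block:
  fixes P :: "real^'m \<Rightarrow> real^'m^'m" and z :: "real^('m::finite + 'n::finite)"
  assumes S: "open S" and P: "smooth_on S P" and inv: "\<And>y. y \<in> S \<Longrightarrow> invertible (P y)" and z: "left_vec z \<in> S"
  shows "local_scal (\<lambda>z. block_diag (P (left_vec z)) (mat 1 :: real^'n^'n)) z = local_scal P (left_vec z)"
proof -
  let ?G = "\<lambda>z. block_diag (P (left_vec z)) (mat 1 :: real^'n^'n)"
  define T where "T = {z :: real^('m + 'n). left_vec z \<in> S}"
  have T: "open T" "z \<in> T" unfolding T_def using open_left_preimage[OF S] z by auto
  have dP: "(\<lambda>y. P y $ i $ j) differentiable (at (left_vec z))" if "z \<in> T" for i j z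
    using that by (intro smooth_on_Suc[of S] smooth_on_vec_nth S P) (simp add: T_def)
  have pG: "partial l (\<lambda>z. ?G z $ i $ j) z = (case (l, i, j) of
      (Inl l, Inl i, Inl j) \<Rightarrow> partial l (\<lambda>y. P y $ i $ j) (left_vec z) | _ \<Rightarrow> 0)" if "z \<in> T" for l i j z
    using partial_left[OF dP[OF that]] by (cases l; cases i; cases j) simp_all
  have Ginv: "matrix_inv (?G z) = block_diag (matrix_inv (P (left_vec z))) (mat 1)" if "z \<in> T" for z
    using that by (intro block_diag_inv inv) (simp add: T_def)
  have C: "christoffel ?G k i j z = (case (k, i, j) of
      (Inl k, Inl i, Inl j) \<Rightarrow> christoffel P k i j (left_vec z) | _ \<Rightarrow> 0)" if "z \<in> T" for k i j z
    unfolding christoffel_def pG[OF that] Ginv[OF that]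
    by (cases k; cases i; cases j) (simp_all add: sum_UNIV_sum)
  have dC: "christoffel P k i j differentiable (at (left_vec z))" for k i j
  proof -
    have "smooth_on S (\<lambda>y. chr P i y $ k $ j)" by (intro smooth_on_vec_nth S chr_smooth P inv)
    then show ?thesis using smooth_on_Suc[of S "\<lambda>y. chr P i y $ k $ j"] z by (simp add: chr_def)
  qed
  have pC: "partial l (christoffel ?G k i j) z = (case (l, k, i, j) of
      (Inl l, Inl k, Inl i, Inl j) \<Rightarrow> partial l (christoffel P k i j) (left_vec z) | _ \<Rightarrow> 0)" for l k i j
  proof -
    have "partial l (christoffel ?G k i j) z = partial l (\<lambda>z. (case (k, i, j) of
      (Inl k, Inl i, Inl j) \<Rightarrow> christoffel P k i j (left_vec z) | _ \<Rightarrow> 0)) z"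
      by (rule partial_cong_open[OF T C])
    then show ?thesis using partial_left[OF dC] by (cases l; cases k; cases i; cases j) simp_all
  qed
  have R: "ricci ?G (Inl i) (Inl j) z = ricci P i j (left_vec z)" "ricci ?G (Inr i') (Inr j') z = 0" for i j i' j'
    unfolding ricci_def pC C[OF T(2)] by (simp_all add: sum_UNIV_sum)
  show ?thesis
    unfolding local_scal_def Ginv[OF T(2)] by (simp add: sum_UNIV_sum R)
qed

text \<open>
  In dimension one the terms of the Ricci tensor cancel in pairs. Hence positive scalar curvature
  forces the first factor to have dimension at least two, and the exponents below make sense.
\<close>

lemma local_scal_dim_1:
  fixes G :: "real^'m \<Rightarrow> real^'m^'m"
  assumes "CARD('m) = 1"
  shows "local_scal G y = 0"
proof -
  obtain i :: 'm where i: "UNIV = {i}" using assms by (metis card_1_singletonE)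
  have "ricci G a b y = 0" for a b
  proof -
    have "a = i" "b = i" using i by auto
    then show ?thesis by (simp add: ricci_def i)
  qed
  then show ?thesis by (simp add: local_scal_def)
qed

subsection \<open>Euclidean space\<close>

abbreviation euclid_chart :: "(real^'n, 'n::finite) rchart" where
  "euclid_chart \<equiv> \<lparr>chart_dom = UNIV, chart_map = (\<lambda>x. x), chart_metric = (\<lambda>_. mat 1)\<rparr>"

lemma euclid_chart_facts [simp]:
  "chart_image (euclid_chart :: (real^'n, 'n::finite) rchart) = UNIV" "chart_inv euclid_chart (y :: real^'n) = y"
  by (simp_all add: chart_image_def chart_inv_def inv_into_def)

lemma chart_inv_euclid: "chart_inv (euclid_chart :: (real^'n, 'n::finite) rchart) = (\<lambda>y. y)"
  by (rule ext) simp

lemma matrix_id: "matrix (\<lambda>w :: real^'n. w) = mat 1"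
  using matrix_id_mat_1 by (simp add: id_def)

lemma riemannian_euclid: "riemannian (euclid :: (real^'n, 'n::finite) riem)"
proof
  have lin: "bounded_linear (\<lambda>x :: real^'n. x)" by (rule bounded_linear_ident)
  have fd: "frechet_derivative (\<lambda>x :: real^'n. x) (at y) = (\<lambda>w. w)" for y
    by (rule frechet_derivative_at[symmetric]) (rule has_derivative_ident)
  have "riemannian_chart (euclid_chart :: (real^'n, 'n) rchart)"
    unfolding riemannian_chart_def
    by (auto simp: chart_inv_euclid homeomorphism_def smooth_on_const continuous_on_id)
  moreover have "compatible_charts (euclid_chart :: (real^'n, 'n) rchart) euclid_chart"
    unfolding compatible_charts_def transition_def Let_def
    by (auto simp: chart_inv_euclid o_def fd matrix_id smooth_on_def Ck_on_linear[OF open_UNIV lin])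
  ultimately show "riemannian_manifold (euclid :: (real^'n, 'n) riem)"
    unfolding riemannian_manifold_def euclid_def by auto
qed

lemma chart_at_euclid: "chart_at (euclid :: (real^'n, 'n::finite) riem) y = euclid_chart"
  unfolding chart_at_def euclid_def by (rule some_equality) auto

lemma grad_sq_euclid:
  fixes f :: "real^'n \<Rightarrow> real"
  shows "grad_sq euclid f y = (\<Sum>i\<in>UNIV. (partial i f y)\<^sup>2)"
proof -
  have "matrix_inv (mat 1 :: real^'n^'n) = mat 1" by (rule matrix_inv_unique) simp
  then show ?thesis
    unfolding grad_sq_eq_chart_grad Let_def chart_at_euclid
    by (simp add: chart_grad_def chart_inv_euclid o_def inner_vec_def power2_eq_square)
qed

lemma vol_euclid: "vol (euclid :: (real^'n, 'n::finite) riem) = lborel"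
proof -
  have "volume_spec (euclid :: (real^'n, 'n) riem) lborel"
    unfolding volume_spec_def euclid_def by (auto simp: vol_density_def)
  then show ?thesis by (rule riemannian.vol_eqI[OF riemannian_euclid])
qed

subsection \<open>The product manifold\<close>

abbreviation times_euclid :: "('a, 'm::finite) rchart \<Rightarrow> ('a \<times> (real^'n), 'm + 'n::finite) rchart" where
  "times_euclid c \<equiv> prod_chart c euclid_chart"

lemma riem_prod_euclid: "riem_prod M (euclid :: (real^'n, 'n::finite) riem) = times_euclid ` M"
  by (auto simp: riem_prod_def euclid_def)

lemma times_euclid_simps [simp]:
  "chart_dom (times_euclid c :: ('a \<times> (real^'n), 'm::finite + 'n::finite) rchart) = chart_dom c \<times> UNIV"
  "chart_map (times_euclid c :: ('a \<times> (real^'n), 'm::finite + 'n::finite) rchart) (x, y) = join_vec (chart_map c x) y"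
  "chart_metric (times_euclid c :: ('a \<times> (real^'n), 'm::finite + 'n::finite) rchart) z = block_diag (chart_metric c (left_vec z)) (mat 1)"
  by (simp_all add: prod_chart_def)

lemma smooth_on_join:
  fixes f :: "real^'m \<Rightarrow> real^'m" and S :: "(real^('m::finite + 'n::finite)) set"
  assumes "open S'" "smooth_on S' f" "open S" "left_vec ` S \<subseteq> S'"
  shows "smooth_on S (\<lambda>z. join_vec (f (left_vec z)) (right_vec z))"
  unfolding smooth_on_def
proof
  fix k
  have "Ck_on k S (\<lambda>z. \<chi> i. (case i of Inl j \<Rightarrow> f (left_vec z) $ j | Inr j \<Rightarrow> right_vec z $ j))"
  proof (rule Ck_on_vec_lambda[OF assms(3)])
    fix i :: "'m + 'n"
    show "Ck_on k S (\<lambda>z. case i of Inl j \<Rightarrow> f (left_vec z) $ j | Inr j \<Rightarrow> right_vec z $ j)"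
    proof (cases i)
      case (Inl j)
      have "Ck_on k S (\<lambda>z. f (left_vec z) $ j)"
        by (intro Ck_on_vec_nth assms Ck_on_precompose_linear[OF assms(1,3) bounded_linear_left_right(1) assms(4)])
          (use assms(2) in \<open>auto simp: smooth_on_def\<close>)
      then show ?thesis by (simp add: Inl)
    next
      case (Inr j)
      have "Ck_on k S (\<lambda>z. right_vec z $ j)"
        by (intro Ck_on_vec_nth assms Ck_on_linear bounded_linear_left_right)
      then show ?thesis by (simp add: Inr)
    qed
  qed
  then show "Ck_on k S (\<lambda>z. join_vec (f (left_vec z)) (right_vec z))" by (simp add: join_vec_def)
qed

context riemannian
begin

lemma times_chart_image: "c \<in> A \<Longrightarrow> chart_image (times_euclid c :: ('a \<times> (real^'n), 'm + 'n::finite) rchart) = {z. left_vec z \<in> chart_image c}"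
proof (intro set_eqI iffI)
  fix z :: "real^('m + 'n)"
  assume c: "c \<in> A"
  show "z \<in> {z. left_vec z \<in> chart_image c}" if "z \<in> chart_image (times_euclid c)"
    using that by (auto simp: chart_image_def)
  assume "z \<in> {z. left_vec z \<in> chart_image c}"
  then obtain x where "x \<in> chart_dom c" "left_vec z = chart_map c x" by (auto simp: chart_image_def)
  then have "(x, right_vec z) \<in> chart_dom (times_euclid c)" "z = chart_map (times_euclid c) (x, right_vec z)"
    by (simp_all flip: \<open>left_vec z = chart_map c x\<close>)
  then show "z \<in> chart_image (times_euclid c)" unfolding chart_image_def by blast
qed

lemma times_chart_inv:
  fixes z :: "real^('m + 'n::finite)"
  assumes c: "c \<in> A" and z: "left_vec z \<in> chart_image c"
  shows "chart_inv (times_euclid c) z = (chart_inv c (left_vec z), right_vec z)"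
  unfolding chart_inv_def[of "times_euclid c"]
proof (rule inv_into_f_eq)
  have inj: "inj_on (chart_map c) (chart_dom c)"
    by (rule inj_on_inverseI[of _ "chart_inv c"]) (rule chart_inv_map[OF c])
  show "inj_on (chart_map (times_euclid c :: ('a \<times> (real^'n), 'm + 'n) rchart)) (chart_dom (times_euclid c))"
  proof (rule inj_onI)
    fix q r :: "'a \<times> (real^'n)"
    assume q: "q \<in> chart_dom (times_euclid c)" "r \<in> chart_dom (times_euclid c)"
      "chart_map (times_euclid c) q = chart_map (times_euclid c) r"
    obtain x y x' y' where [simp]: "q = (x, y)" "r = (x', y')" by (cases q, cases r) auto
    have eq: "join_vec (chart_map c x) y = join_vec (chart_map c x') y'" using q(3) by simp
    have "chart_map c x = chart_map c x'" "y = y'"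
      using arg_cong[OF eq, of left_vec] arg_cong[OF eq, of right_vec] by simp_all
    then show "q = r" using q(1,2) inj by (auto dest: inj_onD)
  qed
  show "(chart_inv c (left_vec z), right_vec z) \<in> chart_dom (times_euclid c)"
    using chart_inv_in[OF c z] by simp
  show "chart_map (times_euclid c) (chart_inv c (left_vec z), right_vec z) = z"
    by (simp add: chart_map_inv[OF c z])
qed

lemma riemannian_chart_times:
  assumes c: "c \<in> A"
  shows "riemannian_chart (times_euclid c :: ('a \<times> (real^'n), 'm + 'n::finite) rchart)"
  unfolding riemannian_chart_def
proof (intro conjI ballI)
  let ?c = "times_euclid c :: ('a \<times> (real^'n), 'm + 'n) rchart"
  note im = times_chart_image[OF c]
  show "open (chart_dom ?c)" by (simp add: open_Times open_dom[OF c])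
  show oi: "open (chart_image ?c)" unfolding im by (rule open_left_preimage[OF open_image[OF c]])
  have hc: "continuous_on (chart_dom c) (chart_map c)" "continuous_on (chart_image c) (chart_inv c)"
    using chart_homeo[OF c] by (auto simp: homeomorphism_def)
  show "homeomorphism (chart_dom ?c) (chart_image ?c) (chart_map ?c) (chart_inv ?c)"
  proof (rule homeomorphismI)
    have "continuous_on (chart_dom ?c) (\<lambda>q. join_vec (fst (chart_map c (fst q), snd q)) (snd (chart_map c (fst q), snd q)) :: real^('m + 'n))"
      by (rule continuous_on_compose2[OF linear_continuous_on[OF bounded_linear_join, of UNIV]])
        (auto intro!: continuous_intros continuous_on_compose2[OF hc(1)])
    then show "continuous_on (chart_dom ?c) (chart_map ?c)"
      by (rule continuous_on_eq) auto
    have "continuous_on (chart_image ?c) (\<lambda>z. (chart_inv c (left_vec z), right_vec z))"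
      unfolding im
      by (auto intro!: continuous_intros continuous_on_compose2[OF hc(2)] linear_continuous_on bounded_linear_left_right)
    then show "continuous_on (chart_image ?c) (chart_inv ?c)"
      by (rule continuous_on_eq) (simp add: im times_chart_inv[OF c])
    show "chart_map ?c ` chart_dom ?c \<subseteq> chart_image ?c" by (simp add: chart_image_def)
    show "chart_inv ?c ` chart_image ?c \<subseteq> chart_dom ?c"
      by (auto simp: im times_chart_inv[OF c] chart_inv_in[OF c])
    show "chart_inv ?c (chart_map ?c q) = q" if "q \<in> chart_dom ?c" for q
      using that by (auto simp: times_chart_inv[OF c] chart_map_in[OF c] chart_inv_map[OF c])
    show "chart_map ?c (chart_inv ?c z) = z" if "z \<in> chart_image ?c" for z
      using that by (simp add: im times_chart_inv[OF c] chart_map_inv[OF c])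
  qed
  show "smooth_on (chart_image ?c) (chart_metric ?c)"
    unfolding smooth_on_def
  proof
    fix k
    have "Ck_on k (chart_image ?c) (\<lambda>z. \<chi> i j. block_diag (chart_metric c (left_vec z)) (mat 1 :: real^'n^'n) $ i $ j)"
    proof (rule Ck_on_matrix[OF oi])
      fix i j :: "'m + 'n"
      have L: "Ck_on k (chart_image ?c) (\<lambda>z. chart_metric c (left_vec z) $ a $ b)" for a b
        by (intro Ck_on_vec_nth oi Ck_on_precompose_linear[OF open_image[OF c] oi bounded_linear_left_right(1)])
          (use smooth_metric[OF c] in \<open>auto simp: smooth_on_def im\<close>)
      show "Ck_on k (chart_image ?c) (\<lambda>z. block_diag (chart_metric c (left_vec z)) (mat 1) $ i $ j)"
        by (cases i; cases j) (simp_all add: L Ck_on_const[OF oi])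
    qed
    moreover have "chart_metric ?c = (\<lambda>z. block_diag (chart_metric c (left_vec z)) (mat 1))" by (rule ext) simp
    ultimately show "Ck_on k (chart_image ?c) (chart_metric ?c)" by simp
  qed
  fix z assume z: "z \<in> chart_image ?c"
  then have lz: "left_vec z \<in> chart_image c" by (simp add: im)
  show "transpose (chart_metric ?c z) = chart_metric ?c z"
    by (simp add: block_diag_transpose sym_metric[OF c lz])
  show "\<forall>w. w \<noteq> 0 \<longrightarrow> w \<bullet> (chart_metric ?c z *v w) > 0"
  proof (intro allI impI)
    fix w :: "real^('m + 'n)" assume w: "w \<noteq> 0"
    have eq: "w \<bullet> (chart_metric ?c z *v w) = left_vec w \<bullet> (chart_metric c (left_vec z) *v left_vec w) + right_vec w \<bullet> right_vec w"
      by (simp add: block_diag_vec inner_sum_vec)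
    show "w \<bullet> (chart_metric ?c z *v w) > 0"
    proof (cases "left_vec w = 0")
      case True
      have "right_vec w \<noteq> 0"
      proof
        assume "right_vec w = 0"
        then have "w = join_vec 0 0" using True join_left_right(1)[of w] by simp
        then show False using w by (simp add: vec_sum_eq_iff)
      qed
      then show ?thesis unfolding eq using True by simp
    next
      case False
      then show ?thesis unfolding eq using pos_metric[OF c lz False] by (simp add: add_pos_nonneg)
    qed
  qed
qed

lemma compatible_charts_times:
  assumes c: "c \<in> A" and d: "d \<in> A"
  shows "compatible_charts (times_euclid c :: ('a \<times> (real^'n), 'm + 'n::finite) rchart) (times_euclid d)"
proof -
  let ?c = "times_euclid c :: ('a \<times> (real^'n), 'm + 'n) rchart" and ?d = "times_euclid d :: ('a \<times> (real^'n), 'm + 'n) rchart"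
  let ?S = "chart_map c ` (chart_dom c \<inter> chart_dom d)"
  have oS: "open ?S" by (intro open_chart_image[OF c] open_Int open_dom c d) auto
  define T where "T = {z :: real^('m + 'n). left_vec z \<in> ?S}"
  have T: "chart_map ?c ` (chart_dom ?c \<inter> chart_dom ?d) = T"
  proof (intro set_eqI iffI)
    fix z assume "z \<in> T"
    then obtain x where "x \<in> chart_dom c \<inter> chart_dom d" and lz: "left_vec z = chart_map c x" by (auto simp: T_def)
    then have "(x, right_vec z) \<in> chart_dom ?c \<inter> chart_dom ?d" "z = chart_map ?c (x, right_vec z)"
      by (simp_all flip: lz)
    then show "z \<in> chart_map ?c ` (chart_dom ?c \<inter> chart_dom ?d)" by blast
  qed (auto simp: T_def)
  have oT: "open T" unfolding T_def by (rule open_left_preimage[OF oS])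
  have tr: "transition ?c ?d z = join_vec (transition c d (left_vec z)) (right_vec z)" if "z \<in> T" for z
  proof -
    have "left_vec z \<in> chart_image c" using that chart_map_in[OF c] by (auto simp: T_def)
    then show ?thesis by (simp add: transition_def times_chart_inv[OF c])
  qed
  have sm: "smooth_on T (transition ?c ?d)"
  proof (rule smooth_on_cong[OF oT tr, THEN iffD2])
    show "smooth_on T (\<lambda>z. join_vec (transition c d (left_vec z)) (right_vec z))"
      by (rule smooth_on_join[OF oS smooth_transition[OF c d] oT]) (auto simp: T_def)
  qed
  have J: "matrix (frechet_derivative (transition ?c ?d) (at z)) =
      block_diag (matrix (frechet_derivative (transition c d) (at (left_vec z)))) (mat 1)" if z: "z \<in> T" for z
  proof -
    let ?D = "frechet_derivative (transition c d) (at (left_vec z))"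
    have D: "((\<lambda>z. transition c d (left_vec z)) has_derivative (\<lambda>w. ?D (left_vec w))) (at z)"
      by (rule has_derivative_compose[OF bounded_linear_imp_has_derivative[OF bounded_linear_left_right(1)]])
        (rule smooth_on_has_derivative[OF smooth_transition[OF c d]], use z in \<open>auto simp: T_def\<close>)
    have "((\<lambda>z. join_vec (fst (transition c d (left_vec z), right_vec z)) (snd (transition c d (left_vec z), right_vec z)) :: real^('m + 'n))
        has_derivative (\<lambda>w. join_vec (fst (?D (left_vec w), right_vec w)) (snd (?D (left_vec w), right_vec w)))) (at z)"
      by (rule bounded_linear.has_derivative[OF bounded_linear_join has_derivative_Pair[OF D
            bounded_linear_imp_has_derivative[OF bounded_linear_left_right(2)]]])
    then have "((\<lambda>z. join_vec (transition c d (left_vec z)) (right_vec z) :: real^('m + 'n))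
        has_derivative (\<lambda>w. join_vec (?D (left_vec w)) (right_vec w))) (at z)" by simp
    then have "(transition ?c ?d has_derivative (\<lambda>w. join_vec (?D (left_vec w)) (right_vec w))) (at z)"
      by (rule has_derivative_transform_within_open[OF _ oT z]) (simp add: tr)
    then have fd: "frechet_derivative (transition ?c ?d) (at z) = (\<lambda>w. join_vec (?D (left_vec w)) (right_vec w))"
      by (rule frechet_derivative_at[symmetric])
    have "linear ?D" by (intro linear_frechet_derivative smooth_on_Suc[OF smooth_transition[OF c d]]) (use z in \<open>simp add: T_def\<close>)
    then have "?D 0 = 0" by (rule linear_0)
    then show ?thesis
      unfolding fd by (simp add: vec_sum_eq_iff matrix_def left_axis) (simp add: mat_def axis_def)
  qed
  show ?thesis
    unfolding compatible_charts_def Let_def T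
  proof (intro conjI ballI sm)
    fix q :: "'a \<times> (real^'n)" assume q: "q \<in> chart_dom ?c \<inter> chart_dom ?d"
    obtain x y where [simp]: "q = (x, y)" by (cases q)
    have x: "x \<in> chart_dom c \<inter> chart_dom d" using q by simp
    have zT: "chart_map ?c q \<in> T" unfolding T[symmetric] using q by blast
    have "compatible_charts c d" using manifold c d unfolding riemannian_manifold_def by blast
    then have "chart_metric c (chart_map c x) = transpose (matrix (frechet_derivative (transition c d) (at (chart_map c x)))) **
        chart_metric d (chart_map d x) ** matrix (frechet_derivative (transition c d) (at (chart_map c x)))"
      using x unfolding compatible_charts_def Let_def by blast
    then show "chart_metric ?c (chart_map ?c q) = transpose (matrix (frechet_derivative (transition ?c ?d) (at (chart_map ?c q)))) **
        chart_metric ?d (chart_map ?d q) ** matrix (frechet_derivative (transition ?c ?d) (at (chart_map ?c q)))"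
      unfolding J[OF zT] by (simp add: block_diag_transpose block_diag_mult)
  qed
qed

lemma riemannian_times: "riemannian (riem_prod A (euclid :: (real^'n, 'n::finite) riem))"
proof
  have "(\<Union>c\<in>A. chart_dom c) = UNIV" using manifold by (simp add: riemannian_manifold_def)
  moreover have "(\<Union>c\<in>A. chart_dom c \<times> (UNIV :: (real^'n) set)) = (\<Union>c\<in>A. chart_dom c) \<times> UNIV" by auto
  ultimately have "(\<Union>c\<in>A. chart_dom c \<times> (UNIV :: (real^'n) set)) = UNIV" by simp
  then show "riemannian_manifold (riem_prod A (euclid :: (real^'n, 'n) riem))"
    unfolding riemannian_manifold_def riem_prod_euclid
    by (auto simp: riemannian_chart_times compatible_charts_times)
qed

text \<open>
  The chart selected on the product need not extend the one selected on the factor; invariance under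
  changes of charts makes this harmless.
\<close>

lemma scal_times: "scal (riem_prod A (euclid :: (real^'n, 'n::finite) riem)) (x, y) = scal A x"
proof -
  let ?c = "chart_at A x"
  have c: "?c \<in> A" "x \<in> chart_dom ?c" using chart_at_works by auto
  have "scal (riem_prod A (euclid :: (real^'n, 'n) riem)) (x, y) =
      local_scal (chart_metric (times_euclid ?c :: ('a \<times> (real^'n), 'm + 'n) rchart)) (chart_map (times_euclid ?c) (x, y))"
    by (rule riemannian.scal_chart[OF riemannian_times]) (use c in \<open>auto simp: riem_prod_euclid\<close>)
  also have "chart_metric (times_euclid ?c :: ('a \<times> (real^'n), 'm + 'n) rchart) =
      (\<lambda>z. block_diag (chart_metric ?c (left_vec z)) (mat 1))" by (rule ext) simp
  also have "local_scal \<dots> (chart_map (times_euclid ?c) (x, y)) = local_scal (chart_metric ?c) (chart_map ?c x)"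
    using local_scal_block[OF open_image[OF c(1)] smooth_metric[OF c(1)] inv_metric[OF c(1)], of "join_vec (chart_map ?c x) y"]
      chart_map_in[OF c] by simp
  finally show ?thesis by (simp add: scal_def Let_def)
qed

end

subsection \<open>The volume of the product\<close>

text \<open>
  Letting a permutation act on the first summand only does not change its factorization into
  transpositions, hence not its sign.
\<close>

lemma swapidseq_map_sum:
  fixes p :: "'m \<Rightarrow> 'm"
  shows "swapidseq n p \<Longrightarrow> swapidseq n (map_sum p id :: 'm + 'n \<Rightarrow> 'm + 'n)"
proof (induction rule: swapidseq.induct)
  case id
  show ?case by (simp only: map_sum.id swapidseq.id)
next
  case (comp_Suc n p a b)
  have "map_sum (Transposition.transpose a b \<circ> p) id = Transposition.transpose (Inl a) (Inl b) \<circ> (map_sum p id :: 'm + 'n \<Rightarrow> 'm + 'n)"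
  proof (rule ext)
    fix x :: "'m + 'n"
    show "map_sum (Transposition.transpose a b \<circ> p) id x = (Transposition.transpose (Inl a) (Inl b) \<circ> (map_sum p id :: 'm + 'n \<Rightarrow> 'm + 'n)) x"
      by (cases x) (simp_all add: Transposition.transpose_def)
  qed
  moreover have "Inl a \<noteq> (Inl b :: 'm + 'n)" using comp_Suc by simp
  ultimately show ?case
    using swapidseq.comp_Suc[OF comp_Suc.IH, of "Inl a" "Inl b"] by argo
qed

lemma sign_map_sum:
  fixes p :: "'m::finite \<Rightarrow> 'm"
  assumes "p permutes UNIV"
  shows "sign (map_sum p id :: 'm + 'n \<Rightarrow> 'm + 'n) = sign p"
proof -
  have "permutation p" using assms by (auto intro: permutes_imp_permutation)
  then obtain n where n: "swapidseq n p" by (auto simp: permutation_def)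
  have "evenperm p = even n" by (rule evenperm_unique[OF n refl])
  moreover have "evenperm (map_sum p id :: 'm + 'n \<Rightarrow> 'm + 'n) = even n"
    by (rule evenperm_unique[OF swapidseq_map_sum[OF n] refl])
  ultimately show ?thesis by (simp add: sign_def)
qed

text \<open>Only the permutations that fix the second block pointwise contribute to the determinant.\<close>

lemma det_block_diag_one:
  fixes P :: "real^'m^'m"
  shows "det (block_diag P (mat 1 :: real^'n^'n)) = det P"
proof -
  let ?B = "block_diag P (mat 1 :: real^'n^'n)"
  define f where "f q = of_int (sign q) * (\<Prod>i\<in>UNIV. ?B $ i $ q i)" for q
  define Q where "Q = {q :: 'm + 'n \<Rightarrow> 'm + 'n. q permutes UNIV \<and> (\<forall>j. q (Inr j) = Inr j)}"
  have bij: "bij_betw (\<lambda>p. map_sum p id) {p. p permutes (UNIV :: 'm set)} Q"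
  proof (rule bij_betwI[where g = "\<lambda>q i. projl (q (Inl i))"])
    show "(\<lambda>p. map_sum p id) \<in> {p. p permutes UNIV} \<rightarrow> Q"
    proof
      fix p :: "'m \<Rightarrow> 'm" assume "p \<in> {p. p permutes UNIV}"
      then have "bij p" by (simp add: permutes_bij)
      then have "bij (map_sum p id :: 'm + 'n \<Rightarrow> 'm + 'n)"
      proof -
        assume b: "bij p"
        have "inj (map_sum p id :: 'm + 'n \<Rightarrow> 'm + 'n)"
          using sum.inj_map[of p "id :: 'n \<Rightarrow> 'n"] b by (simp add: bij_def)
        then show ?thesis by (simp add: bij_def finite_UNIV_inj_surj)
      qed
      then show "(map_sum p id :: 'm + 'n \<Rightarrow> 'm + 'n) \<in> Q" by (auto simp: Q_def intro: bij_imp_permutes)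
    qed
    have inl: "\<exists>i'. q (Inl i) = Inl i'" if "q \<in> Q" for q i
    proof (cases "q (Inl i)")
      case (Inr j)
      have "inj q" using that by (auto simp: Q_def dest: permutes_inj)
      moreover have "q (Inl i) = q (Inr j)" using Inr that by (simp add: Q_def)
      ultimately have "Inl i = (Inr j :: 'm + 'n)" by (rule injD)
      then show ?thesis by simp
    qed auto
    show "(\<lambda>q i. projl (q (Inl i))) \<in> Q \<rightarrow> {p. p permutes UNIV}"
    proof
      fix q assume q: "q \<in> Q"
      have "inj (\<lambda>i. projl (q (Inl i)))"
      proof (rule injI)
        fix i j assume "projl (q (Inl i)) = projl (q (Inl j))"
        then have "q (Inl i) = q (Inl j)" using inl[OF q, of i] inl[OF q, of j] by auto
        moreover have "inj q" using q by (auto simp: Q_def dest: permutes_inj)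
        ultimately show "i = j" by (auto dest: injD)
      qed
      then have "bij (\<lambda>i. projl (q (Inl i)))" by (simp add: bij_def finite_UNIV_inj_surj)
      then show "(\<lambda>i. projl (q (Inl i))) \<in> {p. p permutes UNIV}" by (auto intro: bij_imp_permutes)
    qed
    show "map_sum (\<lambda>i. projl (q (Inl i))) id = q" if q: "q \<in> Q" for q
    proof (rule ext)
      fix x show "map_sum (\<lambda>i. projl (q (Inl i))) id x = q x"
        using inl[OF q] q by (cases x) (auto simp: Q_def, metis sum.sel(1))
    qed
  qed simp
  have "det ?B = (\<Sum>q\<in>{q. q permutes UNIV}. f q)" by (simp add: det_def f_def)
  also have "\<dots> = (\<Sum>q\<in>Q. f q)"
  proof (rule sum.mono_neutral_right)
    show "\<forall>q\<in>{q. q permutes UNIV} - Q. f q = 0"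
    proof
      fix q :: "'m + 'n \<Rightarrow> 'm + 'n" assume "q \<in> {q. q permutes UNIV} - Q"
      then obtain j where j: "q (Inr j) \<noteq> Inr j" by (auto simp: Q_def)
      have "?B $ Inr j $ q (Inr j) = 0" using j by (cases "q (Inr j)") (auto simp: mat_def)
      then have "(\<Prod>i\<in>UNIV. ?B $ i $ q i) = 0" by (intro prod_zero) auto
      then show "f q = 0" by (simp add: f_def)
    qed
  qed (auto simp: Q_def)
  also have "\<dots> = (\<Sum>p\<in>{p. p permutes UNIV}. f (map_sum p id))"
    by (rule sum.reindex_bij_betw[OF bij, symmetric])
  also have "\<dots> = (\<Sum>p\<in>{p. p permutes UNIV}. of_int (sign p) * (\<Prod>i\<in>UNIV. P $ i $ p i))"
    by (rule sum.cong[OF refl]) (simp add: f_def sign_map_sum prod_UNIV_sum, simp add: mat_def)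
  finally show ?thesis by (simp add: det_def)
qed

lemma lborel_join:
  "distr (lborel \<Otimes>\<^sub>M lborel) borel (\<lambda>q. join_vec (fst q) (snd q)) = (lborel :: (real^('m::finite + 'n::finite)) measure)"
proof (rule lborel_vec_eqI[symmetric])
  fix l u :: "real^('m + 'n)" assume le: "\<And>i. l $ i \<le> u $ i"
  have m: "(\<lambda>q. join_vec (fst q) (snd q) :: real^('m + 'n)) \<in> borel_measurable (lborel \<Otimes>\<^sub>M lborel)"
    using borel_measurable_continuous_onI[OF linear_continuous_on[OF bounded_linear_join]]
    by (simp add: lborel_prod)
  have "(\<lambda>q. join_vec (fst q) (snd q)) -` box l u = box (left_vec l) (left_vec u) \<times> box (right_vec l) (right_vec u)"
    by (auto simp: mem_box_vec all_sum_iff)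
  then have "emeasure (distr (lborel \<Otimes>\<^sub>M lborel) borel (\<lambda>q. join_vec (fst q) (snd q))) (box l u) =
      emeasure (lborel \<Otimes>\<^sub>M lborel) (box (left_vec l) (left_vec u) \<times> box (right_vec l) (right_vec u))"
    using m by (simp add: emeasure_distr space_pair_measure)
  also have "\<dots> = (\<Prod>i\<in>UNIV. ennreal (u $ i - l $ i))"
    using lborel_vec_box[of "left_vec l" "left_vec u"] lborel_vec_box[of "right_vec l" "right_vec u"] le
    by (simp add: lborel.emeasure_pair_measure_Times prod_UNIV_sum)
  finally show "emeasure (distr (lborel \<Otimes>\<^sub>M lborel) borel (\<lambda>q. join_vec (fst q) (snd q))) (box l u) =
    (\<Prod>i\<in>UNIV. ennreal (u $ i - l $ i))" .
qed simp

lemma nn_integral_join: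
  fixes F :: "real^('m::finite + 'n::finite) \<Rightarrow> ennreal"
  assumes F: "F \<in> borel_measurable borel"
  shows "(\<integral>\<^sup>+z. F z \<partial>lborel) = (\<integral>\<^sup>+y. \<integral>\<^sup>+w. F (join_vec w y) \<partial>lborel \<partial>lborel)"
proof -
  have m: "(\<lambda>q. join_vec (fst q) (snd q) :: real^('m + 'n)) \<in> borel_measurable (lborel \<Otimes>\<^sub>M lborel)"
    using borel_measurable_continuous_onI[OF linear_continuous_on[OF bounded_linear_join]]
    by (simp add: lborel_prod)
  have "(\<integral>\<^sup>+z. F z \<partial>lborel) = (\<integral>\<^sup>+q. F (join_vec (fst q) (snd q)) \<partial>(lborel \<Otimes>\<^sub>M lborel))"
    by (subst lborel_join[symmetric], subst nn_integral_distr) (use m F in auto)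
  also have "\<dots> = (\<integral>\<^sup>+y. \<integral>\<^sup>+w. F (join_vec w y) \<partial>lborel \<partial>lborel)"
    using lborel_pair.nn_integral_snd[OF measurable_compose[OF m F]] by simp
  finally show ?thesis .
qed

context riemannian
begin

text \<open>
  The product measure has the property that characterizes the volume: slice a set inside a
  product chart, measure the slices in the chart of the first factor, and recombine by Fubini.
\<close>

lemma vol_times:
  assumes cpt: "compact (UNIV :: 'a set)"
  shows "vol (riem_prod A (euclid :: (real^'n, 'n::finite) riem)) = vol A \<Otimes>\<^sub>M lborel"
proof (rule riemannian.vol_eqI[OF riemannian_times])
  interpret finite_measure "vol A"
    using vol_compact_finite[OF cpt] by (intro finite_measureI) auto
  interpret pair_sigma_finite "vol A" "lborel :: (real^'n) measure" ..
  have sets: "sets (vol A \<Otimes>\<^sub>M (lborel :: (real^'n) measure)) = sets borel"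
  proof -
    have "sets (vol A \<Otimes>\<^sub>M (lborel :: (real^'n) measure)) = sets ((borel :: 'a measure) \<Otimes>\<^sub>M (borel :: (real^'n) measure))"
      by (rule sets_pair_measure_cong) simp_all
    then show ?thesis by (simp only: borel_prod)
  qed
  show "volume_spec (riem_prod A (euclid :: (real^'n, 'n) riem)) (vol A \<Otimes>\<^sub>M lborel)"
    unfolding volume_spec_def riem_prod_euclid
  proof (intro conjI ballI impI sets)
    fix c' and B :: "('a \<times> (real^'n)) set"
    assume "c' \<in> times_euclid ` A" and B: "B \<in> sets borel" "B \<subseteq> chart_dom c'"
    then obtain c where c: "c \<in> A" and c': "c' = times_euclid c" by blast
    have Bs: "B \<subseteq> chart_dom c \<times> UNIV" using B(2) c' by simp
    have sl: "(\<lambda>x. (x, y)) -` B \<in> sets borel" "(\<lambda>x. (x, y)) -` B \<subseteq> chart_dom c" for y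
    proof -
      have "(\<lambda>x. (x, y)) -` B \<inter> space borel \<in> sets borel"
        by (rule measurable_sets[OF _ B(1)]) (intro borel_measurable_continuous_onI continuous_intros)
      then show "(\<lambda>x. (x, y)) -` B \<in> sets borel" by simp
      show "(\<lambda>x. (x, y)) -` B \<subseteq> chart_dom c" using Bs by auto
    qed
    have mem: "join_vec w y \<in> chart_map c' ` B \<longleftrightarrow> w \<in> chart_map c ` ((\<lambda>x. (x, y)) -` B)" for w y
    proof
      assume "join_vec w y \<in> chart_map c' ` B"
      then obtain x y' where xy: "(x, y') \<in> B" "join_vec w y = join_vec (chart_map c x) y'" by (auto simp: c')
      have "w = chart_map c x" "y = y'"
        using arg_cong[OF xy(2), of left_vec] arg_cong[OF xy(2), of right_vec] by simp_all
      then show "w \<in> chart_map c ` ((\<lambda>x. (x, y)) -` B)" using xy(1) by auto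
    next
      assume "w \<in> chart_map c ` ((\<lambda>x. (x, y)) -` B)"
      then obtain x where "(x, y) \<in> B" "w = chart_map c x" by auto
      then show "join_vec w y \<in> chart_map c' ` B" unfolding c' by (intro image_eqI[of _ _ "(x, y)"]) auto
    qed
    have dens: "vol_density c' z = vol_density c (left_vec z)" for z
      by (simp add: vol_density_def c' det_block_diag_one)
    have "emeasure (vol A \<Otimes>\<^sub>M lborel) B = (\<integral>\<^sup>+y. emeasure (vol A) ((\<lambda>x. (x, y)) -` B) \<partial>lborel)"
      by (rule emeasure_pair_measure_alt2) (use B(1) sets in simp)
    also have "\<dots> = (\<integral>\<^sup>+y. \<integral>\<^sup>+w. ennreal (vol_density c w) * indicator (chart_map c ` ((\<lambda>x. (x, y)) -` B)) w \<partial>lborel \<partial>lborel)"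
      by (intro nn_integral_cong emeasure_vol_chart[OF c] sl)
    also have "\<dots> = (\<integral>\<^sup>+y. \<integral>\<^sup>+w. ennreal (vol_density c' (join_vec w y)) * indicator (chart_map c' ` B) (join_vec w y) \<partial>lborel \<partial>lborel)"
      by (intro nn_integral_cong) (simp add: dens mem indicator_def)
    also have "\<dots> = (\<integral>\<^sup>+z. ennreal (vol_density c' z) * indicator (chart_map c' ` B) z \<partial>lborel)"
    proof (rule nn_integral_join[symmetric])
      have W: "riemannian (riem_prod A (euclid :: (real^'n, 'n) riem))" by (rule riemannian_times)
      have c'W: "c' \<in> riem_prod A (euclid :: (real^'n, 'n) riem)" using c c' by (simp add: riem_prod_euclid)
      have "(\<lambda>z. indicator (chart_map c' ` B) z * vol_density c' z) \<in> borel_measurable borel"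
        by (rule riemannian.borel_density_on[OF W c'W riemannian.borel_chart_map_image[OF W c'W B]])
          (use B(2) riemannian.chart_map_in[OF W c'W] in auto)
      from measurable_compose[OF this measurable_ennreal]
      show "(\<lambda>z. ennreal (vol_density c' z) * indicator (chart_map c' ` B) z) \<in> borel_measurable borel"
        by (simp add: ennreal_indicator_mult)
    qed
    finally show "emeasure (vol A \<Otimes>\<^sub>M lborel) B = (\<integral>\<^sup>+z. ennreal (vol_density c' z) * indicator (chart_map c' ` B) z \<partial>lborel)" .
  qed
qed

end

subsection \<open>Translations\<close>

lemma has_derivative_shift:
  fixes g :: "'e::real_normed_vector \<Rightarrow> 'f::real_normed_vector"
  shows "((\<lambda>w. g (w + v)) has_derivative D) (at z) \<longleftrightarrow> (g has_derivative D) (at (z + v))"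
proof
  assume "(g has_derivative D) (at (z + v))"
  then show "((\<lambda>w. g (w + v)) has_derivative D) (at z)"
    by (rule has_derivative_compose[rotated]) (auto intro!: derivative_eq_intros)
next
  assume "((\<lambda>w. g (w + v)) has_derivative D) (at z)"
  then have "((\<lambda>w. g (w + v)) has_derivative D) (at (z + v + - v))" by simp
  then have "((\<lambda>w. g (w + - v + v)) has_derivative D) (at (z + v))"
    by (rule has_derivative_compose[rotated, where f = "\<lambda>w. w + - v"]) (auto intro!: derivative_eq_intros)
  then show "(g has_derivative D) (at (z + v))" by simp
qed

lemma frechet_derivative_shift:
  "frechet_derivative (\<lambda>w. g (w + v)) (at z) = frechet_derivative g (at (z + v))"
  unfolding frechet_derivative_def has_derivative_shift ..

lemma partial_shift: "partial i (\<lambda>w. g (w + v)) z = partial i g (z + v)"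
  unfolding partial_def frechet_derivative_shift ..

lemma smooth_on_shift:
  assumes "open S" "smooth_on T g" "\<And>w. w \<in> S \<Longrightarrow> w + v \<in> T"
  shows "smooth_on S (\<lambda>w. g (w + v))"
  unfolding smooth_on_def
proof
  fix k
  have "Ck_on k T g" using assms(2) by (simp add: smooth_on_def)
  then show "Ck_on k S (\<lambda>w. g (w + v))"
  proof (induction k arbitrary: g)
    case 0
    then show ?case using assms(3)
      by (auto intro!: continuous_on_compose2[of T g] continuous_intros)
  next
    case (Suc k)
    show ?case
    proof (rule Ck_on_SucI[OF assms(1)])
      show "((\<lambda>w. g (w + v)) has_derivative frechet_derivative g (at (y + v))) (at y)" if "y \<in> S" for y
        unfolding has_derivative_shift by (rule Ck_on_SucD[OF Suc.prems assms(3)[OF that]])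
      show "Ck_on k S (\<lambda>y. frechet_derivative g (at (y + v)) w)" for w
        using Suc.prems by (intro Suc.IH) simp
    qed
  qed
qed

text \<open>
  Translate by more than twice the radius of a ball around the origin that contains the set.
\<close>

lemma translation_disjoint:
  fixes K :: "(real^'n) set"
  assumes "bounded K"
  shows "\<exists>b. \<forall>y\<in>K. y + b \<notin> K"
proof -
  obtain R where R: "\<And>y. y \<in> K \<Longrightarrow> norm y \<le> R" using assms bounded_iff by blast
  obtain b :: "real^'n" where b: "norm b = 2 * \<bar>R\<bar> + 1" using vector_choose_size[of "2 * \<bar>R\<bar> + 1"] by auto
  have "y + b \<notin> K" if "y \<in> K" for y
  proof
    assume "y + b \<in> K"
    then have "norm (y + b) \<le> \<bar>R\<bar>" "norm y \<le> \<bar>R\<bar>" using R[of "y + b"] R[OF that] by auto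
    moreover have "norm b \<le> norm (y + b) + norm y" using norm_triangle_ineq4[of "y + b" y] by simp
    ultimately show False using b by simp
  qed
  then show ?thesis by blast
qed

context yamabe_data
begin

text \<open>
  Disjoint copies of test functions come from isometries that move a given compact set off itself.
\<close>

lemma second_inf_eq_translations:
  assumes T: "\<And>K. compact K \<Longrightarrow> \<exists>T T'. continuous_on UNIV T \<and> continuous_on UNIV T' \<and> (\<forall>x. T (T' x) = x) \<and> (\<forall>x. T' (T x) = x) \<and>
    distr (vol A) borel T = vol A \<and> (\<forall>f. smooth_fun A f \<longrightarrow> smooth_fun A (\<lambda>x. f (T x))) \<and>
    (\<forall>f x. grad_sq A (\<lambda>x. f (T x)) x = grad_sq A f (T x)) \<and> (\<forall>x. s (T x) = s x) \<and> (\<forall>x\<in>K. T x \<notin> K)"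
  shows "second_inf = ereal (2 powr (2 / real k)) * yamabe_inf"
proof (rule second_inf_eq)
  fix v assume v: "v \<in> Cc_smooth A"
  obtain T T' where cont: "continuous_on UNIV T" "continuous_on UNIV T'" and inv: "\<And>x. T (T' x) = x" "\<And>x. T' (T x) = x"
    and d: "distr (vol A) borel T = vol A" and sm: "\<And>f. smooth_fun A f \<Longrightarrow> smooth_fun A (\<lambda>x. f (T x))"
    and gr: "\<And>f x. grad_sq A (\<lambda>x. f (T x)) x = grad_sq A f (T x)" and sT: "\<And>x. s (T x) = s x"
    and disj: "\<And>x. x \<in> supp v \<Longrightarrow> T x \<notin> supp v"
    using T[OF Cc_compact[OF v]] by blast
  have cl: "closed (supp v)" by (simp add: supp_def)
  have "closed (T -` supp v)" by (rule closed_vimage[OF cl cont(1)])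
  then have sub: "supp (\<lambda>x. v (T x)) \<subseteq> T -` supp v"
    by (rule supp_subsetI) (simp add: notin_supp[of _ v])
  have "T -` supp v = T' ` supp v" using inv by (auto simp: image_iff) metis
  moreover have "compact (T' ` supp v)"
    by (rule compact_continuous_image[OF continuous_on_subset[OF cont(2)] Cc_compact[OF v]]) auto
  ultimately have cK: "compact (T -` supp v)" by simp
  have "compact (supp (\<lambda>x. v (T x)))"
    by (rule compact_suppI[OF cK]) (simp add: notin_supp[of _ v])
  then have C: "(\<lambda>x. v (T x)) \<in> Cc_smooth A"
    unfolding Cc_smooth_iff using sm[OF Cc_smooth_fun[OF v]] by simp
  have Tm: "T \<in> measurable (vol A) borel"
    using borel_measurable_continuous_onI[OF cont(1)] by (simp add: measurable_cong_sets[OF sets_vol refl])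
  have trans: "(\<integral>x. h (T x) \<partial>vol A) = (\<integral>x. h x \<partial>vol A)" if "h \<in> borel_measurable borel" for h :: "'a \<Rightarrow> real"
    using integral_distr[OF Tm that] by (simp add: d)
  have "energy (\<lambda>x. v (T x)) = (\<integral>x. dens v (T x) \<partial>vol A)"
    unfolding energy_def dens_def gr by (simp add: sT)
  also have "\<dots> = energy v"
    unfolding energy_def by (intro trans borel_measurable_continuous_onI continuous_dens v)
  finally have E: "energy (\<lambda>x. v (T x)) = energy v" .
  have vm: "(\<lambda>x. \<bar>v x\<bar> powr p) \<in> borel_measurable borel"
    using mass_integrable[OF v] borel_measurable_integrable borel_measurable_vol_iff by blast
  have M: "mass (\<lambda>x. v (T x)) = mass v"
    unfolding mass_def by (rule trans[OF vm])
  have "supp v \<inter> supp (\<lambda>x. v (T x)) = {}" using sub disj by blast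
  then show "\<exists>v'\<in>Cc_smooth A. supp v \<inter> supp v' = {} \<and> energy v' = energy v \<and> mass v' = mass v"
    using C E M by blast
qed

end

context riemannian
begin

text \<open>
  Whether a product chart contains a point does not depend on the Euclidean coordinate, so the same
  chart is selected.
\<close>

lemma chart_at_times_shift:
  "chart_at (riem_prod A (euclid :: (real^'n, 'n::finite) riem)) (x, y + b) = chart_at (riem_prod A euclid) (x, y)"
proof -
  have "(\<lambda>c. c \<in> riem_prod A (euclid :: (real^'n, 'n) riem) \<and> (x, y + b) \<in> chart_dom c) =
      (\<lambda>c. c \<in> riem_prod A euclid \<and> (x, y) \<in> chart_dom c)"
    by (rule ext) (auto simp: riem_prod_euclid)
  then show ?thesis unfolding chart_at_def by simp
qed

lemma chart_inv_times_shift: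
  fixes f :: "'a \<times> (real^'n::finite) \<Rightarrow> real"
  assumes c: "c \<in> A" and z: "left_vec z \<in> chart_image c"
  shows "((\<lambda>q. f (fst q, snd q + b)) \<circ> chart_inv (times_euclid c)) z = (f \<circ> chart_inv (times_euclid c)) (z + join_vec 0 b)"
proof -
  have "left_vec (z + join_vec 0 b) = left_vec z" "right_vec (z + join_vec 0 b) = right_vec z + b"
    by (simp_all add: vec_eq_iff)
  then show ?thesis using times_chart_inv[OF c z] times_chart_inv[OF c, of "z + join_vec 0 b"] z by simp
qed

lemma smooth_fun_times_shift:
  assumes f: "smooth_fun (riem_prod A (euclid :: (real^'n, 'n::finite) riem)) f"
  shows "smooth_fun (riem_prod A (euclid :: (real^'n, 'n) riem)) (\<lambda>q. f (fst q, snd q + b))"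
  unfolding smooth_fun_def riem_prod_euclid
proof
  fix c' assume "c' \<in> (times_euclid ` A :: ('a \<times> (real^'n), 'm + 'n) riem)"
  then obtain c where c: "c \<in> A" "c' = times_euclid c" by blast
  have o: "open (chart_image c')" using riemannian.open_image[OF riemannian_times] c by (auto simp: riem_prod_euclid)
  have im: "chart_image c' = {z. left_vec z \<in> chart_image c}" unfolding c(2) by (rule times_chart_image[OF c(1)])
  have "smooth_on (chart_image c') (\<lambda>z. (f \<circ> chart_inv c') (z + join_vec 0 b))"
  proof (rule smooth_on_shift[OF o])
    show "smooth_on (chart_image c') (f \<circ> chart_inv c')"
      using f c by (simp add: smooth_fun_def riem_prod_euclid)
    show "z + join_vec 0 b \<in> chart_image c'" if "z \<in> chart_image c'" for z
    proof -
      have "left_vec (z + join_vec 0 b) = left_vec z" by (simp add: vec_eq_iff)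
      then show ?thesis using that by (simp add: im)
    qed
  qed
  then show "smooth_on (chart_image c') ((\<lambda>q. f (fst q, snd q + b)) \<circ> chart_inv c')"
    by (rule smooth_on_cong[OF o, THEN iffD2, rotated]) (use chart_inv_times_shift[OF c(1)] c(2) im in auto)
qed

lemma grad_sq_times_shift:
  "grad_sq (riem_prod A (euclid :: (real^'n, 'n::finite) riem)) (\<lambda>q. f (fst q, snd q + b)) (x, y) =
    grad_sq (riem_prod A euclid) f (x, y + b)"
proof -
  let ?W = "riem_prod A (euclid :: (real^'n, 'n) riem)"
  have "chart_at ?W (x, y) \<in> ?W" "(x, y) \<in> chart_dom (chart_at ?W (x, y))"
    using riemannian.chart_at_works[OF riemannian_times] by auto
  then obtain c where c: "c \<in> A" "chart_at ?W (x, y) = times_euclid c" "x \<in> chart_dom c"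
    by (auto simp: riem_prod_euclid)
  let ?c = "times_euclid c :: ('a \<times> (real^'n), 'm + 'n) rchart"
  have c2: "chart_at ?W (x, y + b) = ?c" by (rule trans[OF chart_at_times_shift c(2)])
  define z where "z = join_vec (chart_map c x) y"
  have zb: "join_vec (chart_map c x) (y + b) = z + join_vec 0 b" by (simp add: z_def vec_sum_eq_iff)
  have im: "chart_image ?c = {z. left_vec z \<in> chart_image c}" by (rule times_chart_image[OF c(1)])
  have o: "open (chart_image ?c)" using riemannian.open_image[OF riemannian_times] c by (auto simp: riem_prod_euclid)
  have zi: "z \<in> chart_image ?c" using chart_map_in[OF c(1,3)] by (simp add: im z_def)
  have "partial i ((\<lambda>q. f (fst q, snd q + b)) \<circ> chart_inv ?c) z = partial i (\<lambda>z. (f \<circ> chart_inv ?c) (z + join_vec 0 b)) z" for i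
    by (rule partial_cong_open[OF o zi]) (use chart_inv_times_shift[OF c(1)] im in auto)
  then have "chart_grad ?c (\<lambda>q. f (fst q, snd q + b)) z = chart_grad ?c f (z + join_vec 0 b)"
    unfolding chart_grad_def partial_shift by simp
  moreover have "left_vec (z + join_vec 0 b) = left_vec z" by (simp add: vec_eq_iff)
  ultimately show ?thesis
    unfolding grad_sq_eq_chart_grad Let_def c(2) c2 by (simp add: zb z_def[symmetric])
qed

lemma grad_sq_times_snd:
  assumes u: "smooth_fun (euclid :: (real^'n, 'n::finite) riem) u"
  shows "grad_sq (riem_prod A (euclid :: (real^'n, 'n) riem)) (u \<circ> snd) (x, y) = grad_sq euclid u y"
proof -
  let ?W = "riem_prod A (euclid :: (real^'n, 'n) riem)"
  have "chart_at ?W (x, y) \<in> ?W" "(x, y) \<in> chart_dom (chart_at ?W (x, y))"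
    using riemannian.chart_at_works[OF riemannian_times] by auto
  then obtain c where c: "c \<in> A" "chart_at ?W (x, y) = times_euclid c" "x \<in> chart_dom c"
    by (auto simp: riem_prod_euclid)
  let ?c = "times_euclid c :: ('a \<times> (real^'n), 'm + 'n) rchart"
  define z where "z = join_vec (chart_map c x) y"
  have im: "chart_image ?c = {z. left_vec z \<in> chart_image c}" by (rule times_chart_image[OF c(1)])
  have o: "open (chart_image ?c)" using riemannian.open_image[OF riemannian_times] c by (auto simp: riem_prod_euclid)
  have zi: "z \<in> chart_image ?c" using chart_map_in[OF c(1,3)] by (simp add: im z_def)
  have rz: "right_vec z = y" "left_vec z = chart_map c x" by (simp_all add: z_def)
  have du: "u differentiable (at (right_vec z))"
    using u smooth_on_Suc[of UNIV u] by (simp add: smooth_fun_def euclid_def chart_inv_euclid o_def)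
  have P: "partial i ((u \<circ> snd) \<circ> chart_inv ?c) z = partial i (\<lambda>z. u (right_vec z)) z" for i
    by (rule partial_cong_open[OF o zi]) (simp add: im times_chart_inv[OF c(1)])
  have g: "chart_grad ?c (u \<circ> snd) z = join_vec 0 (\<chi> j. partial j u y)"
    unfolding vec_sum_eq_iff chart_grad_def using partial_right[OF du] by (simp add: P rz)
  have inv: "matrix_inv (chart_metric ?c z) = block_diag (matrix_inv (chart_metric c (chart_map c x))) (mat 1)"
    using block_diag_inv[OF inv_metric[OF c(1) chart_map_in[OF c(1,3)]]] by (simp add: rz)
  have "grad_sq ?W (u \<circ> snd) (x, y) = chart_grad ?c (u \<circ> snd) z \<bullet> (matrix_inv (chart_metric ?c z) *v chart_grad ?c (u \<circ> snd) z)"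
    unfolding grad_sq_eq_chart_grad Let_def c(2) by (simp add: z_def)
  also have "\<dots> = (\<Sum>j\<in>UNIV. (partial j u y)\<^sup>2)"
    unfolding g inv by (simp add: block_diag_vec inner_sum_vec) (simp add: inner_vec_def power2_eq_square)
  finally show ?thesis by (simp add: grad_sq_euclid)
qed

end

section \<open>The second Yamabe constant of a product with Euclidean space\<close>

lemma ereal_cmult_INF:
  fixes c :: real
  assumes "c > 0"
  shows "(INF x\<in>X. ereal c * f x) = ereal c * (INF x\<in>X. f x)"
  using ereal_Inf_cmult[OF assms, of "\<lambda>y. y \<in> f ` X"] by (simp add: image_image setcompr_eq_image)

text \<open>
  One inequality is monotonicity; the other one follows from it by scaling with \<open>1 / c\<close>.
\<close>

lemma ereal_cmult_SUP:
  fixes c :: real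
  assumes "c > 0"
  shows "(SUP x\<in>X. ereal c * f x) = ereal c * (SUP x\<in>X. f x)"
proof -
  have le: "(SUP x\<in>X. ereal c * f x) \<le> ereal c * (SUP x\<in>X. f x)" if "c > 0" for c :: real and f :: "_ \<Rightarrow> ereal"
    using that by (intro SUP_least ereal_mult_left_mono SUP_upper) auto
  have "ereal c * (SUP x\<in>X. f x) = ereal c * (SUP x\<in>X. ereal (1 / c) * (ereal c * f x))"
    using assms by (simp flip: mult.assoc)
  also have "\<dots> \<le> ereal c * (ereal (1 / c) * (SUP x\<in>X. ereal c * f x))"
    using assms by (intro ereal_mult_left_mono le) auto
  also have "\<dots> = (SUP x\<in>X. ereal c * f x)" using assms by (simp flip: mult.assoc)
  finally show ?thesis using le[OF assms, of f] by (intro antisym)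
qed

lemma lborel_distr_translation: "distr lborel borel (\<lambda>y. y + b) = (lborel :: 'e::euclidean_space measure)"
proof -
  have "(\<lambda>y. y + b) = (+) b" by (rule ext) (simp add: add.commute)
  then show ?thesis using lborel_distr_plus[of b] by simp
qed

lemma smooth_fun_euclid: "smooth_fun (euclid :: (real^'n, 'n::finite) riem) f \<longleftrightarrow> smooth_on UNIV f"
  by (simp add: smooth_fun_def euclid_def chart_inv_euclid o_def)

lemma second_inf_eq_euclid:
  fixes c :: real and a :: real
  assumes "yamabe_data (euclid :: (real^'n, 'n::finite) riem) (\<lambda>_. c) a k"
  shows "yamabe_data.second_inf (euclid :: (real^'n, 'n) riem) (\<lambda>_. c) a k =
    ereal (2 powr (2 / real k)) * yamabe_data.yamabe_inf (euclid :: (real^'n, 'n) riem) (\<lambda>_. c) a k"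
proof -
  interpret yamabe_data "euclid :: (real^'n, 'n) riem" "\<lambda>_. c" a k by (rule assms)
  show ?thesis
  proof (rule second_inf_eq_translations)
    fix K :: "(real^'n) set" assume "compact K"
    then obtain b where b: "\<forall>y\<in>K. y + b \<notin> K" using translation_disjoint compact_imp_bounded by blast
    have gr: "grad_sq euclid (\<lambda>x. f (x + b)) x = grad_sq euclid f (x + b)" for f and x :: "real^'n"
      by (simp add: grad_sq_euclid partial_shift)
    have sm: "smooth_fun (euclid :: (real^'n, 'n) riem) (\<lambda>x. f (x + b))" if "smooth_fun (euclid :: (real^'n, 'n) riem) f" for f
      using that unfolding smooth_fun_euclid by (intro smooth_on_shift[of _ UNIV]) auto
    have co: "continuous_on UNIV (\<lambda>y. y + - b)" by (intro continuous_intros)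
    show "\<exists>T T'. continuous_on UNIV T \<and> continuous_on UNIV T' \<and> (\<forall>x. T (T' x) = x) \<and> (\<forall>x. T' (T x) = x) \<and>
      distr (vol euclid) borel T = vol (euclid :: (real^'n, 'n) riem) \<and>
      (\<forall>f. smooth_fun (euclid :: (real^'n, 'n) riem) f \<longrightarrow> smooth_fun (euclid :: (real^'n, 'n) riem) (\<lambda>x. f (T x))) \<and>
      (\<forall>f x. grad_sq euclid (\<lambda>x. f (T x)) x = grad_sq (euclid :: (real^'n, 'n) riem) f (T x)) \<and> (\<forall>x. c = c) \<and> (\<forall>x\<in>K. T x \<notin> K)"
      using lborel_distr_translation[of b] co continuous_on_add[OF continuous_on_id continuous_on_const, of UNIV b] gr sm b
      by (intro exI[of _ "\<lambda>y. y + b"] exI[of _ "\<lambda>y. y + - b"] conjI allI impI) (auto simp: vol_euclid)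
  qed
qed

context riemannian
begin

lemma second_inf_eq_times:
  assumes cpt: "compact (UNIV :: 'a set)"
    and Y: "yamabe_data (riem_prod A (euclid :: (real^'n, 'n::finite) riem)) (scal (riem_prod A (euclid :: (real^'n, 'n) riem))) a k"
  shows "yamabe_data.second_inf (riem_prod A (euclid :: (real^'n, 'n) riem)) (scal (riem_prod A (euclid :: (real^'n, 'n) riem))) a k =
    ereal (2 powr (2 / real k)) * yamabe_data.yamabe_inf (riem_prod A (euclid :: (real^'n, 'n) riem)) (scal (riem_prod A (euclid :: (real^'n, 'n) riem))) a k"
proof -
  let ?W = "riem_prod A (euclid :: (real^'n, 'n) riem)"
  interpret W: yamabe_data ?W "scal ?W" a k by (rule Y)
  interpret finite_measure "vol A"
    using vol_compact_finite[OF cpt] by (intro finite_measureI) auto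
  show ?thesis
  proof (rule W.second_inf_eq_translations)
    fix K :: "('a \<times> (real^'n)) set" assume K: "compact K"
    have "compact (snd ` K)" by (rule compact_continuous_image[OF _ K]) (intro continuous_intros)
    then obtain b where b: "\<forall>y\<in>snd ` K. y + b \<notin> snd ` K"
      using translation_disjoint compact_imp_bounded by blast
    define T where "T b q = (fst q, snd q + b)" for b and q :: "'a \<times> (real^'n)"
    have cT: "continuous_on UNIV (T b)" for b unfolding T_def[abs_def] by (intro continuous_intros)
    have TT: "T b (T (- b) q) = q" "T (- b) (T b q) = q" for q by (simp_all add: T_def)
    have gr: "grad_sq ?W (\<lambda>q. f (T b q)) q = grad_sq ?W f (T b q)" for f q
      using grad_sq_times_shift[of f b "fst q" "snd q"] by (simp add: T_def)
    have sm: "smooth_fun ?W (\<lambda>q. f (T b q))" if "smooth_fun ?W f" for f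
      unfolding T_def by (rule smooth_fun_times_shift[OF that])
    have sc: "scal ?W (T b q) = scal ?W q" for q by (cases q) (simp add: T_def scal_times)
    have d: "distr (vol ?W) borel (T b) = vol ?W"
    proof -
      have l: "distr lborel lborel (\<lambda>y. y + b) = (lborel :: (real^'n) measure)"
        using lborel_distr_translation[of b] distr_cong[of lborel lborel lborel borel "\<lambda>y. y + b" "\<lambda>y. y + b"] by simp
      have "vol A \<Otimes>\<^sub>M (lborel :: (real^'n) measure) = distr (vol A) (vol A) (\<lambda>x. x) \<Otimes>\<^sub>M distr lborel lborel (\<lambda>y. y + b)"
        by (simp add: l distr_id2)
      also have "\<dots> = distr (vol A \<Otimes>\<^sub>M lborel) (vol A \<Otimes>\<^sub>M lborel) (\<lambda>(x, y). (x, y + b))"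
        by (rule pair_measure_distr) (simp_all add: l lborel.sigma_finite_measure_axioms)
      finally have "distr (vol ?W) (vol ?W) (T b) = vol ?W"
        by (simp add: vol_times[OF cpt] T_def[abs_def] case_prod_beta')
      moreover have "distr (vol ?W) borel (T b) = distr (vol ?W) (vol ?W) (T b)"
        by (rule distr_cong) auto
      ultimately show ?thesis by simp
    qed
    have disj: "\<forall>q\<in>K. T b q \<notin> K"
    proof (intro ballI notI)
      fix q assume "q \<in> K" "T b q \<in> K"
      then have "snd q \<in> snd ` K" "snd (T b q) \<in> snd ` K" by blast+
      then show False using b by (simp add: T_def)
    qed
    show "\<exists>T T'. continuous_on UNIV T \<and> continuous_on UNIV T' \<and> (\<forall>x. T (T' x) = x) \<and> (\<forall>x. T' (T x) = x) \<and>
      distr (vol ?W) borel T = vol ?W \<and> (\<forall>f. smooth_fun ?W f \<longrightarrow> smooth_fun ?W (\<lambda>x. f (T x))) \<and>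
      (\<forall>f x. grad_sq ?W (\<lambda>x. f (T x)) x = grad_sq ?W f (T x)) \<and> (\<forall>x. scal ?W (T x) = scal ?W x) \<and> (\<forall>x\<in>K. T x \<notin> K)"
      by (rule exI[of _ "T b"], rule exI[of _ "T (- b)"]) (use cT TT gr sm sc d disj in blast)
  qed
qed

text \<open>
  The image of the product measure under the projection is Lebesgue measure times the total volume.
\<close>

lemma integral_times_snd:
  fixes h :: "real^'n::finite \<Rightarrow> real"
  assumes cpt: "compact (UNIV :: 'a set)" and h: "h \<in> borel_measurable borel"
  shows "(\<integral>z. h (snd z) \<partial>vol (riem_prod A (euclid :: (real^'n, 'n) riem))) = measure (vol A) UNIV * (\<integral>y. h y \<partial>lborel)"
proof -
  interpret finite_measure "vol A"
    using vol_compact_finite[OF cpt] by (intro finite_measureI) auto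
  let ?m = "measure (vol A) UNIV"
  have d: "distr (vol A \<Otimes>\<^sub>M lborel) lborel snd = density (lborel :: (real^'n) measure) (\<lambda>_. ennreal ?m)"
  proof (rule measure_eqI)
    fix B :: "(real^'n) set" assume "B \<in> sets (distr (vol A \<Otimes>\<^sub>M lborel) lborel snd)"
    then have B: "B \<in> sets borel" by simp
    have "snd -` B \<inter> space (vol A \<Otimes>\<^sub>M lborel) = UNIV \<times> B" by (auto simp: space_pair_measure)
    then have "emeasure (distr (vol A \<Otimes>\<^sub>M lborel) lborel snd) B = emeasure (vol A) UNIV * emeasure lborel B"
      using B by (simp add: emeasure_distr lborel.emeasure_pair_measure_Times)
    then show "emeasure (distr (vol A \<Otimes>\<^sub>M lborel) lborel snd) B = emeasure (density lborel (\<lambda>_. ennreal ?m)) B"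
      using B by (simp add: emeasure_density_const emeasure_eq_measure)
  qed simp
  have "(\<integral>z. h (snd z) \<partial>vol (riem_prod A (euclid :: (real^'n, 'n) riem))) = (\<integral>y. h y \<partial>distr (vol A \<Otimes>\<^sub>M lborel) lborel snd)"
    using h by (simp add: vol_times[OF cpt] integral_distr)
  also have "\<dots> = (\<integral>y. ?m * h y \<partial>lborel)"
    unfolding d using h by (subst integral_density) auto
  finally show ?thesis by simp
qed

end

theorem theorem1p4:
  fixes M :: "('a::{t2_space,second_countable_topology}, 'm::finite) riem"
  assumes "closed_riemannian_manifold M"
    and "\<forall>x. scal M x > 0"
  shows "yamabe_l 2 (riem_prod M (euclid :: (real^'n, 'n::finite) riem))
           = ereal (2 powr (2 / real (CARD('m) + CARD('n))))
             * yamabe_const (riem_prod M (euclid :: (real^'n, 'n) riem))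
       \<and> ((\<exists>s. \<forall>x. scal M x = s) \<longrightarrow>
           yamabe_l_N 2 M (euclid :: (real^'n, 'n) riem)
             = ereal (2 powr (2 / real (CARD('m) + CARD('n))))
               * yamabe_const_Rn M TYPE('n))"
proof -
  let ?E = "euclid :: (real^'n, 'n) riem"
  let ?W = "riem_prod M ?E"
  define k where "k = CARD('m) + CARD('n)"
  interpret M: riemannian M
    using assms(1) by unfold_locales (simp add: closed_riemannian_manifold_def)
  have cpt: "compact (UNIV :: 'a set)" using assms(1) by (simp add: closed_riemannian_manifold_def)
  have m2: "CARD('m) \<ge> 2"
  proof (rule ccontr)
    assume "\<not> CARD('m) \<ge> 2"
    moreover have "CARD('m) > 0" by simp
    ultimately have "CARD('m) = 1" by linarith
    then have "scal M undefined = 0" by (simp add: scal_def Let_def local_scal_dim_1)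
    then show False using assms(2) by (metis less_irrefl)
  qed
  have n1: "CARD('n) > 0" by simp
  have k3: "k \<ge> 3" using m2 n1 unfolding k_def by linarith
  have a0: "yam_a k \<ge> 0" using k3 by (simp add: yam_a_def)
  interpret R: riemannian ?W by (rule M.riemannian_times)
  have YW: "yamabe_data ?W (scal ?W) (yam_a k) k"
  proof unfold_locales
    show "continuous_on UNIV (scal ?W)" by (rule R.continuous_scal)
    show "scal ?W q \<ge> 0" for q using assms(2) by (cases q) (simp add: M.scal_times less_imp_le)
  qed (rule a0 k3)+
  interpret W: yamabe_data ?W "scal ?W" "yam_a k" k by (rule YW)
  have card: "CARD('m + 'n) = k" by (simp add: k_def card_UNIV_sum)
  have 1: "yamabe_l 2 ?W = W.second_inf" "yamabe_const ?W = W.yamabe_inf"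
    unfolding yamabe_l_def yamabe_const_def Let_def card W.second_inf_def W.yamabe_inf_def
      W.energy_def W.dens_def[abs_def] W.weighted_def W.mass_def W.p_def by (rule refl)+
  have part1: "yamabe_l 2 ?W = ereal (2 powr (2 / real k)) * yamabe_const ?W"
    unfolding 1 by (rule M.second_inf_eq_times[OF cpt YW])
  have part2: "yamabe_l_N 2 M ?E = ereal (2 powr (2 / real k)) * yamabe_const_Rn M TYPE('n)"
    if s: "\<forall>x. scal M x = s" for s
  proof -
    have YE: "yamabe_data ?E (\<lambda>_. s) (yam_a k) k"
    proof (intro yamabe_data.intro riemannian_euclid yamabe_data_axioms.intro)
      show "0 \<le> s" using assms(2) s by (metis less_imp_le)
    qed (auto intro: a0 k3)
    interpret E: yamabe_data ?E "\<lambda>_. s" "yam_a k" k by (rule YE)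
    define m where "m = measure (vol M) UNIV"
    have m: "m > 0"
    proof -
      have "emeasure (vol M) UNIV > 0" by (rule M.vol_open_pos) auto
      moreover have "emeasure (vol M) UNIV < \<infinity>" by (rule M.vol_compact_finite[OF cpt])
      ultimately show ?thesis by (simp add: m_def measure_def enn2real_positive_iff)
    qed
    \<comment> \<open>The volume of the closed factor enters both sides with the exponent \<open>2 / k = 1 - 2 / p\<close>.\<close>
    define \<mu> where "\<mu> = m powr (2 / real k)"
    have \<mu>: "\<mu> > 0" using m by (simp add: \<mu>_def)
    have N: "yamabe_l_N 2 M ?E = ereal \<mu> * E.second_inf"
    proof -
      have sc: "scal (riem_prod M ?E) (undefined, y) = s" for y using s by (simp add: M.scal_times)
      have "yamabe_l_N 2 M ?E = (INF u \<in> Lp_nonneg_c ?E E.p. INF V \<in> Gr ?E E.p 2 u. SUP v \<in> V - {\<lambda>_. 0}.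
          ereal \<mu> * ereal (E.energy v / E.weighted u v * (\<integral>x. u x powr E.p \<partial>vol ?E) powr (2 / real k)))"
        unfolding yamabe_l_N_def Let_def k_def[symmetric] sc m_def[symmetric] \<mu>_def[symmetric]
          E.energy_def E.dens_def[abs_def] E.weighted_def E.p_def by (simp add: mult.commute)
      also have "\<dots> = ereal \<mu> * E.second_inf"
        unfolding ereal_cmult_SUP[OF \<mu>] ereal_cmult_INF[OF \<mu>] E.second_inf_def ..
      finally show ?thesis .
    qed
    have C: "yamabe_const_Rn M TYPE('n) = ereal \<mu> * E.yamabe_inf"
    proof -
      have "yamabe_const_Rn M TYPE('n) = (INF u \<in> Cc_smooth ?E - {\<lambda>_. 0}. ereal \<mu> * ereal (E.energy u / E.mass u powr (2 / E.p)))"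
        unfolding yamabe_const_Rn_def Let_def k_def[symmetric]
      proof (rule INF_cong[OF refl])
        fix u assume "u \<in> Cc_smooth ?E - {\<lambda>_. 0}"
        then have u: "u \<in> Cc_smooth ?E" "u \<noteq> (\<lambda>_. 0)" by auto
        have g: "yam_a k * grad_sq ?W (u \<circ> snd) z + scal M (fst z) * (u (snd z))\<^sup>2 = E.dens u (snd z)" for z
          using M.grad_sq_times_snd[OF E.Cc_smooth_fun[OF u(1)], of "fst z" "snd z"] s by (simp add: E.dens_def)
        have n: "(\<integral>z. yam_a k * grad_sq ?W (u \<circ> snd) z + scal M (fst z) * (u (snd z))\<^sup>2 \<partial>vol ?W) = m * E.energy u"
          unfolding g E.energy_def vol_euclid m_def
          by (rule M.integral_times_snd[OF cpt borel_measurable_continuous_onI[OF E.continuous_dens[OF u(1)]]])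
        have um: "(\<lambda>y. \<bar>u y\<bar> powr E.p) \<in> borel_measurable borel"
          using E.mass_integrable[OF u(1)] borel_measurable_integrable E.borel_measurable_vol_iff by blast
        have d: "(\<integral>z. \<bar>u (snd z)\<bar> powr E.p \<partial>vol ?W) = m * E.mass u"
          using M.integral_times_snd[OF cpt um] by (simp add: E.mass_def vol_euclid m_def)
        have mm: "m / m powr (2 / E.p) = \<mu>"
        proof -
          have "\<mu> * m powr (2 / E.p) = m powr 1"
            unfolding \<mu>_def powr_add[symmetric] E.p_facts(2) by simp
          then show ?thesis using m by (simp add: field_simps)
        qed
        have "m * E.energy u / (m * E.mass u) powr (2 / E.p) = m / m powr (2 / E.p) * (E.energy u / E.mass u powr (2 / E.p))"
          using m E.mass_nonneg[of u] by (simp add: powr_mult)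
        then show "ereal ((\<integral>z. yam_a k * grad_sq ?W (u \<circ> snd) z + scal M (fst z) * (u (snd z))\<^sup>2 \<partial>vol ?W) /
            (\<integral>z. \<bar>u (snd z)\<bar> powr yam_p k \<partial>vol ?W) powr (2 / yam_p k)) =
          ereal \<mu> * ereal (E.energy u / E.mass u powr (2 / E.p))"
          unfolding E.p_def[symmetric] n d mm by simp
      qed
      then show ?thesis unfolding ereal_cmult_INF[OF \<mu>] E.yamabe_inf_def .
    qed
    have "E.second_inf = ereal (2 powr (2 / real k)) * E.yamabe_inf" by (rule second_inf_eq_euclid[OF YE])
    then show ?thesis unfolding N C by (simp only: mult.left_commute)
  qed
  show ?thesis using part1 part2 unfolding k_def by blast
qed

end
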